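(* Let $\mathcal{H}_A,\mathcal{H}_B$ be finite-dimensional, let $\mathcal{V}_A\subseteq\mathcal{U}(\mathcal{H}_A)$ and $\mathcal{V}_B\subseteq\mathcal{U}(\mathcal{H}_B)$ be closed subgroups, let $\Psi_{A\to A}$ on $\mathcal{B}(\mathcal{H}_A)$ and $\Psi_{B\to B}$ on $\mathcal{B}(\mathcal{H}_B)$ be linear maps covariant with respect to $\mathcal{V}_A$ and $\mathcal{V}_B$ respectively, let $X_A\in\mathcal{B}(\mathcal{H}_A)$, $X_B\in\mathcal{B}(\mathcal{H}_B)$, and let $H_{AB}$ be a Hermitian operator on $\mathcal{H}_A\otimes\mathcal{H}_B$ with $(V_A\otimes V_B)H_{AB}(V_A\otimes V_B)^\dagger=H_{AB}$ for all $V_A\in\mathcal{V}_A$, $V_B\in\mathcal{V}_B$. Let $$c_{\mathrm{opt}}=\sup\{\mathrm{tr}[H_{AB}\,\rho_A\otimes\rho_B]:\rho_A\in\mathcal{S}(\mathcal{H}_A),\ \rho_B\in\mathcal{S}(\mathcal{H}_B),\ \Psi_{A\to A}(\rho_A)=X_A,\ \Psi_{B\to B}(\rho_B)=X_B\}.$$ For $n\in\mathbb{N}$ let $c^{(n)}$ be the supremum of $\mathrm{tr}[H_{AB}\,\rho_{AB_1}]$ over all states $\rho_{AB_1^n}\in\mathcal{S}(\mathcal{H}_A\otimes\mathcal{H}_B^{\otimes n})$ such that $$(\Psi_{A\to A}\otimes\mathrm{id}_{B_1^n})(\rho_{AB_1^n})=X_A\otimes\rho_{B_1^n},\qquad(\mathrm{id}_{AB_1^{n-1}}\otimes\Psi_{B\to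 B})(\rho_{AB_1^n})=\rho_{AB_1^{n-1}}\otimes X_B,\qquad\rho_{AB_1^n}\in\mathcal{A}'_{\mathcal{V}_A\times\mathcal{V}_B\times S_n}.$$ Then $$c^{(n)}-c_{\mathrm{opt}}\le\lVert H_{AB}\rVert_\infty\,2\,m_{B,\max}\sqrt{\frac{2\ln2\,\log\big(\sum_{i=1}^{k_A}m_{i,A}^2\big)}{n}},$$ where $m_{1,A},\dots,m_{k_A,A}$ are the block dimensions of the fixed point algebra (commutant) of $\mathcal{V}_A$ and $m_{B,\max}=\max_{1\le i\le k_B}m_{i,B}$ is the largest block size of the fixed point algebra (commutant) of $\mathcal{V}_B$.
   Context: $\log$ is base 2. A linear map $\Psi$ on $\mathcal{B}(\mathcal{H})$ is covariant with respect to $\mathcal{V}\subseteq\mathcal{U}(\mathcal{H})$ if $\Psi(VXV^\dagger)=V\Psi(X)V^\dagger$ for all $X$ and all $V\in\mathcal{V}$. $\mathcal{A}'_{\mathcal{V}_A\times\mathcal{V}_B\times S_n}$ is the commutant in $\mathcal{B}(\mathcal{H}_A\otimes\mathcal{H}_B^{\otimes n})$ of the $*$-algebra generated by $V_A\otimes1$ ($V_A\in\mathcal{V}_A$), $1_A\otimes V_B^{\otimes n}$ ($V_B\in\mathcal{V}_B$), and $1_A\otimes U(\sigma)$ ($\sigma\in S_n$ permuting the $B$-factors). The commutant $\mathcal{V}'=\{X:XV=VX\ \forall V\in\mathcal{V}\}$ is the fixed point algebra of the Haar twirl over $\mathcal{V}$ and is isomorphic to $\bigoplus_iM_{m_i}(\mathbb{C})$;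 the $m_i$ are its block dimensions. Suprema over the empty set are $-\infty$ and the bound is read as $c^{(n)}\le c_{\mathrm{opt}}+\dots$. *)

theory Defs
  imports
    "Jordan_Normal_Form.Schur_Decomposition"
    "HOL-Combinatorics.Permutations"
    "HOL-Algebra.Group"
    "HOL-Analysis.Function_Topology"
    "HOL-Library.Extended_Real"
begin

text \<open>
  A Hilbert space of dimension \<open>d\<close> is identified with the \<open>d\<close>-dimensional complex column
  vectors, and its algebra of operators with \<open>carrier_mat d d\<close>. Tensor products are Kronecker
  products, so that the basis vector \<open>i \<otimes> k\<close> of a product of spaces of dimensions \<open>d1\<close>, \<open>d2\<close>
  has index \<open>i * d2 + k\<close>. As this convention is associative, the operators on
  \<open>A \<otimes> B\<^sub>1 \<otimes> \<dots> \<otimes> B\<^sub>n\<close> are \<open>carrier_mat (dA * dB ^ n) (dA * dB ^ n)\<close>, with the index of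
  \<open>B\<^sub>1\<close> the most significant base-\<open>dB\<close> digit among the \<open>B\<close>-indices.
\<close>

section \<open>Operators\<close>

definition tr :: "complex mat \<Rightarrow> complex" where
  "tr M = (\<Sum>i<dim_row M. M $$ (i, i))"

definition hermitian_mat :: "nat \<Rightarrow> complex mat \<Rightarrow> bool" where
  "hermitian_mat d M \<longleftrightarrow> M \<in> carrier_mat d d \<and> mat_adjoint M = M"

text \<open>The order on \<^typ>\<open>complex\<close> is such that \<open>0 \<le> z\<close> means that \<open>z\<close> is real and nonnegative.\<close>

definition positive_mat :: "nat \<Rightarrow> complex mat \<Rightarrow> bool" where
  "positive_mat d M \<longleftrightarrow> hermitian_mat d M \<and> (\<forall>v \<in> carrier_vec d. 0 \<le> (M *\<^sub>v v) \<bullet>c v)"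

definition states :: "nat \<Rightarrow> complex mat set" where
  "states d = {\<rho>. positive_mat d \<rho> \<and> tr \<rho> = 1}"

definition vec_norm2 :: "complex vec \<Rightarrow> real" where
  "vec_norm2 v = sqrt (Re (v \<bullet>c v))"

definition op_norm :: "complex mat \<Rightarrow> real" where
  "op_norm M = Sup {vec_norm2 (M *\<^sub>v v) | v. v \<in> carrier_vec (dim_col M) \<and> vec_norm2 v = 1}"

section \<open>Tensor products and partial traces\<close>

definition tensor_mat :: "complex mat \<Rightarrow> complex mat \<Rightarrow> complex mat" (infixl "\<otimes>\<^sub>m" 70) where
  "A \<otimes>\<^sub>m B = mat (dim_row A * dim_row B) (dim_col A * dim_col B)
     (\<lambda>(r, c). A $$ (r div dim_row B, c div dim_col B) * B $$ (r mod dim_row B, c mod dim_col B))"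

fun tensor_pow :: "complex mat \<Rightarrow> nat \<Rightarrow> complex mat" where
  "tensor_pow V 0 = 1\<^sub>m 1"
| "tensor_pow V (Suc n) = tensor_pow V n \<otimes>\<^sub>m V"

definition mat_unit :: "nat \<Rightarrow> nat \<Rightarrow> nat \<Rightarrow> complex mat" where
  "mat_unit d i j = mat d d (\<lambda>(r, c). if r = i \<and> c = j then 1 else 0)"

text \<open>
  The tensor product of linear maps \<open>\<Psi>\<close>, \<open>\<Phi>\<close> on the operators in dimensions \<open>d1\<close>, \<open>d2\<close>: expand
  \<open>M\<close> in the products \<open>E\<^sub>i\<^sub>j \<otimes> E\<^sub>k\<^sub>l\<close> of matrix units and map each of these to
  \<open>\<Psi>(E\<^sub>i\<^sub>j) \<otimes> \<Phi>(E\<^sub>k\<^sub>l)\<close>. The sum is taken entrywise because matrices of varying dimension have no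
  sum over finite index sets.
\<close>

definition tensor_map ::
  "nat \<Rightarrow> (complex mat \<Rightarrow> complex mat) \<Rightarrow> nat \<Rightarrow> (complex mat \<Rightarrow> complex mat)
    \<Rightarrow> complex mat \<Rightarrow> complex mat" where
  "tensor_map d1 \<Psi> d2 \<Phi> M = mat (d1 * d2) (d1 * d2) (\<lambda>(r, c).
     \<Sum>i<d1. \<Sum>j<d1. \<Sum>k<d2. \<Sum>l<d2.
       M $$ (i * d2 + k, j * d2 + l) * (\<Psi> (mat_unit d1 i j) \<otimes>\<^sub>m \<Phi> (mat_unit d2 k l)) $$ (r, c))"

text \<open>\<open>ptrace_fst\<close> traces out the first tensor factor, \<open>ptrace_snd\<close> the second.\<close>

definition ptrace_fst :: "nat \<Rightarrow> nat \<Rightarrow> complex mat \<Rightarrow> complex mat" where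
  "ptrace_fst d1 d2 M = mat d2 d2 (\<lambda>(k, l). \<Sum>i<d1. M $$ (i * d2 + k, i * d2 + l))"

definition ptrace_snd :: "nat \<Rightarrow> nat \<Rightarrow> complex mat \<Rightarrow> complex mat" where
  "ptrace_snd d1 d2 M = mat d1 d1 (\<lambda>(i, j). \<Sum>k<d2. M $$ (i * d2 + k, j * d2 + k))"

text \<open>
  \<open>tensor_digit d n r t\<close> is the index of the factor number \<open>t < n\<close>, counted from \<open>0\<close>, in the basis
  vector \<open>r < d ^ n\<close> of the \<open>n\<close>-fold tensor power. The operator \<open>perm_op d n \<sigma>\<close> moves the
  content of factor \<open>t\<close> to factor \<open>\<sigma> t\<close>.
\<close>

definition tensor_digit :: "nat \<Rightarrow> nat \<Rightarrow> nat \<Rightarrow> nat \<Rightarrow> nat" where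
  "tensor_digit d n r t = r div d ^ (n - 1 - t) mod d"

definition perm_op :: "nat \<Rightarrow> nat \<Rightarrow> (nat \<Rightarrow> nat) \<Rightarrow> complex mat" where
  "perm_op d n \<sigma> = mat (d ^ n) (d ^ n)
     (\<lambda>(r, c). if \<forall>t<n. tensor_digit d n r (\<sigma> t) = tensor_digit d n c t then 1 else 0)"

section \<open>Symmetries\<close>

definition unitary_group :: "nat \<Rightarrow> complex mat monoid" where
  "unitary_group d =
     \<lparr>carrier = {U \<in> carrier_mat d d. U * mat_adjoint U = 1\<^sub>m d \<and> mat_adjoint U * U = 1\<^sub>m d},
      monoid.mult = (*), one = 1\<^sub>m d\<rparr>"

text \<open>
  Matrices carry no topology in the library; a set of \<open>d \<times> d\<close> matrices is closed if the set of
  families of entries, in the topology of entrywise convergence, is. The extensional restriction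
  gives all families the same value at the irrelevant indices.
\<close>

definition closed_mats :: "nat \<Rightarrow> complex mat set \<Rightarrow> bool" where
  "closed_mats d S \<longleftrightarrow> closed ((\<lambda>M. restrict (\<lambda>p. M $$ p) ({..<d} \<times> {..<d})) ` S)"

definition closed_unitary_subgroup :: "nat \<Rightarrow> complex mat set \<Rightarrow> bool" where
  "closed_unitary_subgroup d V \<longleftrightarrow> subgroup V (unitary_group d) \<and> closed_mats d V"

definition linear_map_on_mats :: "nat \<Rightarrow> (complex mat \<Rightarrow> complex mat) \<Rightarrow> bool" where
  "linear_map_on_mats d \<Psi> \<longleftrightarrow>
     (\<forall>X \<in> carrier_mat d d. \<Psi> X \<in> carrier_mat d d) \<and>
     (\<forall>X \<in> carrier_mat d d. \<forall>Y \<in> carrier_mat d d. \<Psi> (X + Y) = \<Psi> X + \<Psi> Y) \<and>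
     (\<forall>c. \<forall>X \<in> carrier_mat d d. \<Psi> (c \<cdot>\<^sub>m X) = c \<cdot>\<^sub>m \<Psi> X)"

definition covariant :: "nat \<Rightarrow> complex mat set \<Rightarrow> (complex mat \<Rightarrow> complex mat) \<Rightarrow> bool" where
  "covariant d \<V> \<Psi> \<longleftrightarrow>
     (\<forall>X \<in> carrier_mat d d. \<forall>V \<in> \<V>. \<Psi> (V * X * mat_adjoint V) = V * \<Psi> X * mat_adjoint V)"

inductive_set star_algebra :: "complex mat set \<Rightarrow> complex mat set" for S where
  gen: "X \<in> S \<Longrightarrow> X \<in> star_algebra S"
| add: "X \<in> star_algebra S \<Longrightarrow> Y \<in> star_algebra S \<Longrightarrow> X + Y \<in> star_algebra S"
| smult: "X \<in> star_algebra S \<Longrightarrow> c \<cdot>\<^sub>m X \<in> star_algebra S"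
| mult: "X \<in> star_algebra S \<Longrightarrow> Y \<in> star_algebra S \<Longrightarrow> X * Y \<in> star_algebra S"
| adj: "X \<in> star_algebra S \<Longrightarrow> mat_adjoint X \<in> star_algebra S"

definition commutant :: "nat \<Rightarrow> complex mat set \<Rightarrow> complex mat set" where
  "commutant d S = {X \<in> carrier_mat d d. \<forall>V \<in> S. X * V = V * X}"

definition sym_generators ::
  "nat \<Rightarrow> nat \<Rightarrow> complex mat set \<Rightarrow> complex mat set \<Rightarrow> nat \<Rightarrow> complex mat set" where
  "sym_generators dA dB \<V>\<^sub>A \<V>\<^sub>B n =
     {V \<otimes>\<^sub>m 1\<^sub>m (dB ^ n) | V. V \<in> \<V>\<^sub>A} \<union>
     {1\<^sub>m dA \<otimes>\<^sub>m tensor_pow V n | V. V \<in> \<V>\<^sub>B} \<union>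
     {1\<^sub>m dA \<otimes>\<^sub>m perm_op dB n \<sigma> | \<sigma>. \<sigma> permutes {..<n}}"

definition sym_commutant ::
  "nat \<Rightarrow> nat \<Rightarrow> complex mat set \<Rightarrow> complex mat set \<Rightarrow> nat \<Rightarrow> complex mat set" where
  "sym_commutant dA dB \<V>\<^sub>A \<V>\<^sub>B n =
     commutant (dA * dB ^ n) (star_algebra (sym_generators dA dB \<V>\<^sub>A \<V>\<^sub>B n))"

text \<open>
  \<open>has_block_dims \<A> k m\<close>: the matrix algebra \<open>\<A>\<close> is isomorphic, as a
  \<open>*\<close>-algebra, to the direct sum of the full matrix algebras of sizes \<open>m 1, \<dots>, m k\<close>, all nonzero.
\<close>

definition has_block_dims :: "complex mat set \<Rightarrow> nat \<Rightarrow> (nat \<Rightarrow> nat) \<Rightarrow> bool" where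
  "has_block_dims \<A> k m \<longleftrightarrow>
     (\<forall>i \<in> {1..k}. 0 < m i) \<and>
     (\<exists>\<phi> :: complex mat \<Rightarrow> nat \<Rightarrow> complex mat.
        bij_betw \<phi> \<A> (\<Pi>\<^sub>E i \<in> {1..k}. carrier_mat (m i) (m i)) \<and>
        (\<forall>i \<in> {1..k}.
           (\<forall>X \<in> \<A>. \<forall>Y \<in> \<A>. \<phi> (X + Y) i = \<phi> X i + \<phi> Y i) \<and>
           (\<forall>c. \<forall>X \<in> \<A>. \<phi> (c \<cdot>\<^sub>m X) i = c \<cdot>\<^sub>m \<phi> X i) \<and>
           (\<forall>X \<in> \<A>. \<forall>Y \<in> \<A>. \<phi> (X * Y) i = \<phi> X i * \<phi> Y i) \<and>
           (\<forall>X \<in> \<A>. \<phi> (mat_adjoint X) i = mat_adjoint (\<phi> X i))))"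

section \<open>The optimization problem and its relaxations\<close>

text \<open>
  The suprema are taken in the extended reals, where the supremum of the empty set is \<open>-\<infinity>\<close>. The
  traces are real, as products of two Hermitian operators are traced.
\<close>

definition c_opt ::
  "nat \<Rightarrow> nat \<Rightarrow> (complex mat \<Rightarrow> complex mat) \<Rightarrow> (complex mat \<Rightarrow> complex mat)
    \<Rightarrow> complex mat \<Rightarrow> complex mat \<Rightarrow> complex mat \<Rightarrow> ereal" where
  "c_opt dA dB \<Psi>\<^sub>A \<Psi>\<^sub>B X\<^sub>A X\<^sub>B H =
     Sup {ereal (Re (tr (H * (\<rho>\<^sub>A \<otimes>\<^sub>m \<rho>\<^sub>B)))) | \<rho>\<^sub>A \<rho>\<^sub>B.
       \<rho>\<^sub>A \<in> states dA \<and> \<rho>\<^sub>B \<in> states dB \<and> \<Psi>\<^sub>A \<rho>\<^sub>A = X\<^sub>A \<and> \<Psi>\<^sub>B \<rho>\<^sub>B = X\<^sub>B}"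

definition feasible_ext ::
  "nat \<Rightarrow> nat \<Rightarrow> complex mat set \<Rightarrow> complex mat set
    \<Rightarrow> (complex mat \<Rightarrow> complex mat) \<Rightarrow> (complex mat \<Rightarrow> complex mat)
    \<Rightarrow> complex mat \<Rightarrow> complex mat \<Rightarrow> nat \<Rightarrow> complex mat set" where
  "feasible_ext dA dB \<V>\<^sub>A \<V>\<^sub>B \<Psi>\<^sub>A \<Psi>\<^sub>B X\<^sub>A X\<^sub>B n =
     {\<rho> \<in> states (dA * dB ^ n).
        tensor_map dA \<Psi>\<^sub>A (dB ^ n) id \<rho> = X\<^sub>A \<otimes>\<^sub>m ptrace_fst dA (dB ^ n) \<rho> \<and>
        tensor_map (dA * dB ^ (n - 1)) id dB \<Psi>\<^sub>B \<rho> = ptrace_snd (dA * dB ^ (n - 1)) dB \<rho> \<otimes>\<^sub>m X\<^sub>B \<and>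
        \<rho> \<in> sym_commutant dA dB \<V>\<^sub>A \<V>\<^sub>B n}"

text \<open>The argument of \<open>H * _\<close> is the reduction of \<open>\<rho>\<close> to \<open>A\<close> and \<open>B\<^sub>1\<close>.\<close>

definition c_ext ::
  "nat \<Rightarrow> nat \<Rightarrow> complex mat set \<Rightarrow> complex mat set
    \<Rightarrow> (complex mat \<Rightarrow> complex mat) \<Rightarrow> (complex mat \<Rightarrow> complex mat)
    \<Rightarrow> complex mat \<Rightarrow> complex mat \<Rightarrow> complex mat \<Rightarrow> nat \<Rightarrow> ereal" where
  "c_ext dA dB \<V>\<^sub>A \<V>\<^sub>B \<Psi>\<^sub>A \<Psi>\<^sub>B X\<^sub>A X\<^sub>B H n =
     Sup {ereal (Re (tr (H * ptrace_snd (dA * dB) (dB ^ (n - 1)) \<rho>))) | \<rho>.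
       \<rho> \<in> feasible_ext dA dB \<V>\<^sub>A \<V>\<^sub>B \<Psi>\<^sub>A \<Psi>\<^sub>B X\<^sub>A X\<^sub>B n}"

end

theory Submission
  imports Defs "HOL-Analysis.L2_Norm"
begin

text \<open>
  Let \<open>\<rho>\<close> be a symmetric extension. Measure \<open>B\<^sub>1, \<dots>, B\<^sub>k\<close> with outcomes \<open>z\<close> and condition on them. As the
  constraints involve only the map on \<open>A\<close> or on the last factor, the conditional states \<open>\<rho>\<^sub>A\<^sup>z\<close> and \<open>\<rho>\<^sub>B\<^sup>z\<close> (of
  the unmeasured \<open>B\<^sub>n\<close>) are feasible for the bilinear problem. The information that the outcomes carry
  about \<open>A\<close> telescopes and is at most the maximal entropy \<open>ln (\<Sum> m\<^sub>i)\<close> on the algebra of \<open>A\<close>, so for some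
  \<open>k < n\<close> the next outcome \<open>y\<close> carries at most \<open>ln (\<Sum> m\<^sub>i) / n\<close>. By Pinsker's inequality \<open>\<rho>\<^sub>A\<close> hardly depends
  on \<open>y\<close>. The measurement is informationally complete on the algebra of \<open>B\<close>: \<open>H = \<Sum>\<^sub>y H\<^sub>y \<otimes> M\<^sub>y\<close> with
  \<open>\<parallel>H\<^sub>y\<parallel> \<le> 2 m\<^sub>B \<parallel>H\<parallel>\<close>, so the value of the conditional state of \<open>A B\<^sub>n\<close> is close to that of \<open>\<rho>\<^sub>A\<^sup>z \<otimes> \<rho>\<^sub>B\<^sup>z\<close>.

  Pinsker's inequality is proved from the eigenbases \<open>u\<^sub>i\<close>, \<open>v\<^sub>j\<close> of the two states: the relative entropy
  is the classical one of the weights \<open>\<lambda>\<^sub>i \<bar>\<langle>u\<^sub>i, v\<^sub>j\<rangle>\<bar>\<^sup>2\<close> and \<open>\<mu>\<^sub>j \<bar>\<langle>u\<^sub>i, v\<^sub>j\<rangle>\<bar>\<^sup>2\<close>, and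
  \<open>x ln (x / y) - x + y \<ge> 3 (x - y)\<^sup>2 / (2 (x + 2 y))\<close> combines with the Cauchy-Schwarz inequality.
\<close>

section \<open>Entropy inequalities for scalars and overlap matrices\<close>

text \<open>The bound may depend on the commutants only, not on \<open>dA\<close> and
  \<open>dB\<close>. Invariance places \<open>H\<close> in the product of the two commutants, so a
  state of A matters only as a positive functional there. Such a functional is a positive matrix of
  size N, the sum of the block sizes, obtained by taking every irreducible representation once. Its
  entropy is at most ln N however large \<open>dA\<close> is, and N is at most the sum of squares in
  the statement.

  The second obstacle is the number of outcomes of a measurement that determines a state on the
  commutant of B: one separate error per outcome would bring it into the bound. Hence the Pinsker
  estimate is tested for each outcome against its own operator of norm at most C, and the
  Cauchy-Schwarz inequality is applied once to all pairs of a past record and a next outcome. The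
  probabilities of these pairs add up to 1, so only the largest norm C survives.

  Conditional states stay unnormalised in the entropy estimates: they are then additive over
  outcomes, and their traces are the probabilities.\<close>

lemma ln_ge_rational:
  fixes t :: real
  assumes "t > 0"
  shows "(t - 1) * (5 * t + 1) / (2 * t * (t + 2)) \<le> ln t"
proof -
  define h where "h t = ln t - (t - 1) * (5 * t + 1) / (2 * t * (t + 2))" for t :: real
  \<comment> \<open>The rational function is made so that the derivative of the difference is the
    cube of x - 1 over a square. It changes sign only at 1, where \<open>h\<close> vanishes.\<close>
  have deriv: "(h has_real_derivative (x - 1) ^ 3 / (x\<^sup>2 * (x + 2)\<^sup>2)) (at x)" if "x > 0" for x
  proof -
    have nz: "2 * x * (x + 2) \<noteq> 0" using that by auto
    have "(h has_real_derivative 1 / x - ((1 * (5 * x + 1) + 5 * (x - 1)) * (2 * x * (x + 2))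
        - (x - 1) * (5 * x + 1) * (2 * (x + 2) + 2 * x)) / ((2 * x * (x + 2)) * (2 * x * (x + 2)))) (at x)"
      unfolding h_def by (rule derivative_eq_intros refl nz | use that in simp)+
    also have "1 / x - ((1 * (5 * x + 1) + 5 * (x - 1)) * (2 * x * (x + 2))
        - (x - 1) * (5 * x + 1) * (2 * (x + 2) + 2 * x)) / ((2 * x * (x + 2)) * (2 * x * (x + 2)))
        = (x - 1) ^ 3 / (x\<^sup>2 * (x + 2)\<^sup>2)" (is "?l = ?r")
    proof -
      define A where "A = (1 * (5 * x + 1) + 5 * (x - 1)) * (2 * x * (x + 2))
        - (x - 1) * (5 * x + 1) * (2 * (x + 2) + 2 * x)"
      define B where "B = 2 * x * (x + 2)"
      have B: "B \<noteq> 0" using nz by (simp add: B_def)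
      have "(1 / x - A / (B * B)) * (B * B) = B * B / x - A"
        using B by (simp add: left_diff_distrib)
      also have "B * B / x = 4 * x * (x + 2)\<^sup>2"
        using that by (simp add: B_def power2_eq_square)
      also have "\<dots> - A = 4 * (x - 1) ^ 3"
        by (simp add: A_def algebra_simps power2_eq_square power3_eq_cube)
      also have "\<dots> = ?r * (B * B)"
      proof -
        have "B * B = 4 * (x\<^sup>2 * (x + 2)\<^sup>2)" by (simp add: B_def power2_eq_square)
        then show ?thesis using that by simp
      qed
      finally have "1 / x - A / (B * B) = ?r"
        using B unfolding mult_cancel_right by simp
      then show ?thesis unfolding A_def B_def .
    qed
    finally show ?thesis .
  qed
  have h1: "h 1 = 0" by (simp add: h_def)
  have "h 1 \<le> h t"
  proof (cases "t \<ge> 1")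
    case True
    show ?thesis
      by (rule DERIV_nonneg_imp_nondecreasing[OF True])
         (use deriv in \<open>force intro!: exI divide_nonneg_nonneg zero_le_power\<close>)
  next
    case False
    then have le: "t \<le> 1" by simp
    show ?thesis
    proof (rule DERIV_nonpos_imp_nonincreasing[OF le])
      fix x assume x: "t \<le> x" "x \<le> 1"
      have "(x - 1) ^ 3 \<le> 0" using x by (simp add: power_le_zero_eq)
      then have "(x - 1) ^ 3 / (x\<^sup>2 * (x + 2)\<^sup>2) \<le> 0" by (simp add: divide_nonpos_nonneg)
      then show "\<exists>y. (h has_real_derivative y) (at x) \<and> y \<le> 0"
        using deriv[of x] x assms by auto
    qed
  qed
  with h1 show ?thesis by (simp add: h_def)
qed

text \<open>Putting t = x / y into \<open>ln_ge_rational\<close> gives the lower bound 3 (x - y)^2 /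
  (2 (x + 2 y)) exactly. The mean (x + 2 y) / 3 is what yields Pinsker's constant: if the x's and
  the y's have the same sum p, so do these means. \<open>null\<close> excludes the pairs of infinite
  relative entropy, where \<open>ln 0\<close> has a finite value.\<close>

lemma relative_entropy_scalar_bound:
  fixes x y :: real
  assumes x: "x \<ge> 0" and y: "y \<ge> 0" and null: "y = 0 \<Longrightarrow> x = 0"
  shows "(x - y)\<^sup>2 \<le> 2 * ((x + 2 * y) / 3) * (x * (ln x - ln y) - x + y)"
proof (cases "x = 0 \<or> y = 0")
  case True
  have "y * y * 3 \<le> 4 * y * y" using y by (simp)
  then show ?thesis using True null by (auto simp: power2_eq_square)
next
  case False
  with x y have x: "x > 0" and y: "y > 0" by auto
  have "(x / y - 1) * (5 * (x / y) + 1) / (2 * (x / y) * (x / y + 2)) \<le> ln x - ln y"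
    using ln_ge_rational[of "x / y"] x y by (simp add: ln_div)
  also have "(x / y - 1) * (5 * (x / y) + 1) / (2 * (x / y) * (x / y + 2))
      = (x - y) * (5 * x + y) / (2 * x * (x + 2 * y))"
    using x y by (simp add: divide_simps add_pos_pos) algebra
  finally have "x * ((x - y) * (5 * x + y) / (2 * x * (x + 2 * y))) \<le> x * (ln x - ln y)"
    using x by (intro mult_left_mono) auto
  then have "(x - y) * (5 * x + y) / (2 * (x + 2 * y)) - x + y \<le> x * (ln x - ln y) - x + y"
    using x by (simp add: mult.assoc)
  then have "2 * ((x + 2 * y) / 3) * ((x - y) * (5 * x + y) / (2 * (x + 2 * y)) - x + y)
      \<le> 2 * ((x + 2 * y) / 3) * (x * (ln x - ln y) - x + y)"
    using x y by (intro mult_left_mono) auto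
  also have "2 * ((x + 2 * y) / 3) * ((x - y) * (5 * x + y) / (2 * (x + 2 * y)) - x + y) = (x - y)\<^sup>2"
    using x y by (simp add: divide_simps add_pos_pos power2_eq_square) (simp add: algebra_simps)
  finally show ?thesis .
qed

lemma Cauchy_Schwarz_sum:
  fixes f g :: "'a \<Rightarrow> real"
  shows "(\<Sum>i\<in>I. \<bar>f i\<bar> * \<bar>g i\<bar>)\<^sup>2 \<le> (\<Sum>i\<in>I. (f i)\<^sup>2) * (\<Sum>i\<in>I. (g i)\<^sup>2)"
proof -
  have "(\<Sum>i\<in>I. \<bar>f i\<bar> * \<bar>g i\<bar>)\<^sup>2 \<le> (L2_set f I * L2_set g I)\<^sup>2"
    by (intro power_mono L2_set_mult_ineq sum_nonneg) auto
  then show ?thesis by (simp add: L2_set_def power_mult_distrib sum_nonneg)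
qed

lemma sum_sqrt_Cauchy_Schwarz:
  fixes x y d :: "'a \<Rightarrow> real"
  assumes "\<And>i. i \<in> I \<Longrightarrow> 0 \<le> x i" "\<And>i. i \<in> I \<Longrightarrow> 0 \<le> y i"
    and "\<And>i. i \<in> I \<Longrightarrow> (d i)\<^sup>2 \<le> x i * y i"
  shows "(\<Sum>i\<in>I. \<bar>d i\<bar>)\<^sup>2 \<le> (\<Sum>i\<in>I. x i) * (\<Sum>i\<in>I. y i)"
proof -
  have "\<bar>d i\<bar> \<le> \<bar>sqrt (x i)\<bar> * \<bar>sqrt (y i)\<bar>" if "i \<in> I" for i
    using assms that real_sqrt_le_mono[OF assms(3)[OF that]] by (simp add: real_sqrt_mult)
  then have "(\<Sum>i\<in>I. \<bar>d i\<bar>)\<^sup>2 \<le> (\<Sum>i\<in>I. \<bar>sqrt (x i)\<bar> * \<bar>sqrt (y i)\<bar>)\<^sup>2"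
    by (intro power_mono sum_mono sum_nonneg) auto
  also have "\<dots> \<le> (\<Sum>i\<in>I. (sqrt (x i))\<^sup>2) * (\<Sum>i\<in>I. (sqrt (y i))\<^sup>2)"
    by (rule Cauchy_Schwarz_sum)
  also have "\<dots> = (\<Sum>i\<in>I. x i) * (\<Sum>i\<in>I. y i)" using assms by (simp cong: sum.cong)
  finally show ?thesis .
qed

text \<open>Here \<open>l\<close> and \<open>m\<close> stand for the eigenvalues of two positive
  matrices of equal trace p, \<open>a\<close> for the overlaps of their eigenvectors and
  \<open>b\<close> for the matrix elements of a test operator. The squared moduli of
  \<open>a\<close> form a doubly stochastic array, which turns the comparison into a classical one
  over pairs of indices.\<close>

lemma pinsker_overlap:
  fixes a b :: "nat \<Rightarrow> nat \<Rightarrow> complex" and l m :: "nat \<Rightarrow> real"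
  assumes l: "\<And>i. i < N \<Longrightarrow> 0 \<le> l i" and m: "\<And>j. j < N \<Longrightarrow> 0 \<le> m j"
    and null: "\<And>i j. i < N \<Longrightarrow> j < N \<Longrightarrow> m j = 0 \<Longrightarrow> l i * (cmod (a i j))\<^sup>2 = 0"
    and a1: "\<And>i. i < N \<Longrightarrow> (\<Sum>j<N. (cmod (a i j))\<^sup>2) = 1"
    and a2: "\<And>j. j < N \<Longrightarrow> (\<Sum>i<N. (cmod (a i j))\<^sup>2) = 1"
    and b1: "\<And>i. i < N \<Longrightarrow> (\<Sum>j<N. (cmod (b i j))\<^sup>2) \<le> C\<^sup>2"
    and b2: "\<And>j. j < N \<Longrightarrow> (\<Sum>i<N. (cmod (b i j))\<^sup>2) \<le> C\<^sup>2"
    and suml: "(\<Sum>i<N. l i) = p" and summ: "(\<Sum>i<N. m i) = p"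
  defines "D \<equiv> (\<Sum>i<N. \<Sum>j<N. (cmod (a i j))\<^sup>2 * (l i * (ln (l i) - ln (m j))))"
  shows "(cmod (\<Sum>i<N. \<Sum>j<N. (l i - m j) * a i j * b i j))\<^sup>2 \<le> 2 * C\<^sup>2 * p * D" and "0 \<le> D"
proof -
  \<comment> \<open>The correction - l + m makes every \<open>e i j\<close> nonnegative, which the
    summands of \<open>D\<close> need not be. It cancels in the total because both spectra sum to
    p.\<close>
  define e where "e i j = (cmod (a i j))\<^sup>2 * (l i * (ln (l i) - ln (m j)) - l i + m j)" for i j
  \<comment> \<open>The part with \<open>l\<close> is summed along the rows of \<open>b\<close> and
    the part with \<open>m\<close> along its columns, so the total weight is at most C^2 (p + 2 p) /
    3.\<close>
  define w where "w i j = (l i + 2 * m j) / 3 * (cmod (b i j))\<^sup>2" for i j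
  define d where "d i j = (l i - m j) * cmod (a i j) * cmod (b i j)" for i j
  let ?I = "{..<N} \<times> {..<N}"
  have w: "0 \<le> w i j" if "i < N" "j < N" for i j using l m that by (simp add: w_def)
  have de: "0 \<le> e i j \<and> (d i j)\<^sup>2 \<le> 2 * e i j * w i j" if ij: "i < N" "j < N" for i j
  proof (cases "a i j = 0")
    case True
    then show ?thesis by (simp add: e_def d_def)
  next
    case False
    have n: "m j = 0 \<Longrightarrow> l i = 0" using null[OF ij] False by auto
    define f where "f = l i * (ln (l i) - ln (m j)) - l i + m j"
    have f: "(l i - m j)\<^sup>2 \<le> 2 * ((l i + 2 * m j) / 3) * f"
      unfolding f_def using relative_entropy_scalar_bound[OF l[OF ij(1)] m[OF ij(2)] n] .
    have "0 \<le> f"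
    proof (cases "l i + 2 * m j = 0")
      case True
      then have "l i = 0 \<and> m j = 0" using l[OF ij(1)] m[OF ij(2)] by auto
      then show ?thesis by (simp add: f_def)
    next
      case False
      then have "0 < l i + 2 * m j" using l[OF ij(1)] m[OF ij(2)] by auto
      moreover have "0 \<le> 2 * ((l i + 2 * m j) / 3) * f" using f zero_le_power2 order_trans by blast
      ultimately show ?thesis by (simp add: zero_le_mult_iff)
    qed
    moreover have "(d i j)\<^sup>2 \<le> 2 * e i j * w i j"
    proof -
      have "(d i j)\<^sup>2 = (l i - m j)\<^sup>2 * ((cmod (a i j))\<^sup>2 * (cmod (b i j))\<^sup>2)"
        by (simp add: d_def power_mult_distrib)
      also have "\<dots> \<le> (2 * ((l i + 2 * m j) / 3) * f) * ((cmod (a i j))\<^sup>2 * (cmod (b i j))\<^sup>2)"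
        by (rule mult_right_mono[OF f]) simp
      also have "\<dots> = 2 * e i j * w i j" by (simp add: e_def w_def f_def)
      finally show ?thesis .
    qed
    ultimately show ?thesis by (simp add: e_def f_def)
  qed
  have sa1: "(\<Sum>i<N. \<Sum>j<N. (cmod (a i j))\<^sup>2 * l i) = p"
    using a1 suml by (simp add: sum_distrib_right[symmetric])
  have sa2: "(\<Sum>i<N. \<Sum>j<N. (cmod (a i j))\<^sup>2 * m j) = p"
    by (subst sum.swap) (use a2 summ in \<open>simp add: sum_distrib_right[symmetric]\<close>)
  have sume: "(\<Sum>i<N. \<Sum>j<N. e i j) = D"
    using sa1 sa2 by (simp add: D_def e_def algebra_simps sum.distrib sum_subtractf)
  then show "0 \<le> D" using de by (auto intro!: sum_nonneg simp flip: sume)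
  have "(\<Sum>i<N. \<Sum>j<N. w i j) = (\<Sum>i<N. l i / 3 * (\<Sum>j<N. (cmod (b i j))\<^sup>2))
      + (\<Sum>j<N. 2 * m j / 3 * (\<Sum>i<N. (cmod (b i j))\<^sup>2))"
  proof -
    have "(\<Sum>j<N. 2 * m j / 3 * (\<Sum>i<N. (cmod (b i j))\<^sup>2))
        = (\<Sum>i<N. \<Sum>j<N. 2 * m j / 3 * (cmod (b i j))\<^sup>2)"
      unfolding sum_distrib_left by (rule sum.swap)
    moreover have "(\<Sum>i<N. l i / 3 * (\<Sum>j<N. (cmod (b i j))\<^sup>2))
        = (\<Sum>i<N. \<Sum>j<N. l i / 3 * (cmod (b i j))\<^sup>2)"
      by (simp add: sum_distrib_left)
    moreover have "w i j = l i / 3 * (cmod (b i j))\<^sup>2 + 2 * m j / 3 * (cmod (b i j))\<^sup>2" for i j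
      by (simp add: w_def add_divide_distrib distrib_right)
    ultimately show ?thesis by (simp add: sum.distrib)
  qed
  also have "\<dots> \<le> (\<Sum>i<N. l i / 3 * C\<^sup>2) + (\<Sum>j<N. 2 * m j / 3 * C\<^sup>2)"
    using l m b1 b2 by (intro add_mono sum_mono mult_left_mono) auto
  also have "\<dots> = (\<Sum>i<N. l i) / 3 * C\<^sup>2 + 2 * (\<Sum>i<N. m i) / 3 * C\<^sup>2"
    by (simp add: sum_distrib_left sum_distrib_right sum_divide_distrib)
  also have "\<dots> = C\<^sup>2 * p" unfolding suml summ by (simp add: field_simps)
  finally have sumw: "(\<Sum>i<N. \<Sum>j<N. w i j) \<le> C\<^sup>2 * p" .
  have "cmod (\<Sum>i<N. \<Sum>j<N. (l i - m j) * a i j * b i j) \<le> (\<Sum>i<N. \<Sum>j<N. \<bar>d i j\<bar>)"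
    by (intro order_trans[OF norm_sum] sum_mono)
      (simp add: d_def norm_mult abs_mult flip: of_real_diff)
  then have "(cmod (\<Sum>i<N. \<Sum>j<N. (l i - m j) * a i j * b i j))\<^sup>2 \<le> (\<Sum>i<N. \<Sum>j<N. \<bar>d i j\<bar>)\<^sup>2"
    by (intro power_mono) auto
  also have "\<dots> = (\<Sum>p\<in>?I. \<bar>d (fst p) (snd p)\<bar>)\<^sup>2"
    by (simp add: sum.cartesian_product case_prod_unfold)
  also have "\<dots> \<le> (\<Sum>p\<in>?I. 2 * e (fst p) (snd p)) * (\<Sum>p\<in>?I. w (fst p) (snd p))"
    by (rule sum_sqrt_Cauchy_Schwarz) (use de w in auto)
  also have "\<dots> = 2 * D * (\<Sum>i<N. \<Sum>j<N. w i j)"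
    by (simp add: sume[symmetric] sum.cartesian_product case_prod_unfold sum_distrib_left)
  also have "\<dots> \<le> 2 * D * (C\<^sup>2 * p)" using sumw \<open>0 \<le> D\<close> by (intro mult_left_mono) auto
  finally show "(cmod (\<Sum>i<N. \<Sum>j<N. (l i - m j) * a i j * b i j))\<^sup>2 \<le> 2 * C\<^sup>2 * p * D"
    by (simp add: mult_ac)
qed

section \<open>The spectral theorem\<close>

lemma tr_mult_commute:
  assumes "A \<in> carrier_mat n m" "B \<in> carrier_mat m n"
  shows "tr (A * B) = tr (B * A)"
proof -
  have "tr (A * B) = (\<Sum>i<n. \<Sum>k<m. A $$ (i, k) * B $$ (k, i))"
    using assms by (auto simp: tr_def scalar_prod_def lessThan_atLeast0 intro!: sum.cong)
  also have "\<dots> = (\<Sum>k<m. \<Sum>i<n. B $$ (k, i) * A $$ (i, k))"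
    by (subst sum.swap) (simp add: mult.commute)
  also have "\<dots> = tr (B * A)"
    using assms by (auto simp: tr_def scalar_prod_def lessThan_atLeast0 intro!: sum.cong)
  finally show ?thesis .
qed

text \<open>In a Schur decomposition the trace is the sum of the listed eigenvalues; if all of them
  were c, it would be n c. This trace test is what produces each new eigenvector of an
  eigenbasis.\<close>

lemma exists_eigenvalue_neq:
  fixes A :: "complex mat"
  assumes A: "A \<in> carrier_mat n n" and ne: "tr A \<noteq> of_nat n * c"
  shows "\<exists>e v. e \<noteq> c \<and> eigenvector A v e"
proof -
  obtain es where cp: "char_poly A = (\<Prod>a\<leftarrow>es. [:- a, 1:])" and len: "length es = n"
    using char_poly_factorized[OF A] by auto
  obtain B P Q where "schur_decomposition A es = (B, P, Q)"
    by (cases "schur_decomposition A es") auto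
  from schur_decomposition[OF A cp this] have sim: "similar_mat_wit A B P Q" and diag: "diag_mat B = es"
    by auto
  note w = similar_mat_witD2[OF A sim]
  have "tr A = tr (P * (B * Q))" using w by (simp add: assoc_mult_mat[of P n n B n Q n])
  also have "\<dots> = tr (B * Q * P)" using w by (intro tr_mult_commute) auto
  also have "\<dots> = tr B" using w by (simp add: assoc_mult_mat[of B n n Q n P n])
  also have "\<dots> = sum_list es"
    using w diag by (simp add: tr_def diag_mat_def sum_list_sum_nth lessThan_atLeast0 flip: diag)
  finally have tr: "tr A = sum_list es" .
  have "\<exists>e\<in>set es. e \<noteq> c"
  proof (rule ccontr)
    assume "\<not> ?thesis"
    then have "es = replicate n c" using len by (metis replicate_eqI)
    then have "sum_list es = of_nat n * c" by (simp add: sum_list_replicate)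
    with tr ne show False by simp
  qed
  then obtain e where e: "e \<in> set es" "e \<noteq> c" by auto
  then have "poly (char_poly A) e = 0" unfolding cp by (simp add: poly_prod_list prod_list_zero_iff image_iff) 
  then have "eigenvalue A e" using eigenvalue_root_char_poly[OF A] by simp
  then show ?thesis using e unfolding eigenvalue_def by auto
qed

lemma exists_eigenvalue_neq_fun:
  fixes S :: "nat \<Rightarrow> nat \<Rightarrow> complex"
  assumes ne: "(\<Sum>i<n. S i i) \<noteq> of_nat n * c"
  shows "\<exists>e x. e \<noteq> c \<and> (\<exists>i<n. x i \<noteq> 0) \<and> (\<forall>r<n. (\<Sum>k<n. S r k * x k) = e * x r)"
proof -
  define A where "A = mat n n (\<lambda>(r, k). S r k)"
  have A: "A \<in> carrier_mat n n" by (simp add: A_def)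
  have "tr A = (\<Sum>i<n. S i i)" by (simp add: tr_def A_def)
  with ne have "tr A \<noteq> of_nat n * c" by simp
  from exists_eigenvalue_neq[OF A this] obtain e v where e: "e \<noteq> c" and v: "eigenvector A v e"
    by blast
  from v A have v': "v \<in> carrier_vec n" "v \<noteq> 0\<^sub>v n" "A *\<^sub>v v = e \<cdot>\<^sub>v v"
    by (auto simp: eigenvector_def)
  have "(\<Sum>k<n. S r k * v $ k) = e * v $ r" if "r < n" for r
  proof -
    have "(\<Sum>k<n. S r k * v $ k) = (A *\<^sub>v v) $ r"
      using that v'(1) by (simp add: A_def scalar_prod_def lessThan_atLeast0)
    then show ?thesis using v' that by simp
  qed
  moreover have "\<exists>i<n. v $ i \<noteq> 0" using v' by (metis eq_vecI carrier_vecD index_zero_vec)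
  ultimately show ?thesis using e by blast
qed

definition orthonormal_system :: "nat \<Rightarrow> nat \<Rightarrow> (nat \<Rightarrow> nat \<Rightarrow> complex) \<Rightarrow> bool" where
  "orthonormal_system n k u \<longleftrightarrow>
     (\<forall>i<k. \<forall>j<k. (\<Sum>r<n. cnj (u i r) * u j r) = (if i = j then 1 else 0))"

lemma orthonormal_systemD:
  "orthonormal_system n k u \<Longrightarrow> i < k \<Longrightarrow> j < k \<Longrightarrow>
    (\<Sum>r<n. cnj (u i r) * u j r) = (if i = j then 1 else 0)"
  by (simp add: orthonormal_system_def)

text \<open>Orthonormality says that a square matrix has a left inverse; completeness says that the
  same matrix is a right inverse.\<close>

lemma orthonormal_system_complete:
  assumes "orthonormal_system n n u" "r < n" "s < n"
  shows "(\<Sum>i<n. u i r * cnj (u i s)) = (if r = s then 1 else 0)"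
proof -
  define U where "U = mat n n (\<lambda>(r, i). u i r)"
  define V where "V = mat n n (\<lambda>(i, r). cnj (u i r))"
  have UV: "U \<in> carrier_mat n n" "V \<in> carrier_mat n n" by (simp_all add: U_def V_def)
  have "V * U = 1\<^sub>m n"
    using assms(1) by (intro eq_matI)
      (auto simp: U_def V_def scalar_prod_def lessThan_atLeast0 orthonormal_system_def)
  then have "U * V = 1\<^sub>m n" using mat_mult_left_right_inverse[OF UV(2,1)] by simp
  then have "(U * V) $$ (r, s) = (if r = s then 1 else 0)" using assms by simp
  then show ?thesis using assms by (simp add: U_def V_def scalar_prod_def lessThan_atLeast0)
qed

lemma sum_mult_delta:
  "(\<Sum>i<k. (f i :: complex) * (if i = (j::nat) then 1 else 0)) = (if j < k then f j else 0)"
  by (simp add: if_distrib[of "(*) _"] cong: if_cong)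

lemma sum_norm_square_pos:
  fixes i n :: nat
  assumes "i < n" "x i \<noteq> (0::complex)"
  shows "\<exists>t>0. (\<Sum>r<n. cnj (x r) * x r) = complex_of_real (t\<^sup>2)"
proof -
  let ?t = "\<Sum>r<n. (cmod (x r))\<^sup>2"
  have "(\<Sum>r<n. cnj (x r) * x r) = complex_of_real ?t"
    by (simp add: mult.commute complex_mult_cnj cmod_power2)
  moreover have "0 < ?t" by (rule sum_pos2[where i = i]) (use assms in auto)
  ultimately show ?thesis by (intro exI[of _ "sqrt ?t"]) auto
qed

text \<open>Deflation: \<open>S' c\<close> has the known eigenvectors with eigenvalue c and agrees
  with S on their orthogonal complement. An eigenvector of \<open>S' c\<close> for any other
  eigenvalue is orthogonal to the known ones, hence also an eigenvector of S.\<close>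

lemma extend_orthonormal_eigensystem:
  fixes S u :: "nat \<Rightarrow> nat \<Rightarrow> complex" and l :: "nat \<Rightarrow> real"
  assumes herm: "\<And>r s. r < n \<Longrightarrow> s < n \<Longrightarrow> S s r = cnj (S r s)"
    and on: "orthonormal_system n k u" and kn: "k < n"
    and eig: "\<And>i r. i < k \<Longrightarrow> r < n \<Longrightarrow> (\<Sum>s<n. S r s * u i s) = l i * u i r"
  shows "\<exists>(x :: nat \<Rightarrow> complex) (e :: real). (\<Sum>r<n. cnj (x r) * x r) = 1 \<and> (\<forall>i<k. (\<Sum>r<n. cnj (u i r) * x r) = 0)
    \<and> (\<forall>r<n. (\<Sum>s<n. S r s * x s) = e * x r)"
proof -
  define S' where "S' c r s = S r s + (\<Sum>i<k. (complex_of_real c - l i) * u i r * cnj (u i s))" for c r s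
  have tr: "(\<Sum>r<n. S' c r r) = (\<Sum>r<n. S r r) + (\<Sum>i<k. complex_of_real c - l i)" for c
  proof -
    have "(\<Sum>r<n. \<Sum>i<k. (complex_of_real c - l i) * u i r * cnj (u i r))
        = (\<Sum>i<k. (complex_of_real c - l i) * (\<Sum>r<n. cnj (u i r) * u i r))"
      by (subst sum.swap) (simp add: sum_distrib_left mult_ac)
    also have "\<dots> = (\<Sum>i<k. complex_of_real c - l i)"
      using on by (simp add: orthonormal_systemD)
    finally show ?thesis by (simp add: S'_def sum.distrib)
  qed
  \<comment> \<open>As a function of c, the trace of \<open>S' c\<close> has slope k and n c has
    slope n. As k < n, they cannot agree both at 0 and at 1.\<close>
  have "\<exists>c\<in>{0, 1}. (\<Sum>r<n. S' c r r) \<noteq> of_nat n * complex_of_real c"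
  proof (rule ccontr)
    assume "\<not> ?thesis"
    then have 0: "(\<Sum>r<n. S' 0 r r) = 0" and 1: "(\<Sum>r<n. S' 1 r r) = of_nat n" by auto
    from 0 1 have "(of_nat k :: complex) = of_nat n" unfolding tr by (simp add: sum_subtractf sum_negf)
    with kn show False by simp
  qed
  then obtain c where "(\<Sum>r<n. S' c r r) \<noteq> of_nat n * complex_of_real c" by blast
  from exists_eigenvalue_neq_fun[where S = "S' c", OF this] obtain e x i0
    where ec: "e \<noteq> complex_of_real c" and i0: "i0 < n" "x i0 \<noteq> 0"
      and ex: "\<And>r. r < n \<Longrightarrow> (\<Sum>s<n. S' c r s * x s) = e * x r" by blast
  have hermS: "cnj (S s r) = S r s" if "r < n" "s < n" for r s
    using herm[OF that] by simp
  have herm': "cnj (S' c s r) = S' c r s" if "r < n" "s < n" for r s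
    using hermS[OF that] by (simp add: S'_def mult_ac)
  have eig': "(\<Sum>s<n. S' c r s * u i s) = c * u i r" if "i < k" "r < n" for i r
  proof -
    have "(\<Sum>s<n. (\<Sum>j<k. (complex_of_real c - l j) * u j r * cnj (u j s)) * u i s)
        = (\<Sum>j<k. (complex_of_real c - l j) * u j r * (\<Sum>s<n. cnj (u j s) * u i s))"
      unfolding sum_distrib_right sum_distrib_left
      by (subst sum.swap) (simp add: mult_ac)
    also have "\<dots> = (\<Sum>j<k. (complex_of_real c - l j) * u j r * (if j = i then 1 else 0))"
      using on that by (intro sum.cong) (simp_all add: orthonormal_systemD)
    also have "\<dots> = (complex_of_real c - l i) * u i r"
      using that by (simp add: sum_mult_delta)
    finally show ?thesis using eig[OF that] by (simp add: S'_def distrib_right sum.distrib left_diff_distrib)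
  qed
  \<comment> \<open>Eigenvectors of the Hermitian \<open>S' c\<close> for the distinct eigenvalues e
    and c are orthogonal; moving \<open>S' c\<close> to the other side leaves c unchanged because it
    is real.\<close>
  have orth: "(\<Sum>r<n. cnj (u i r) * x r) = 0" if i: "i < k" for i
  proof -
    have "e * (\<Sum>r<n. cnj (u i r) * x r) = (\<Sum>r<n. cnj (u i r) * (\<Sum>s<n. S' c r s * x s))"
      using ex by (simp add: sum_distrib_left mult_ac)
    also have "\<dots> = (\<Sum>s<n. \<Sum>r<n. cnj (u i r) * (S' c r s * x s))"
      unfolding sum_distrib_left by (rule sum.swap)
    also have "\<dots> = (\<Sum>s<n. cnj (\<Sum>r<n. S' c s r * u i r) * x s)"
      using herm' by (intro sum.cong refl) (simp add: sum_distrib_left sum_distrib_right mult_ac)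
    also have "\<dots> = complex_of_real c * (\<Sum>r<n. cnj (u i r) * x r)"
      using eig'[OF i] by (simp add: sum_distrib_left mult_ac)
    finally show ?thesis using ec by simp
  qed
  have ex2: "(\<Sum>s<n. S r s * x s) = e * x r" if "r < n" for r
  proof -
    have "(\<Sum>s<n. (\<Sum>j<k. (complex_of_real c - l j) * u j r * cnj (u j s)) * x s)
        = (\<Sum>j<k. (complex_of_real c - l j) * u j r * (\<Sum>s<n. cnj (u j s) * x s))"
      unfolding sum_distrib_right sum_distrib_left
      by (subst sum.swap) (simp add: mult_ac)
    also have "\<dots> = 0" using orth by simp
    finally show ?thesis using ex[OF that] by (simp add: S'_def distrib_right sum.distrib)
  qed
  obtain t where t: "t > 0" "(\<Sum>r<n. cnj (x r) * x r) = complex_of_real (t\<^sup>2)"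
    using sum_norm_square_pos[OF i0(1), of x] i0(2) by auto
  \<comment> \<open>The form of S at x is the squared length of x times e, and also times the
    conjugate of e, so e is real.\<close>
  have "e * (\<Sum>r<n. cnj (x r) * x r) = (\<Sum>r<n. cnj (x r) * (\<Sum>s<n. S r s * x s))"
    using ex2 by (simp add: sum_distrib_left mult_ac)
  also have "\<dots> = (\<Sum>s<n. \<Sum>r<n. cnj (x r) * (S r s * x s))"
    unfolding sum_distrib_left by (rule sum.swap)
  also have "\<dots> = (\<Sum>s<n. cnj (\<Sum>r<n. S s r * x r) * x s)"
    using hermS by (intro sum.cong refl) (simp add: sum_distrib_left sum_distrib_right mult_ac)
  also have "\<dots> = cnj e * (\<Sum>r<n. cnj (x r) * x r)"
    using ex2 by (simp add: sum_distrib_left mult_ac)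
  finally have "e = cnj e" using t by simp
  then have e: "e = complex_of_real (Re e)" by (simp add: complex_eq_iff)
  show ?thesis
  proof (intro exI[of _ "\<lambda>r. x r / t"] exI[of _ "Re e"] conjI allI impI)
    show "(\<Sum>r<n. cnj (x r / t) * (x r / t)) = 1"
      using t by (simp add: sum_divide_distrib[symmetric] power2_eq_square)
    show "(\<Sum>r<n. cnj (u i r) * (x r / t)) = 0" if "i < k" for i
      using orth[OF that] by (simp add: sum_divide_distrib[symmetric])
    show "(\<Sum>s<n. S r s * (x s / t)) = Re e * (x r / t)" if "r < n" for r
      using ex2[OF that] by (simp add: sum_divide_distrib[symmetric] flip: e)
  qed
qed

definition eigensystem :: "nat \<Rightarrow> (nat \<Rightarrow> nat \<Rightarrow> complex) \<Rightarrow> (nat \<Rightarrow> nat \<Rightarrow> complex) \<Rightarrow> (nat \<Rightarrow> real) \<Rightarrow> bool" where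
  "eigensystem n S u l \<longleftrightarrow> orthonormal_system n n u \<and>
     (\<forall>r<n. \<forall>s<n. S r s = (\<Sum>i<n. complex_of_real (l i) * u i r * cnj (u i s)))"

theorem hermitian_eigensystem:
  fixes S :: "nat \<Rightarrow> nat \<Rightarrow> complex"
  assumes herm: "\<And>r s. r < n \<Longrightarrow> s < n \<Longrightarrow> S s r = cnj (S r s)"
  shows "\<exists>u l. eigensystem n S u l"
proof -
  have "\<exists>u l. orthonormal_system n k u \<and>
      (\<forall>i<k. \<forall>r<n. (\<Sum>s<n. S r s * u i s) = complex_of_real (l i) * u i r)" if "k \<le> n" for k
    using that
  proof (induction k)
    case 0
    show ?case by (simp add: orthonormal_system_def)
  next
    case (Suc k)
    then obtain u l where on: "orthonormal_system n k u"
      and eig: "\<And>i r. i < k \<Longrightarrow> r < n \<Longrightarrow> (\<Sum>s<n. S r s * u i s) = complex_of_real (l i) * u i r"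
      by auto
    from extend_orthonormal_eigensystem[of n S k u l, OF herm on _ eig] Suc.prems
    obtain x :: "nat \<Rightarrow> complex" and e :: real where x: "(\<Sum>r<n. cnj (x r) * x r) = 1" "\<And>i. i < k \<Longrightarrow> (\<Sum>r<n. cnj (u i r) * x r) = 0"
      "\<And>r. r < n \<Longrightarrow> (\<Sum>s<n. S r s * x s) = complex_of_real e * x r" by auto
    have x': "(\<Sum>r<n. cnj (x r) * u i r) = 0" if "i < k" for i
    proof -
      have "(\<Sum>r<n. cnj (x r) * u i r) = cnj (\<Sum>r<n. cnj (u i r) * x r)" by (simp add: mult.commute)
      then show ?thesis using x(2)[OF that] by simp
    qed
    have "orthonormal_system n (Suc k) (u(k := x))"
      using on x x' by (auto simp: orthonormal_system_def less_Suc_eq)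
    moreover have "\<forall>i<Suc k. \<forall>r<n. (\<Sum>s<n. S r s * (u(k := x)) i s) = complex_of_real ((l(k := e)) i) * (u(k := x)) i r"
      using eig x(3) by (auto simp: less_Suc_eq)
    ultimately show ?case by blast
  qed
  from this[of n] obtain u l where on: "orthonormal_system n n u"
    and eig: "\<And>i r. i < n \<Longrightarrow> r < n \<Longrightarrow> (\<Sum>s<n. S r s * u i s) = complex_of_real (l i) * u i r" by auto
  have "S r s = (\<Sum>i<n. l i * u i r * cnj (u i s))" if "r < n" "s < n" for r s
  proof -
    have "(\<Sum>i<n. l i * u i r * cnj (u i s)) = (\<Sum>i<n. (\<Sum>t<n. S r t * u i t) * cnj (u i s))"
      using eig that by simp
    also have "\<dots> = (\<Sum>t<n. S r t * (\<Sum>i<n. u i t * cnj (u i s)))"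
      unfolding sum_distrib_left sum_distrib_right by (subst sum.swap) (simp add: mult_ac)
    also have "\<dots> = (\<Sum>t<n. S r t * (if t = s then 1 else 0))"
      using that by (intro sum.cong refl) (simp add: orthonormal_system_complete[OF on])
    also have "\<dots> = S r s" using that by (simp add: sum_mult_delta)
    finally show ?thesis by simp
  qed
  with on show ?thesis unfolding eigensystem_def by blast
qed

section \<open>Sesquilinear forms and entropy\<close>

text \<open>Conjugate-linear in the first argument, unlike \<open>\<bullet>c\<close>.\<close>

definition ip :: "nat \<Rightarrow> (nat \<Rightarrow> complex) \<Rightarrow> (nat \<Rightarrow> complex) \<Rightarrow> complex" where
  "ip n x y = (\<Sum>r<n. cnj (x r) * y r)"

definition sesq :: "nat \<Rightarrow> (nat \<Rightarrow> nat \<Rightarrow> complex) \<Rightarrow> (nat \<Rightarrow> complex) \<Rightarrow> (nat \<Rightarrow> complex) \<Rightarrow> complex" where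
  "sesq n Q x y = (\<Sum>r<n. \<Sum>s<n. cnj (x r) * Q r s * y s)"

definition trprod :: "nat \<Rightarrow> (nat \<Rightarrow> nat \<Rightarrow> complex) \<Rightarrow> (nat \<Rightarrow> nat \<Rightarrow> complex) \<Rightarrow> complex" where
  "trprod n Q R = (\<Sum>r<n. \<Sum>s<n. Q r s * R s r)"

definition psd_fun :: "nat \<Rightarrow> (nat \<Rightarrow> nat \<Rightarrow> complex) \<Rightarrow> bool" where
  "psd_fun n S \<longleftrightarrow> (\<forall>x. 0 \<le> sesq n S x x)"

text \<open>The operator norm of Q is at most C, phrased through the form so that it passes directly
  to corners of a larger operator.\<close>

definition sesq_bounded :: "nat \<Rightarrow> (nat \<Rightarrow> nat \<Rightarrow> complex) \<Rightarrow> real \<Rightarrow> bool" where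
  "sesq_bounded n Q C \<longleftrightarrow>
    (\<forall>x y. cmod (sesq n Q x y) \<le> C * sqrt (Re (ip n x x)) * sqrt (Re (ip n y y)))"

lemma sum_rotate3:
  "(\<Sum>r\<in>A. \<Sum>s\<in>B. \<Sum>i\<in>I. f r s i) = (\<Sum>i\<in>I. \<Sum>r\<in>A. \<Sum>s\<in>B. f r s i)"
proof -
  have "(\<Sum>r\<in>A. \<Sum>s\<in>B. \<Sum>i\<in>I. f r s i) = (\<Sum>r\<in>A. \<Sum>i\<in>I. \<Sum>s\<in>B. f r s i)"
    by (intro sum.cong refl sum.swap)
  also have "\<dots> = (\<Sum>i\<in>I. \<Sum>r\<in>A. \<Sum>s\<in>B. f r s i)" by (rule sum.swap)
  finally show ?thesis .
qed

lemma cnj_ip: "cnj (ip n x y) = ip n y x"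
  by (simp add: ip_def mult.commute)

lemma ip_self: "ip n x x = complex_of_real (\<Sum>r<n. (cmod (x r))\<^sup>2)"
  by (simp add: ip_def mult.commute complex_mult_cnj cmod_power2)

lemma ip_expand:
  assumes "orthonormal_system n n u"
  shows "ip n x y = (\<Sum>i<n. ip n x (u i) * ip n (u i) y)"
proof -
  have "(\<Sum>i<n. ip n x (u i) * ip n (u i) y)
      = (\<Sum>i<n. \<Sum>r<n. \<Sum>s<n. cnj (x r) * (u i r * cnj (u i s)) * y s)"
    by (simp only: ip_def sum_product) (simp only: mult_ac)
  also have "\<dots> = (\<Sum>r<n. \<Sum>s<n. \<Sum>i<n. cnj (x r) * (u i r * cnj (u i s)) * y s)"
    by (subst sum.swap) (intro sum.cong refl sum.swap)
  also have "\<dots> = (\<Sum>r<n. \<Sum>s<n. cnj (x r) * (\<Sum>i<n. u i r * cnj (u i s)) * y s)"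
    by (simp add: sum_distrib_left sum_distrib_right)
  also have "\<dots> = (\<Sum>r<n. \<Sum>s<n. (cnj (x r) * y s) * (if s = r then 1 else 0))"
    using orthonormal_system_complete[OF assms] by (intro sum.cong refl) auto
  also have "\<dots> = ip n x y" by (simp add: sum_mult_delta ip_def)
  finally show ?thesis ..
qed

lemma sesq_eq_ip_right: "sesq n Q x y = ip n x (\<lambda>r. \<Sum>s<n. Q r s * y s)"
  by (simp add: sesq_def ip_def sum_distrib_left mult.assoc)

lemma sesq_eq_ip_left: "sesq n Q x y = ip n (\<lambda>s. \<Sum>r<n. cnj (Q r s) * x r) y"
  unfolding sesq_def ip_def
  by (subst sum.swap) (simp add: sum_distrib_left sum_distrib_right mult_ac)

lemma sesq_expand_left:
  assumes "orthonormal_system n n u"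
  shows "sesq n Q x y = (\<Sum>i<n. ip n x (u i) * sesq n Q (u i) y)"
  unfolding sesq_eq_ip_right by (rule ip_expand[OF assms])

lemma sesq_expand_right:
  assumes "orthonormal_system n n u"
  shows "sesq n Q x y = (\<Sum>i<n. sesq n Q x (u i) * ip n (u i) y)"
  unfolding sesq_eq_ip_left by (rule ip_expand[OF assms])

lemma parseval:
  assumes "orthonormal_system n n u"
  shows "(\<Sum>i<n. (cmod (ip n (u i) x))\<^sup>2) = Re (ip n x x)"
proof -
  have "ip n x x = (\<Sum>i<n. cnj (ip n (u i) x) * ip n (u i) x)"
    using ip_expand[OF assms, of x x] by (simp add: cnj_ip)
  also have "\<dots> = complex_of_real (\<Sum>i<n. (cmod (ip n (u i) x))\<^sup>2)"
    by (simp add: mult.commute complex_mult_cnj cmod_power2)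
  finally show ?thesis by simp
qed

lemma ip_orthonormal:
  "orthonormal_system n k u \<Longrightarrow> i < k \<Longrightarrow> j < k \<Longrightarrow> ip n (u i) (u j) = (if i = j then 1 else 0)"
  by (simp add: ip_def orthonormal_system_def)

lemma ip_sum_right: "ip n x (\<lambda>r. \<Sum>i\<in>I. c i * u i r) = (\<Sum>i\<in>I. c i * ip n x (u i))"
  unfolding ip_def sum_distrib_left by (subst sum.swap) (simp add: mult_ac)

lemma ip_sum_left: "ip n (\<lambda>r. \<Sum>i\<in>I. c i * u i r) y = (\<Sum>i\<in>I. cnj (c i) * ip n (u i) y)"
  unfolding ip_def sum_distrib_left cnj_sum sum_distrib_right
  by (subst sum.swap) (simp add: mult_ac)

lemma sesq_sum_right: "sesq n Q x (\<lambda>r. \<Sum>i\<in>I. c i * u i r) = (\<Sum>i\<in>I. c i * sesq n Q x (u i))"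
  unfolding sesq_eq_ip_left by (rule ip_sum_right)

lemma sesq_sum_left: "sesq n Q (\<lambda>r. \<Sum>i\<in>I. c i * u i r) y = (\<Sum>i\<in>I. cnj (c i) * sesq n Q (u i) y)"
  unfolding sesq_eq_ip_right by (rule ip_sum_left)

lemma ip_combination_self:
  assumes "orthonormal_system n k u"
  shows "ip n (\<lambda>r. \<Sum>i<k. c i * u i r) (\<lambda>r. \<Sum>i<k. c i * u i r) = (\<Sum>i<k. cnj (c i) * c i)"
proof -
  have "ip n (u i) (\<lambda>r. \<Sum>j<k. c j * u j r) = c i" if "i < k" for i
  proof -
    have "ip n (u i) (\<lambda>r. \<Sum>j<k. c j * u j r) = (\<Sum>j<k. c j * (if j = i then 1 else 0))"
      unfolding ip_sum_right using that by (intro sum.cong refl) (auto simp: ip_orthonormal[OF assms])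
    then show ?thesis using that by (simp add: sum_mult_delta)
  qed
  then show ?thesis unfolding ip_sum_left by simp
qed

lemma le_square_if_le_mult_sqrt:
  fixes t C :: real
  assumes "0 \<le> t" "t \<le> C * sqrt t" shows "t \<le> C\<^sup>2"
proof (cases "t = 0")
  case False
  with assms have "0 < sqrt t" by simp
  moreover have "sqrt t * sqrt t \<le> C * sqrt t" using assms by simp
  ultimately have "sqrt t \<le> C" by (rule mult_right_le_imp_le[rotated])
  then have "(sqrt t)\<^sup>2 \<le> C\<^sup>2" using \<open>0 < sqrt t\<close> by (intro power_mono) auto
  then show ?thesis using assms by simp
qed simp

text \<open>The sum t is the squared length of Q y. Testing the form at x = Q y, written in the
  basis \<open>v\<close>, gives t \<le> C sqrt t.\<close>

lemma sesq_bounded_column: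
  assumes Q: "sesq_bounded n Q C" and v: "orthonormal_system n n v" and y: "ip n y y = 1"
  shows "(\<Sum>j<n. (cmod (sesq n Q (v j) y))\<^sup>2) \<le> C\<^sup>2"
proof -
  define b where "b j = sesq n Q (v j) y" for j
  define x where "x = (\<lambda>r. \<Sum>j<n. b j * v j r)"
  define t where "t = (\<Sum>j<n. (cmod (b j))\<^sup>2)"
  have bb: "(\<Sum>j<n. cnj (b j) * b j) = complex_of_real t"
    by (simp add: t_def mult.commute complex_mult_cnj cmod_power2)
  have t0: "0 \<le> t" by (simp add: t_def sum_nonneg)
  have "sesq n Q x y = complex_of_real t" unfolding x_def sesq_sum_left using bb by (simp add: b_def)
  moreover have "ip n x x = complex_of_real t" unfolding x_def ip_combination_self[OF v] bb ..
  moreover have "cmod (sesq n Q x y) \<le> C * sqrt (Re (ip n x x)) * sqrt (Re (ip n y y))"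
    using Q by (simp add: sesq_bounded_def)
  ultimately have "t \<le> C * sqrt t" using y t0 by simp
  then show ?thesis using le_square_if_le_mult_sqrt[OF t0] by (simp add: t_def b_def)
qed

text \<open>The same test for the adjoint of Q: here y is the image of x under the adjoint, written
  in the basis \<open>u\<close>.\<close>

lemma sesq_bounded_row:
  assumes Q: "sesq_bounded n Q C" and u: "orthonormal_system n n u" and x: "ip n x x = 1"
  shows "(\<Sum>i<n. (cmod (sesq n Q x (u i)))\<^sup>2) \<le> C\<^sup>2"
proof -
  define b where "b j = sesq n Q x (u j)" for j
  define y where "y = (\<lambda>r. \<Sum>j<n. cnj (b j) * u j r)"
  define t where "t = (\<Sum>j<n. (cmod (b j))\<^sup>2)"
  have bb: "(\<Sum>j<n. b j * cnj (b j)) = complex_of_real t"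
    by (simp add: t_def complex_mult_cnj cmod_power2)
  have t0: "0 \<le> t" by (simp add: t_def sum_nonneg)
  have "sesq n Q x y = complex_of_real t"
    unfolding y_def sesq_sum_right using bb by (simp add: b_def mult.commute)
  moreover have "ip n y y = complex_of_real t" unfolding y_def ip_combination_self[OF u] using bb by simp
  moreover have "cmod (sesq n Q x y) \<le> C * sqrt (Re (ip n x x)) * sqrt (Re (ip n y y))"
    using Q by (simp add: sesq_bounded_def)
  ultimately have "t \<le> C * sqrt t" using x t0 by simp
  then show ?thesis using le_square_if_le_mult_sqrt[OF t0] by (simp add: t_def b_def)
qed

lemma sum_two_points:
  assumes "r < n" "s < n" "r \<noteq> s" "\<And>t. t \<noteq> r \<Longrightarrow> t \<noteq> s \<Longrightarrow> f t = (0 :: complex)"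
  shows "(\<Sum>t<(n::nat). f t) = f r + f s"
proof -
  have "(\<Sum>t<n. f t) = (\<Sum>t\<in>{r, s}. f t)"
    using assms by (intro sum.mono_neutral_right) auto
  then show ?thesis using assms by simp
qed

lemma sesq_two_points:
  assumes "r < n" "s < n" "r \<noteq> s"
  shows "sesq n S (\<lambda>t. if t = r then 1 else if t = s then z else 0) (\<lambda>t. if t = r then 1 else if t = s then z else 0)
    = S r r + z * S r s + cnj z * S s r + cnj z * z * S s s"
proof -
  define x where "x = (\<lambda>t. if t = r then 1 else if t = s then z else 0)"
  have x: "x r = 1" "x s = z" "\<And>t. t \<noteq> r \<Longrightarrow> t \<noteq> s \<Longrightarrow> x t = 0" using assms by (auto simp: x_def)
  have right: "(\<Sum>b<n. S a b * x b) = S a r + S a s * z" for a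
    using sum_two_points[OF assms, of "\<lambda>b. S a b * x b"] by (simp add: x)
  have "ip n x w = w r + cnj z * w s" for w
    using sum_two_points[OF assms, of "\<lambda>a. cnj (x a) * w a"] by (simp add: x ip_def)
  then have "sesq n S x x = (S r r + S r s * z) + cnj z * (S s r + S s s * z)"
    unfolding sesq_eq_ip_right by (simp add: right)
  then show ?thesis unfolding x_def by (simp add: algebra_simps)
qed

lemma sesq_one_point:
  assumes "r < n"
  shows "sesq n S (\<lambda>t. if t = r then 1 else 0) (\<lambda>t. if t = r then 1 else 0) = S r r"
proof -
  define x :: "nat \<Rightarrow> complex" where "x = (\<lambda>t. if t = r then 1 else 0)"
  have "(\<Sum>t<n. f t * x t) = f r" for f
    unfolding x_def using assms by (simp only: sum_mult_delta) simp
  moreover have "ip n x w = (\<Sum>t<n. w t * x t)" for w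
    unfolding ip_def by (intro sum.cong refl) (simp add: x_def)
  ultimately show ?thesis by (simp add: sesq_eq_ip_right flip: x_def)
qed

text \<open>Polarisation: a complex form with real values on the diagonal is Hermitian. Vectors with
  entries 1 and z at two places give the imaginary part of the relation for z = 1 and the real part
  for z = i.\<close>

lemma psd_fun_hermitian:
  assumes psd: "psd_fun n S" and rs: "r < n" "s < n"
  shows "S s r = cnj (S r s)"
proof (cases "r = s")
  case True
  have "0 \<le> sesq n S (\<lambda>t. if t = r then 1 else 0) (\<lambda>t. if t = r then 1 else 0)"
    using psd by (simp add: psd_fun_def)
  then have "0 \<le> S r r" unfolding sesq_one_point[OF rs(1)] .
  then show ?thesis using True by (simp add: complex_eq_iff less_eq_complex_def)
next
  case False
  have form: "Im (sesq n S x x) = 0" for x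
    using psd by (simp add: psd_fun_def less_eq_complex_def)
  have diag: "Im (S t t) = 0" if "t < n" for t
    using form[of "\<lambda>u. if u = t then 1 else 0"] unfolding sesq_one_point[OF that] .
  have "Im (S r r + z * S r s + cnj z * S s r + cnj z * z * S s s) = 0" for z
    using form[of "\<lambda>t. if t = r then 1 else if t = s then z else 0"]
    unfolding sesq_two_points[OF rs False] .
  from this[of 1] this[of \<i>] diag rs show ?thesis by (simp add: complex_eq_iff)
qed

lemma psd_fun_diag: "psd_fun n S \<Longrightarrow> r < n \<Longrightarrow> 0 \<le> S r r"
  using sesq_one_point[of r n S, symmetric] by (simp add: psd_fun_def)

lemma eigensystem_orthonormal: "eigensystem n S u l \<Longrightarrow> orthonormal_system n n u"
  by (simp add: eigensystem_def)

lemma eigensystem_trprod: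
  assumes "eigensystem n S u l"
  shows "trprod n Q S = (\<Sum>i<n. l i * sesq n Q (u i) (u i))"
proof -
  have "trprod n Q S = (\<Sum>r<n. \<Sum>s<n. \<Sum>i<n. l i * (cnj (u i r) * Q r s * u i s))"
    using assms by (simp add: trprod_def eigensystem_def sum_distrib_left mult_ac)
  also have "\<dots> = (\<Sum>i<n. \<Sum>r<n. \<Sum>s<n. l i * (cnj (u i r) * Q r s * u i s))"
    by (rule sum_rotate3)
  finally show ?thesis by (simp add: sesq_def sum_distrib_left)
qed

lemma eigensystem_sesq:
  assumes "eigensystem n S u l"
  shows "sesq n S x y = (\<Sum>i<n. l i * ip n x (u i) * ip n (u i) y)"
proof -
  \<comment> \<open>The form at x, y is the trace of S against the rank-one matrix made of y and x,
    so the trace formula applies.\<close>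
  have "sesq n S x y = trprod n (\<lambda>r s. y r * cnj (x s)) S"
    unfolding sesq_def trprod_def by (subst sum.swap) (simp add: mult_ac)
  also have "\<dots> = (\<Sum>i<n. l i * ip n x (u i) * ip n (u i) y)"
    unfolding eigensystem_trprod[OF assms]
  proof (intro sum.cong refl)
    fix i
    have "sesq n (\<lambda>r s. y r * cnj (x s)) (u i) (u i) = ip n (u i) y * ip n x (u i)"
      by (simp only: sesq_def ip_def sum_product) (simp only: mult_ac)
    then show "l i * sesq n (\<lambda>r s. y r * cnj (x s)) (u i) (u i) = l i * ip n x (u i) * ip n (u i) y"
      by simp
  qed
  finally show ?thesis .
qed

lemma eigensystem_trace:
  assumes "eigensystem n S u l"
  shows "(\<Sum>r<n. S r r) = complex_of_real (\<Sum>i<n. l i)"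
proof -
  have "(\<Sum>r<n. S r r) = (\<Sum>i<n. l i * ip n (u i) (u i))"
    using assms unfolding eigensystem_def ip_def sum_distrib_left
    by (subst sum.swap) (simp add: mult_ac)
  then show ?thesis using ip_orthonormal[OF eigensystem_orthonormal[OF assms]] by simp
qed

lemma eigensystem_eigenvalue:
  assumes "eigensystem n S u l" "i < n"
  shows "sesq n S (u i) (u i) = l i"
proof -
  have "sesq n S (u i) (u i) = (\<Sum>j<n. complex_of_real (l j) * (if j = i then 1 else 0))"
    unfolding eigensystem_sesq[OF assms(1)] using assms(2)
    by (intro sum.cong refl) (auto simp: ip_orthonormal[OF eigensystem_orthonormal[OF assms(1)]])
  then show ?thesis using assms(2) by (simp add: sum_mult_delta)
qed

lemma eigensystem_psd:
  assumes "eigensystem n S u l" "psd_fun n S" "i < n"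
  shows "0 \<le> l i"
proof -
  have "0 \<le> sesq n S (u i) (u i)" using assms(2) by (simp add: psd_fun_def)
  then show ?thesis unfolding eigensystem_eigenvalue[OF assms(1,3)] by (simp add: less_eq_complex_def)
qed

text \<open>One fixed choice makes \<open>negentropy\<close> a function of the matrix without a
  proof that the value is independent of the eigenbasis.\<close>

definition eigen_vec :: "nat \<Rightarrow> (nat \<Rightarrow> nat \<Rightarrow> complex) \<Rightarrow> nat \<Rightarrow> nat \<Rightarrow> complex" where
  "eigen_vec n S = (SOME u. \<exists>l. eigensystem n S u l)"

definition eigen_val :: "nat \<Rightarrow> (nat \<Rightarrow> nat \<Rightarrow> complex) \<Rightarrow> nat \<Rightarrow> real" where
  "eigen_val n S = (SOME l. eigensystem n S (eigen_vec n S) l)"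

lemma eigensystem_eigen:
  assumes "psd_fun n S"
  shows "eigensystem n S (eigen_vec n S) (eigen_val n S)"
proof -
  have "\<exists>u l. eigensystem n S u l"
    by (rule hermitian_eigensystem) (rule psd_fun_hermitian[OF assms])
  then have "\<exists>l. eigensystem n S (eigen_vec n S) l" unfolding eigen_vec_def by (rule someI_ex)
  then show ?thesis unfolding eigen_val_def by (rule someI_ex)
qed

text \<open>For S of trace p > 0 this is minus p times the entropy of S / p, in natural units. The
  factor p is the weight that a conditional entropy gives to an outcome of probability p.\<close>

definition negentropy :: "nat \<Rightarrow> (nat \<Rightarrow> nat \<Rightarrow> complex) \<Rightarrow> real" where
  "negentropy n S = (\<Sum>i<n. eigen_val n S i * ln (eigen_val n S i))
     - (\<Sum>i<n. eigen_val n S i) * ln (\<Sum>i<n. eigen_val n S i)"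

lemma negentropy_nonpos:
  assumes "psd_fun n S"
  shows "negentropy n S \<le> 0"
proof -
  define l where "l = eigen_val n S"
  have l: "0 \<le> l i" if "i < n" for i
    using eigensystem_psd[OF eigensystem_eigen[OF assms] assms that] by (simp add: l_def)
  have "l i * ln (l i) \<le> l i * ln (\<Sum>i<n. l i)" if "i < n" for i
  proof (cases "l i = 0")
    case False
    moreover have "l i \<le> (\<Sum>i<n. l i)" using that l by (intro member_le_sum) auto
    ultimately show ?thesis using l[OF that] by (intro mult_left_mono ln_mono) auto
  qed simp
  then have "(\<Sum>i<n. l i * ln (l i)) \<le> (\<Sum>i<n. l i * ln (\<Sum>i<n. l i))" by (intro sum_mono) simp
  then show ?thesis by (simp add: negentropy_def l_def sum_distrib_right)
qed

text \<open>Gibbs' inequality against the uniform distribution, summand by summand from ln x \<le> x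
  - 1.\<close>

lemma negentropy_ge:
  assumes "psd_fun n S" "(\<Sum>r<n. S r r) = 1"
  shows "- ln n \<le> negentropy n S"
proof -
  define l where "l = eigen_val n S"
  have l: "0 \<le> l i" if "i < n" for i
    using eigensystem_psd[OF eigensystem_eigen[OF assms(1)] assms(1) that] by (simp add: l_def)
  have sum: "(\<Sum>i<n. l i) = 1"
    using eigensystem_trace[OF eigensystem_eigen[OF assms(1)]] assms(2)
    unfolding l_def by (metis of_real_eq_1_iff)
  then have n: "0 < n" by (cases n) auto
  have "l i - 1 / n \<le> l i * ln (l i) + l i * ln n" if "i < n" for i
  proof (cases "l i = 0")
    case False
    then have "0 < l i" using l[OF that] by simp
    then have "ln (1 / n / l i) \<le> 1 / n / l i - 1" using n by (intro ln_le_minus_one) auto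
    then have "l i * ln (1 / n / l i) \<le> l i * (1 / n / l i - 1)" using \<open>0 < l i\<close> by (intro mult_left_mono) auto
    also have "l i * (1 / n / l i - 1) = 1 / n - l i" using \<open>0 < l i\<close> by (simp add: right_diff_distrib)
    also have "ln (1 / n / l i) = - ln n - ln (l i)" using n \<open>0 < l i\<close> by (simp add: ln_div ln_mult)
    finally show ?thesis by (simp add: algebra_simps)
  qed simp
  then have "(\<Sum>i<n. l i - 1 / n) \<le> (\<Sum>i<n. l i * ln (l i) + l i * ln n)" by (intro sum_mono) simp
  then have "0 \<le> (\<Sum>i<n. l i * ln (l i)) + ln n"
    using n sum by (simp add: sum_subtractf sum.distrib sum_distrib_right[symmetric])
  then show ?thesis using sum by (simp add: negentropy_def flip: l_def)
qed

section \<open>The chain rule bound\<close>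

abbreviation trace_re :: "nat \<Rightarrow> (nat \<Rightarrow> nat \<Rightarrow> complex) \<Rightarrow> real" where
  "trace_re n R \<equiv> Re (\<Sum>r<n. R r r)"

text \<open>The \<open>R y\<close> decompose S as conditional states decompose their average.
  \<open>D y\<close> is the relative entropy of \<open>R y\<close> to the multiple of S with the
  same trace. Their total is the Holevo information, which is the gain in negentropy, and each of
  them controls how far \<open>R y\<close> is from that multiple under the test operator
  \<open>Q y\<close>.\<close>

lemma negentropy_increment:
  fixes S :: "nat \<Rightarrow> nat \<Rightarrow> complex" and R Q :: "'y \<Rightarrow> nat \<Rightarrow> nat \<Rightarrow> complex"
  assumes Y: "finite Y" and S: "psd_fun n S" and R: "\<And>y. y \<in> Y \<Longrightarrow> psd_fun n (R y)"
    and SR: "\<And>r s. r < n \<Longrightarrow> s < n \<Longrightarrow> S r s = (\<Sum>y\<in>Y. R y r s)"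
    and Q: "\<And>y. y \<in> Y \<Longrightarrow> sesq_bounded n (Q y) C"
  shows "\<exists>D. (\<forall>y\<in>Y. 0 \<le> D y \<and>
      (cmod (trprod n (Q y) (R y) - trace_re n (R y) / trace_re n S * trprod n (Q y) S))\<^sup>2
        \<le> 2 * C\<^sup>2 * trace_re n (R y) * D y)
    \<and> (\<Sum>y\<in>Y. D y) = (\<Sum>y\<in>Y. negentropy n (R y)) - negentropy n S"
proof -
  define v m where "v = eigen_vec n S" and "m = eigen_val n S"
  define u l where "u y = eigen_vec n (R y)" and "l y = eigen_val n (R y)" for y
  define a where "a y i j = ip n (u y i) (v j)" for y i j
  define b where "b y i j = sesq n (Q y) (v j) (u y i)" for y i j
  \<comment> \<open>The diagonal of \<open>R y\<close> in the eigenbasis of S, the only part of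
    \<open>R y\<close> that enters the trace against ln S.\<close>
  define c where "c y j = (\<Sum>i<n. l y i * (cmod (a y i j))\<^sup>2)" for y j
  define p where "p = (\<Sum>j<n. m j)"
  define q where "q y = (\<Sum>i<n. l y i)" for y
  \<comment> \<open>The last two terms come from scaling S to the trace of
    \<open>R y\<close>.\<close>
  define D where "D y = (\<Sum>i<n. l y i * ln (l y i)) - (\<Sum>j<n. c y j * ln (m j)) - q y * ln (q y) + q y * ln p" for y
  have eS: "eigensystem n S v m" unfolding v_def m_def by (rule eigensystem_eigen[OF S])
  have eR: "eigensystem n (R y) (u y) (l y)" if "y \<in> Y" for y
    unfolding u_def l_def by (rule eigensystem_eigen[OF R[OF that]])
  note on_v = eigensystem_orthonormal[OF eS]
  note on_u = eigensystem_orthonormal[OF eR]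
  have trS: "trace_re n S = p" unfolding eigensystem_trace[OF eS] p_def by simp
  have trR: "trace_re n (R y) = q y" if "y \<in> Y" for y
    unfolding eigensystem_trace[OF eR[OF that]] q_def by simp
  have m0: "0 \<le> m j" if "j < n" for j using eigensystem_psd[OF eS S that] .
  have l0: "0 \<le> l y i" if "y \<in> Y" "i < n" for y i using eigensystem_psd[OF eR R] that by blast
  have q0: "0 \<le> q y" if "y \<in> Y" for y unfolding q_def using l0[OF that] by (intro sum_nonneg) auto
  have c0: "0 \<le> c y j" if "y \<in> Y" for y j unfolding c_def using l0[OF that] by (intro sum_nonneg) auto
  have pq: "p = (\<Sum>y\<in>Y. q y)"
  proof -
    have "(\<Sum>r<n. S r r) = (\<Sum>y\<in>Y. \<Sum>r<n. R y r r)" using SR by (subst sum.swap) simp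
    then have "trace_re n S = (\<Sum>y\<in>Y. trace_re n (R y))" by simp
    then show ?thesis using trS trR by simp
  qed
  \<comment> \<open>The diagonals add up to the eigenvalues of S, so the cross terms of all
    \<open>D y\<close> together give the term of S itself.\<close>
  have cm: "(\<Sum>y\<in>Y. c y j) = m j" if j: "j < n" for j
  proof -
    have "sesq n (R y) (v j) (v j) = complex_of_real (c y j)" if "y \<in> Y" for y
    proof -
      have "ip n (v j) (u y i) * ip n (u y i) (v j) = complex_of_real ((cmod (a y i j))\<^sup>2)" for i
        by (simp add: a_def cnj_ip[of n "u y i" "v j", symmetric] mult.commute complex_mult_cnj cmod_power2)
      then show ?thesis unfolding eigensystem_sesq[OF eR[OF that]] c_def by (simp add: mult.assoc)
    qed
    then have "complex_of_real (\<Sum>y\<in>Y. c y j) = (\<Sum>y\<in>Y. sesq n (R y) (v j) (v j))" by simp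
    also have "\<dots> = sesq n S (v j) (v j)"
    proof -
      have "sesq n S (v j) (v j) = (\<Sum>r<n. \<Sum>s<n. \<Sum>y\<in>Y. cnj (v j r) * R y r s * v j s)"
        unfolding sesq_def using SR by (intro sum.cong refl) (simp add: sum_distrib_left sum_distrib_right)
      also have "\<dots> = (\<Sum>y\<in>Y. sesq n (R y) (v j) (v j))" unfolding sesq_def by (rule sum_rotate3)
      finally show ?thesis ..
    qed
    also have "\<dots> = complex_of_real (m j)" by (rule eigensystem_eigenvalue[OF eS j])
    finally show ?thesis unfolding of_real_eq_iff .
  qed
  have a1: "(\<Sum>j<n. (cmod (a y i j))\<^sup>2) = 1" if "y \<in> Y" "i < n" for y i
  proof -
    have "cmod (a y i j) = cmod (ip n (v j) (u y i))" for j
      unfolding a_def by (metis cnj_ip complex_mod_cnj)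
    then show ?thesis using parseval[OF on_v, of "u y i"] ip_orthonormal[OF on_u[OF that(1)] that(2,2)] by simp
  qed
  have a2: "(\<Sum>i<n. (cmod (a y i j))\<^sup>2) = 1" if "y \<in> Y" "j < n" for y j
    unfolding a_def using parseval[OF on_u[OF that(1)], of "v j"] ip_orthonormal[OF on_v that(2,2)] by simp
  have sumc: "(\<Sum>j<n. c y j) = q y" if "y \<in> Y" for y
    unfolding c_def q_def
    by (subst sum.swap) (simp add: sum_distrib_left[symmetric] a1[OF that])
  have "0 \<le> D y \<and> (cmod (trprod n (Q y) (R y) - trace_re n (R y) / trace_re n S * trprod n (Q y) S))\<^sup>2
        \<le> 2 * C\<^sup>2 * trace_re n (R y) * D y" if y: "y \<in> Y" for y
  proof -
    define m' where "m' j = q y / p * m j" for j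
    have qp: "q y \<le> p" unfolding pq using y Y q0 by (intro member_le_sum) auto
    then have p0: "0 \<le> p" using q0[OF y] by simp
    have m'0: "0 \<le> m' j" if "j < n" for j using that m0 q0[OF y] p0 by (simp add: m'_def)
    \<comment> \<open>Absolute continuity: where an eigenvalue of S vanishes, the nonnegative
      \<open>c y j\<close> sum to 0, so no \<open>R y\<close> has weight there. This supplies the
      hypothesis \<open>null\<close> of the Pinsker estimate.\<close>
    have c_null: "c y j = 0" if "j < n" "m' j = 0" for j
    proof (cases "q y = 0")
      case True
      then have "\<And>i. i < n \<Longrightarrow> l y i = 0" using l0[OF y] unfolding q_def
        by (subst (asm) sum_nonneg_eq_0_iff) auto
      then show ?thesis by (simp add: c_def)
    next
      case False
      then have "p \<noteq> 0" using qp q0[OF y] by auto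
      then have "m j = 0" using that False by (simp add: m'_def)
      then have "\<forall>y\<in>Y. c y j = 0"
        using cm[OF that(1)] c0 Y by (simp add: sum_nonneg_eq_0_iff)
      then show ?thesis using y by simp
    qed
    have null: "l y i * (cmod (a y i j))\<^sup>2 = 0" if "i < n" "j < n" "m' j = 0" for i j
    proof -
      have "\<forall>i\<in>{..<n}. l y i * (cmod (a y i j))\<^sup>2 = 0"
        using c_null[OF that(2,3)] l0[OF y] unfolding c_def by (subst (asm) sum_nonneg_eq_0_iff) auto
      then show ?thesis using that by blast
    qed
    have b1: "(\<Sum>j<n. (cmod (b y i j))\<^sup>2) \<le> C\<^sup>2" if "i < n" for i
      unfolding b_def using sesq_bounded_column[OF Q[OF y] on_v] ip_orthonormal[OF on_u[OF y] that that] by simp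
    have b2: "(\<Sum>i<n. (cmod (b y i j))\<^sup>2) \<le> C\<^sup>2" if "j < n" for j
      unfolding b_def using sesq_bounded_row[OF Q[OF y] on_u[OF y]] ip_orthonormal[OF on_v that that] by simp
    have summ': "(\<Sum>j<n. m' j) = q y"
      using qp q0[OF y] unfolding m'_def sum_distrib_left[symmetric] p_def[symmetric] by auto
    have cln: "c y j * ln (m' j) = c y j * ln (m j) + c y j * ln (q y) - c y j * ln p" if "j < n" for j
    proof (cases "c y j = 0")
      case False
      then have "m' j \<noteq> 0" using c_null that by auto
      then have "0 < m j" "0 < q y" "0 < p" using m0[OF that] q0[OF y] p0 by (auto simp: m'_def less_le)
      then have "ln (m' j) = ln (m j) + ln (q y) - ln p" by (simp add: m'_def ln_mult ln_div)
      then show ?thesis by (simp only: right_diff_distrib distrib_left)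
    qed simp
    have Deq: "(\<Sum>i<n. \<Sum>j<n. (cmod (a y i j))\<^sup>2 * (l y i * (ln (l y i) - ln (m' j)))) = D y"
    proof -
      have "(\<Sum>i<n. \<Sum>j<n. (cmod (a y i j))\<^sup>2 * (l y i * (ln (l y i) - ln (m' j))))
          = (\<Sum>i<n. \<Sum>j<n. (cmod (a y i j))\<^sup>2 * (l y i * ln (l y i)))
            - (\<Sum>i<n. \<Sum>j<n. l y i * (cmod (a y i j))\<^sup>2 * ln (m' j))"
        by (simp add: sum_subtractf[symmetric] right_diff_distrib mult_ac)
      also have "(\<Sum>i<n. \<Sum>j<n. (cmod (a y i j))\<^sup>2 * (l y i * ln (l y i))) = (\<Sum>i<n. l y i * ln (l y i))"
        using a1[OF y] by (simp add: sum_distrib_right[symmetric])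
      also have "(\<Sum>i<n. \<Sum>j<n. l y i * (cmod (a y i j))\<^sup>2 * ln (m' j)) = (\<Sum>j<n. c y j * ln (m' j))"
        unfolding c_def by (subst sum.swap) (simp add: sum_distrib_right)
      also have "(\<Sum>j<n. c y j * ln (m' j)) = (\<Sum>j<n. c y j * ln (m j)) + q y * ln (q y) - q y * ln p"
        using sumc[OF y] by (simp add: cln sum.distrib sum_subtractf sum_distrib_right[symmetric])
      finally show ?thesis by (simp add: D_def)
    qed
    \<comment> \<open>Each trace is taken in the eigenbasis of its own matrix, and then one argument
      of the form is expanded in the other basis. Both become sums over the same products of
      overlaps and matrix elements.\<close>
    have "trprod n (Q y) (R y) = (\<Sum>i<n. \<Sum>j<n. l y i * a y i j * b y i j)"
      unfolding eigensystem_trprod[OF eR[OF y]] a_def b_def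
      by (intro sum.cong refl)
        (subst sesq_expand_left[OF on_v], simp add: sum_distrib_left mult_ac)
    moreover have "q y / p * trprod n (Q y) S = (\<Sum>i<n. \<Sum>j<n. m' j * a y i j * b y i j)"
    proof -
      have "q y / p * trprod n (Q y) S = (\<Sum>j<n. m' j * sesq n (Q y) (v j) (v j))"
        unfolding eigensystem_trprod[OF eS] by (simp add: m'_def sum_distrib_left mult_ac)
      also have "\<dots> = (\<Sum>j<n. \<Sum>i<n. m' j * a y i j * b y i j)"
        unfolding a_def b_def
        by (intro sum.cong refl)
          (subst sesq_expand_right[OF on_u[OF y]], simp add: sum_distrib_left mult_ac)
      also have "\<dots> = (\<Sum>i<n. \<Sum>j<n. m' j * a y i j * b y i j)" by (rule sum.swap)
      finally show ?thesis .
    qed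
    ultimately have diff: "trprod n (Q y) (R y) - q y / p * trprod n (Q y) S
        = (\<Sum>i<n. \<Sum>j<n. complex_of_real (l y i - m' j) * a y i j * b y i j)"
      by (simp add: sum_subtractf[symmetric] left_diff_distrib)
    have sl: "(\<Sum>i<n. l y i) = q y" by (simp add: q_def)
    have "0 \<le> D y"
      unfolding Deq[symmetric]
      by (rule pinsker_overlap(2)[where p = "q y" and C = C and b = "b y"])
        (fact l0[OF y] m'0 null a1[OF y] a2[OF y] b1 b2 sl summ')+
    moreover have "(cmod (\<Sum>i<n. \<Sum>j<n. complex_of_real (l y i - m' j) * a y i j * b y i j))\<^sup>2
        \<le> 2 * C\<^sup>2 * q y * D y"
      unfolding Deq[symmetric]
      by (rule pinsker_overlap(1)) (fact l0[OF y] m'0 null a1[OF y] a2[OF y] b1 b2 sl summ')+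
    ultimately show ?thesis unfolding trS trR[OF y] diff by blast
  qed
  moreover have "(\<Sum>y\<in>Y. D y) = (\<Sum>y\<in>Y. negentropy n (R y)) - negentropy n S"
  proof -
    have "(\<Sum>y\<in>Y. \<Sum>j<n. c y j * ln (m j)) = (\<Sum>j<n. m j * ln (m j))"
      by (subst sum.swap) (simp add: sum_distrib_right[symmetric] cm)
    moreover have "(\<Sum>y\<in>Y. q y * ln p) = p * ln p" by (simp add: pq sum_distrib_right[symmetric])
    moreover have "negentropy n (R y) = (\<Sum>i<n. l y i * ln (l y i)) - q y * ln (q y)" for y
      by (simp add: negentropy_def l_def q_def)
    moreover have "negentropy n S = (\<Sum>j<n. m j * ln (m j)) - p * ln p"
      by (simp add: negentropy_def m_def p_def)
    ultimately show ?thesis by (simp add: D_def sum.distrib sum_subtractf)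
  qed
  ultimately show ?thesis by blast
qed

text \<open>The possible records of k measurements; the latest outcome stands last.\<close>

definition words :: "'y set \<Rightarrow> nat \<Rightarrow> 'y list set" where
  "words Y k = {zs. set zs \<subseteq> Y \<and> length zs = k}"

lemma finite_words: "finite Y \<Longrightarrow> finite (words Y k)"
  unfolding words_def by (rule finite_lists_length_eq)

lemma words_0 [simp]: "words Y 0 = {[]}"
  by (auto simp: words_def)

lemma sum_words_Suc:
  assumes "finite Y"
  shows "(\<Sum>zs\<in>words Y (Suc k). f zs) = (\<Sum>zs\<in>words Y k. \<Sum>y\<in>Y. f (zs @ [y]))"
proof -
  have "bij_betw (\<lambda>(zs, y). zs @ [y]) (words Y k \<times> Y) (words Y (Suc k))"
  proof (rule bij_betw_byWitness[where f' = "\<lambda>ws. (butlast ws, last ws)"])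
    show "\<forall>ws\<in>words Y (Suc k). (case (butlast ws, last ws) of (zs, y) \<Rightarrow> zs @ [y]) = ws"
      by (auto simp: words_def) (metis append_butlast_last_id length_0_conv nat.distinct(1))
    show "(\<lambda>ws. (butlast ws, last ws)) ` words Y (Suc k) \<subseteq> words Y k \<times> Y"
    proof clarsimp
      fix ws assume ws: "ws \<in> words Y (Suc k)"
      then have "ws \<noteq> []" by (auto simp: words_def)
      with ws show "butlast ws \<in> words Y k \<and> last ws \<in> Y"
        by (auto simp: words_def dest: in_set_butlastD last_in_set)
    qed
  qed (auto simp: words_def)
  from sum.reindex_bij_betw[OF this, of f] show ?thesis
    by (simp add: sum.cartesian_product case_prod_unfold)
qed

text \<open>\<open>s zs\<close> is the unnormalised state after the record \<open>zs\<close>, with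
  the probability of the record as its trace. \<open>F k\<close> is minus the conditional entropy
  given k outcomes: it starts at no less than - ln N and ends at no more than 0.\<close>

theorem information_chain_bound:
  fixes s :: "'y list \<Rightarrow> nat \<Rightarrow> nat \<Rightarrow> complex" and Q :: "'y \<Rightarrow> nat \<Rightarrow> nat \<Rightarrow> complex"
    and N n :: nat
  assumes Y: "finite Y" and n: "0 < n" and C: "0 \<le> C"
    and psd: "\<And>k zs. k \<le> n \<Longrightarrow> zs \<in> words Y k \<Longrightarrow> psd_fun N (s zs)"
    and split: "\<And>k zs i j. k < n \<Longrightarrow> zs \<in> words Y k \<Longrightarrow> i < N \<Longrightarrow> j < N \<Longrightarrow>
      s zs i j = (\<Sum>y\<in>Y. s (zs @ [y]) i j)"
    and one: "(\<Sum>i<N. s [] i i) = 1"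
    and Q: "\<And>y. y \<in> Y \<Longrightarrow> sesq_bounded N (Q y) C"
  shows "\<exists>k<n. (\<Sum>zs\<in>words Y k. trace_re N (s zs)) = 1 \<and>
    (\<Sum>zs\<in>words Y k. \<Sum>y\<in>Y. cmod (trprod N (Q y) (s (zs @ [y]))
      - trace_re N (s (zs @ [y])) / trace_re N (s zs) * trprod N (Q y) (s zs))) \<le> C * sqrt (2 * ln N / n)"
proof -
  define d where "d zs y = cmod (trprod N (Q y) (s (zs @ [y]))
      - trace_re N (s (zs @ [y])) / trace_re N (s zs) * trprod N (Q y) (s zs))" for zs y
  define F where "F k = (\<Sum>zs\<in>words Y k. negentropy N (s zs))" for k
  have tr0: "0 \<le> trace_re N (s zs)" if "k \<le> n" "zs \<in> words Y k" for k zs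
  proof -
    have "0 \<le> (\<Sum>r<N. s zs r r)" using psd_fun_diag[OF psd[OF that]] by (intro sum_nonneg) auto
    then show ?thesis by (simp only: less_eq_complex_def) simp
  qed
  have app: "zs @ [y] \<in> words Y (Suc k)" if "zs \<in> words Y k" "y \<in> Y" for zs y k
    using that by (auto simp: words_def)
  have total: "(\<Sum>zs\<in>words Y k. trace_re N (s zs)) = 1" if "k \<le> n" for k
    using that
  proof (induction k)
    case 0
    show ?case using one by simp
  next
    case (Suc k)
    have "(\<Sum>y\<in>Y. trace_re N (s (zs @ [y]))) = trace_re N (s zs)" if "zs \<in> words Y k" for zs
    proof -
      have "(\<Sum>r<N. s zs r r) = (\<Sum>y\<in>Y. \<Sum>r<N. s (zs @ [y]) r r)"
        using split[OF _ that] Suc.prems by (subst sum.swap) simp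
      then show ?thesis by simp
    qed
    then have "(\<Sum>zs\<in>words Y (Suc k). trace_re N (s zs)) = (\<Sum>zs\<in>words Y k. trace_re N (s zs))"
      unfolding sum_words_Suc[OF Y] by (intro sum.cong refl) blast
    then show ?case using Suc by simp
  qed
  \<comment> \<open>Cauchy-Schwarz over all pairs of a record and a next outcome at once: the
    probabilities sum to 1, the relative entropies to the increment of \<open>F\<close>.\<close>
  have step: "(\<Sum>zs\<in>words Y k. \<Sum>y\<in>Y. d zs y)\<^sup>2 \<le> 2 * C\<^sup>2 * (F (Suc k) - F k)" if k: "k < n" for k
  proof -
    have "\<forall>zs\<in>words Y k. \<exists>D. (\<forall>y\<in>Y. 0 \<le> D y \<and> (d zs y)\<^sup>2 \<le> 2 * C\<^sup>2 * trace_re N (s (zs @ [y])) * D y)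
        \<and> (\<Sum>y\<in>Y. D y) = (\<Sum>y\<in>Y. negentropy N (s (zs @ [y]))) - negentropy N (s zs)"
    proof
      fix zs assume zs: "zs \<in> words Y k"
      show "\<exists>D. (\<forall>y\<in>Y. 0 \<le> D y \<and> (d zs y)\<^sup>2 \<le> 2 * C\<^sup>2 * trace_re N (s (zs @ [y])) * D y)
        \<and> (\<Sum>y\<in>Y. D y) = (\<Sum>y\<in>Y. negentropy N (s (zs @ [y]))) - negentropy N (s zs)"
        unfolding d_def
        by (rule negentropy_increment[OF Y psd[OF _ zs] psd[OF _ app[OF zs]] split[OF k zs] Q])
          (use k in auto)
    qed
    then obtain D where D: "\<forall>zs\<in>words Y k. (\<forall>y\<in>Y. 0 \<le> D zs y \<and>
        (d zs y)\<^sup>2 \<le> 2 * C\<^sup>2 * trace_re N (s (zs @ [y])) * D zs y)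
        \<and> (\<Sum>y\<in>Y. D zs y) = (\<Sum>y\<in>Y. negentropy N (s (zs @ [y]))) - negentropy N (s zs)"
      by (rule bchoice[THEN exE])
    let ?I = "words Y k \<times> Y"
    have "(\<Sum>zs\<in>words Y k. \<Sum>y\<in>Y. d zs y)\<^sup>2 = (\<Sum>z\<in>?I. \<bar>d (fst z) (snd z)\<bar>)\<^sup>2"
      by (simp add: sum.cartesian_product case_prod_unfold d_def)
    also have "\<dots> \<le> (\<Sum>z\<in>?I. trace_re N (s (fst z @ [snd z]))) * (\<Sum>z\<in>?I. 2 * C\<^sup>2 * D (fst z) (snd z))"
    proof (rule sum_sqrt_Cauchy_Schwarz)
      fix z assume z: "z \<in> ?I"
      then show "0 \<le> trace_re N (s (fst z @ [snd z]))"
        using tr0[OF _ app[of "fst z" k "snd z"]] k by auto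
      show "0 \<le> 2 * C\<^sup>2 * D (fst z) (snd z)" using D z by auto
      have "(d (fst z) (snd z))\<^sup>2 \<le> 2 * C\<^sup>2 * trace_re N (s (fst z @ [snd z])) * D (fst z) (snd z)"
        using D z by (auto simp del: Re_sum)
      then show "(d (fst z) (snd z))\<^sup>2 \<le> trace_re N (s (fst z @ [snd z])) * (2 * C\<^sup>2 * D (fst z) (snd z))"
        by (simp only: mult_ac)
    qed
    also have "(\<Sum>z\<in>?I. trace_re N (s (fst z @ [snd z]))) = (\<Sum>zs\<in>words Y (Suc k). trace_re N (s zs))"
      unfolding sum_words_Suc[OF Y] sum.cartesian_product case_prod_unfold ..
    also have "\<dots> = 1" using total k by simp
    also have "(\<Sum>z\<in>?I. 2 * C\<^sup>2 * D (fst z) (snd z)) = 2 * C\<^sup>2 * (\<Sum>zs\<in>words Y k. \<Sum>y\<in>Y. D zs y)"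
      by (simp add: sum.cartesian_product case_prod_unfold sum_distrib_left)
    also have "(\<Sum>zs\<in>words Y k. \<Sum>y\<in>Y. D zs y) = F (Suc k) - F k"
      using D by (simp add: F_def sum_words_Suc[OF Y] sum_subtractf[symmetric])
    finally show ?thesis by simp
  qed
  have "F n \<le> 0" unfolding F_def using psd negentropy_nonpos by (intro sum_nonpos) blast
  moreover have "- ln N \<le> F 0" unfolding F_def using negentropy_ge[OF psd[of 0 "[]"] one] by simp
  moreover have "(\<Sum>k<n. F (Suc k) - F k) = F n - F 0" by (rule sum_lessThan_telescope)
  ultimately have le: "(\<Sum>k<n. F (Suc k) - F k) \<le> ln N" by simp
  have "\<exists>k<n. F (Suc k) - F k \<le> ln N / n"
  proof (rule ccontr)
    assume "\<not> ?thesis"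
    then have "(\<Sum>k<n. ln N / n) < (\<Sum>k<n. F (Suc k) - F k)" using n by (intro sum_strict_mono) auto
    with le n show False by simp
  qed
  then obtain k where k: "k < n" "F (Suc k) - F k \<le> ln N / n" by blast
  have "(\<Sum>zs\<in>words Y k. \<Sum>y\<in>Y. d zs y)\<^sup>2 \<le> 2 * C\<^sup>2 * (ln N / n)"
    using step[OF k(1)] mult_left_mono[OF k(2), of "2 * C\<^sup>2"] by simp
  then have "(\<Sum>zs\<in>words Y k. \<Sum>y\<in>Y. d zs y) \<le> sqrt (2 * C\<^sup>2 * (ln N / n))" by (rule real_le_rsqrt)
  also have "\<dots> = C * sqrt (2 * ln N / n)" using C by (simp add: real_sqrt_mult real_sqrt_divide)
  finally show ?thesis using k(1) total[of k] unfolding d_def by (intro exI[of _ k]) simp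
qed

section \<open>Tensor products\<close>

lemma dim_mat_adjoint [simp]: "dim_row (mat_adjoint A) = dim_col A" "dim_col (mat_adjoint A) = dim_row A"
  by (simp_all add: mat_adjoint_def)

lemma mat_adjoint_carrier [simp]: "A \<in> carrier_mat n m \<Longrightarrow> mat_adjoint A \<in> carrier_mat m n"
  by (intro carrier_matI) auto

lemma mat_adjoint_index [simp]:
  fixes A :: "complex mat"
  assumes "i < dim_col A" "j < dim_row A"
  shows "mat_adjoint A $$ (i, j) = cnj (A $$ (j, i))"
  using assms by (simp add: mat_adjoint_def mat_of_rows_def)

lemma mat_adjoint_one [simp]: "mat_adjoint (1\<^sub>m d) = (1\<^sub>m d :: complex mat)"
  by (intro eq_matI) auto

lemma mult_mat_index:
  fixes A B :: "complex mat"
  assumes "A \<in> carrier_mat n m" "B \<in> carrier_mat m k" "i < n" "j < k"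
  shows "(A * B) $$ (i, j) = (\<Sum>t<m. A $$ (i, t) * B $$ (t, j))"
  using assms by (auto simp: scalar_prod_def lessThan_atLeast0)

lemma tr_mult:
  assumes "A \<in> carrier_mat n m" "B \<in> carrier_mat m n"
  shows "tr (A * B) = (\<Sum>i<n. \<Sum>j<m. A $$ (i, j) * B $$ (j, i))"
  using assms by (simp add: tr_def mult_mat_index[OF assms] del: index_mult_mat(1))

lemma tensor_mat_carrier [simp]:
  "A \<in> carrier_mat a b \<Longrightarrow> B \<in> carrier_mat c d \<Longrightarrow> A \<otimes>\<^sub>m B \<in> carrier_mat (a * c) (b * d)"
  by (simp add: tensor_mat_def)

lemma tensor_mat_dim [simp]:
  "dim_row (A \<otimes>\<^sub>m B) = dim_row A * dim_row B" "dim_col (A \<otimes>\<^sub>m B) = dim_col A * dim_col B"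
  by (simp_all add: tensor_mat_def)

lemma product_index_less:
  fixes i k d1 d2 :: nat
  assumes "i < d1" "k < d2" shows "i * d2 + k < d1 * d2"
proof -
  have "i * d2 + k < Suc i * d2" using assms by simp
  also have "\<dots> \<le> d1 * d2" using assms by (intro mult_le_mono1) simp
  finally show ?thesis .
qed

lemma tensor_mat_index:
  assumes "A \<in> carrier_mat a b" "B \<in> carrier_mat c d" "r < a * c" "s < b * d"
  shows "(A \<otimes>\<^sub>m B) $$ (r, s) = A $$ (r div c, s div d) * B $$ (r mod c, s mod d)"
  using assms by (simp add: tensor_mat_def)

lemma tensor_mat_index':
  assumes "A \<in> carrier_mat a b" "B \<in> carrier_mat c d" "i < a" "k < c" "j < b" "l < d"
  shows "(A \<otimes>\<^sub>m B) $$ (i * c + k, j * d + l) = A $$ (i, j) * B $$ (k, l)"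
  using assms by (subst tensor_mat_index[OF assms(1,2)]) (auto intro: product_index_less)

lemma sum_product_index:
  fixes f :: "nat \<Rightarrow> 'a :: comm_monoid_add"
  shows "(\<Sum>r<d1 * d2. f r) = (\<Sum>i<d1. \<Sum>k<d2. f (i * d2 + k))"
proof (induction d1)
  case (Suc d1)
  have "(\<Sum>r<Suc d1 * d2. f r) = (\<Sum>r<d1 * d2. f r) + (\<Sum>r = d1 * d2..<d1 * d2 + d2. f r)"
  proof -
    have eq: "{..<Suc d1 * d2} = {..<d1 * d2} \<union> {d1 * d2..<d1 * d2 + d2}" by auto
    show ?thesis unfolding eq by (rule sum.union_disjoint) auto
  qed
  also have "(\<Sum>r = d1 * d2..<d1 * d2 + d2. f r) = (\<Sum>k<d2. f (d1 * d2 + k))"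
    using sum.shift_bounds_nat_ivl[of f 0 "d1 * d2" d2] by (simp add: atLeast0LessThan add.commute)
  finally show ?case using Suc by simp
qed simp

lemma mat_eq_product_index:
  assumes "A \<in> carrier_mat (a * c) (b * d)" "B \<in> carrier_mat (a * c) (b * d)"
    and "\<And>i k j l. i < a \<Longrightarrow> k < c \<Longrightarrow> j < b \<Longrightarrow> l < d \<Longrightarrow>
      A $$ (i * c + k, j * d + l) = B $$ (i * c + k, j * d + l)"
  shows "A = B"
proof (rule eq_matI)
  fix r s assume rs: "r < dim_row B" "s < dim_col B"
  then have rs: "r < a * c" "s < b * d" using assms by auto
  then have "0 < c" "0 < d" by (auto intro: gr0I)
  then have "r div c < a" "r mod c < c" "s div d < b" "s mod d < d"
    using rs by (simp_all add: less_mult_imp_div_less)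
  from assms(3)[OF this] show "A $$ (r, s) = B $$ (r, s)" by simp
qed (use assms in auto)

lemma tensor_mat_mult:
  assumes A: "A \<in> carrier_mat a b" and B: "B \<in> carrier_mat c d"
    and C: "C \<in> carrier_mat b e" and D: "D \<in> carrier_mat d f"
  shows "(A \<otimes>\<^sub>m B) * (C \<otimes>\<^sub>m D) = (A * C) \<otimes>\<^sub>m (B * D)"
proof (rule mat_eq_product_index[where a = a and b = e and c = c and d = f])
  note AB = tensor_mat_carrier[OF A B] and CD = tensor_mat_carrier[OF C D]
  note AC = mult_carrier_mat[OF A C] and BD = mult_carrier_mat[OF B D]
  show "(A \<otimes>\<^sub>m B) * (C \<otimes>\<^sub>m D) \<in> carrier_mat (a * c) (e * f)" using AB CD by simp
  show "(A * C) \<otimes>\<^sub>m (B * D) \<in> carrier_mat (a * c) (e * f)" using AC BD by simp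
  fix i k j l assume ix: "i < a" "k < c" "j < e" "l < f"
  have "((A \<otimes>\<^sub>m B) * (C \<otimes>\<^sub>m D)) $$ (i * c + k, j * f + l)
      = (\<Sum>t<b. \<Sum>u<d. (A \<otimes>\<^sub>m B) $$ (i * c + k, t * d + u) * (C \<otimes>\<^sub>m D) $$ (t * d + u, j * f + l))"
    using ix by (subst mult_mat_index[OF AB CD]) (auto intro: product_index_less simp: sum_product_index)
  also have "\<dots> = (\<Sum>t<b. \<Sum>u<d. (A $$ (i, t) * B $$ (k, u)) * (C $$ (t, j) * D $$ (u, l)))"
    using ix by (intro sum.cong refl) (simp add: tensor_mat_index'[OF A B] tensor_mat_index'[OF C D])
  also have "\<dots> = (\<Sum>t<b. A $$ (i, t) * C $$ (t, j)) * (\<Sum>u<d. B $$ (k, u) * D $$ (u, l))"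
    by (simp only: sum_product mult_ac)
  also have "\<dots> = ((A * C) \<otimes>\<^sub>m (B * D)) $$ (i * c + k, j * f + l)"
    using ix by (simp only: tensor_mat_index'[OF AC BD] mult_mat_index[OF A C] mult_mat_index[OF B D])
  finally show "((A \<otimes>\<^sub>m B) * (C \<otimes>\<^sub>m D)) $$ (i * c + k, j * f + l)
      = ((A * C) \<otimes>\<^sub>m (B * D)) $$ (i * c + k, j * f + l)" .
qed

lemma mat_adjoint_tensor:
  assumes A: "A \<in> carrier_mat a b" and B: "B \<in> carrier_mat c d"
  shows "mat_adjoint (A \<otimes>\<^sub>m B) = mat_adjoint A \<otimes>\<^sub>m mat_adjoint B"
proof (rule mat_eq_product_index[where a = b and b = a and c = d and d = c])
  fix i k j l assume ix: "i < b" "k < d" "j < a" "l < c"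
  have "mat_adjoint (A \<otimes>\<^sub>m B) $$ (i * d + k, j * c + l) = cnj ((A \<otimes>\<^sub>m B) $$ (j * c + l, i * d + k))"
    using A B ix by (intro mat_adjoint_index) (auto intro: product_index_less)
  also have "\<dots> = cnj (A $$ (j, i)) * cnj (B $$ (l, k))" using ix by (simp add: tensor_mat_index'[OF A B])
  also have "\<dots> = (mat_adjoint A \<otimes>\<^sub>m mat_adjoint B) $$ (i * d + k, j * c + l)"
    using ix A B by (simp add: tensor_mat_index'[OF mat_adjoint_carrier[OF A] mat_adjoint_carrier[OF B]])
  finally show "mat_adjoint (A \<otimes>\<^sub>m B) $$ (i * d + k, j * c + l)
    = (mat_adjoint A \<otimes>\<^sub>m mat_adjoint B) $$ (i * d + k, j * c + l)" .
qed (use A B in auto)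

text \<open>Digits may be split off in two stages; this makes the Kronecker product associative with
  literally equal indices.\<close>

lemma div_mod_product:
  fixes x b c :: nat
  assumes "0 < c"
  shows "x div (b * c) = x div c div b" "x mod (b * c) div c = x div c mod b" "x mod (b * c) mod c = x mod c"
  unfolding mult.commute[of b c] using assms by (simp_all add: div_mult2_eq mod_mult2_eq)

lemma tensor_mat_assoc:
  assumes A: "A \<in> carrier_mat a a'" and B: "B \<in> carrier_mat b b'" and C: "C \<in> carrier_mat c c'"
  shows "(A \<otimes>\<^sub>m B) \<otimes>\<^sub>m C = A \<otimes>\<^sub>m (B \<otimes>\<^sub>m C)"
proof (rule eq_matI)
  fix r s assume "r < dim_row (A \<otimes>\<^sub>m (B \<otimes>\<^sub>m C))" "s < dim_col (A \<otimes>\<^sub>m (B \<otimes>\<^sub>m C))"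
  then have rs: "r < a * (b * c)" "s < a' * (b' * c')" using A B C by auto
  then have pos: "0 < c" "0 < b" "0 < c'" "0 < b'" by (auto intro: gr0I)
  have m: "r mod (b * c) < b * c" "s mod (b' * c') < b' * c'" using pos by simp_all
  have d: "r div c < a * b" "s div c' < a' * b'"
    using rs pos by (simp_all add: less_mult_imp_div_less mult.assoc)
  note e1 = div_mod_product[OF pos(1)] and e2 = div_mod_product[OF pos(3)]
  show "((A \<otimes>\<^sub>m B) \<otimes>\<^sub>m C) $$ (r, s) = (A \<otimes>\<^sub>m (B \<otimes>\<^sub>m C)) $$ (r, s)"
    using rs m d
    by (simp add: tensor_mat_index[OF tensor_mat_carrier[OF A B] C] tensor_mat_index[OF A B]
        tensor_mat_index[OF A tensor_mat_carrier[OF B C]] tensor_mat_index[OF B C] mult.assoc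
        e1 e2)
qed (use A B C in auto)

lemma tensor_mat_one: "1\<^sub>m a \<otimes>\<^sub>m 1\<^sub>m b = (1\<^sub>m (a * b) :: complex mat)"
proof (rule mat_eq_product_index[where a = a and b = a and c = b and d = b])
  fix i k j l assume ix: "i < a" "k < b" "j < a" "l < b"
  have "i * b + k = j * b + l \<longleftrightarrow> i = j \<and> k = l"
  proof
    assume eq: "i * b + k = j * b + l"
    then have "(i * b + k) div b = (j * b + l) div b" "(i * b + k) mod b = (j * b + l) mod b" by simp_all
    then show "i = j \<and> k = l" using ix by simp
  qed simp
  then show "(1\<^sub>m a \<otimes>\<^sub>m 1\<^sub>m b) $$ (i * b + k, j * b + l) = (1\<^sub>m (a * b) :: complex mat) $$ (i * b + k, j * b + l)"
    using ix by (simp add: tensor_mat_index'[where a = a and b = a and c = b and d = b] product_index_less)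
qed auto

text \<open>Nested to the right: the head of the list acts on the first factor, the most significant
  digit. With lists, single factors can be replaced, moved and appended.\<close>

fun tprod :: "complex mat list \<Rightarrow> complex mat" where
  "tprod [] = 1\<^sub>m 1"
| "tprod (Y # Ys) = Y \<otimes>\<^sub>m tprod Ys"

lemma tprod_carrier:
  "set Ys \<subseteq> carrier_mat d d \<Longrightarrow> length Ys = n \<Longrightarrow> tprod Ys \<in> carrier_mat (d ^ n) (d ^ n)"
proof (induction Ys arbitrary: n)
  case (Cons Y Ys)
  then show ?case by (cases n) auto
qed auto

lemma tensor_mat_one_left:
  assumes "A \<in> carrier_mat a b" shows "1\<^sub>m 1 \<otimes>\<^sub>m A = A"
  using assms by (intro eq_matI) (auto simp: tensor_mat_def)

lemma tensor_mat_one_right: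
  assumes "A \<in> carrier_mat a b" shows "A \<otimes>\<^sub>m 1\<^sub>m 1 = A"
  using assms by (intro eq_matI) (auto simp: tensor_mat_def)

lemma tprod_append:
  assumes "set Xs \<subseteq> carrier_mat d d" "set Ys \<subseteq> carrier_mat d d"
  shows "tprod (Xs @ Ys) = tprod Xs \<otimes>\<^sub>m tprod Ys"
  using assms(1)
proof (induction Xs)
  case Nil
  show ?case using tensor_mat_one_left[OF tprod_carrier[OF assms(2) refl]] by simp
next
  case (Cons X Xs)
  then show ?case
    using tensor_mat_assoc[OF _ tprod_carrier[OF _ refl] tprod_carrier[OF assms(2) refl], of X d d Xs d]
    by simp
qed

lemma tprod_one: "tprod (replicate n (1\<^sub>m d)) = 1\<^sub>m (d ^ n)"
  by (induction n) (auto simp: tensor_mat_one)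

text \<open>Keeps products of measurement operators in the form of an adjoint times an operator,
  through which positivity is used.\<close>

lemma tprod_square:
  assumes "set Cs \<subseteq> carrier_mat d d"
  shows "tprod (map (\<lambda>C. mat_adjoint C * C) Cs) = mat_adjoint (tprod Cs) * tprod Cs"
  using assms
proof (induction Cs)
  case Nil
  show ?case by simp
next
  case (Cons C Cs)
  have C: "C \<in> carrier_mat d d" using Cons.prems by simp
  have T: "tprod Cs \<in> carrier_mat (d ^ length Cs) (d ^ length Cs)"
    using Cons.prems by (intro tprod_carrier) auto
  show ?case using Cons
      by (simp add: mat_adjoint_tensor[OF C T]
        tensor_mat_mult[OF mat_adjoint_carrier[OF C] mat_adjoint_carrier[OF T] C T])
qed

lemma tensor_digit_less: "0 < d \<Longrightarrow> tensor_digit d n r t < d"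
  by (simp add: tensor_digit_def)

lemma tensor_digit_Suc_0:
  assumes "r < d ^ Suc n" shows "tensor_digit d (Suc n) r 0 = r div d ^ n"
proof -
  have "r div d ^ n < d" using assms by (intro less_mult_imp_div_less) simp
  then show ?thesis by (simp add: tensor_digit_def)
qed

lemma tensor_digit_Suc_Suc:
  assumes "t < n"
  shows "tensor_digit d (Suc n) r (Suc t) = tensor_digit d n (r mod d ^ n) t"
proof -
  define k where "k = n - 1 - t"
  have n: "n = Suc k + t" using assms by (simp add: k_def)
  have "r mod d ^ n div d ^ k mod d = r div d ^ k mod d"
  proof -
    have eq: "d ^ n = d ^ (n - k) * d ^ k" using n by (simp add: power_add[symmetric] add.commute)
    have "r mod d ^ n div d ^ k = r div d ^ k mod d ^ (n - k)"
      unfolding eq by (cases "0 < d ^ k") (simp_all only: div_mod_product, auto simp: zero_power)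
    moreover have "d dvd d ^ (n - k)" using n by (intro dvd_power) auto
    ultimately show ?thesis by (simp add: mod_mod_cancel)
  qed
  then show ?thesis by (simp add: tensor_digit_def k_def)
qed

lemma tensor_digit_inject:
  assumes "r < d ^ n" "s < d ^ n" "\<And>t. t < n \<Longrightarrow> tensor_digit d n r t = tensor_digit d n s t"
  shows "r = s"
  using assms
proof (induction n arbitrary: r s)
  case (Suc n)
  have "d > 0" using Suc.prems(1) by (auto intro: gr0I)
  then have "r mod d ^ n < d ^ n" "s mod d ^ n < d ^ n" by simp_all
  moreover have "tensor_digit d n (r mod d ^ n) t = tensor_digit d n (s mod d ^ n) t" if "t < n" for t
    using Suc.prems(3)[of "Suc t"] that by (simp add: tensor_digit_Suc_Suc)
  ultimately have "r mod d ^ n = s mod d ^ n" by (rule Suc.IH)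
  moreover have "r div d ^ n = s div d ^ n"
    using Suc.prems(3)[of 0] by (simp add: tensor_digit_Suc_0[OF Suc.prems(1)] tensor_digit_Suc_0[OF Suc.prems(2)])
  ultimately show ?case by (metis div_mult_mod_eq)
qed simp

text \<open>By counting: the digit map is injective between two sets of \<open>d ^ n\<close>
  elements.\<close>

lemma tensor_digit_surj:
  assumes "\<And>t. t < n \<Longrightarrow> f t < d"
  shows "\<exists>r<d ^ n. \<forall>t<n. tensor_digit d n r t = f t"
proof -
  have "inj_on (\<lambda>r. restrict (tensor_digit d n r) {..<n}) {..<d ^ n}"
  proof (rule inj_onI)
    fix r s assume rs: "r \<in> {..<d ^ n}" "s \<in> {..<d ^ n}"
      and eq: "restrict (tensor_digit d n r) {..<n} = restrict (tensor_digit d n s) {..<n}"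
    have "tensor_digit d n r t = tensor_digit d n s t" if "t < n" for t
      using fun_cong[OF eq, of t] that by simp
    then show "r = s" using tensor_digit_inject[of r d n s] rs by simp
  qed
  moreover have "(\<lambda>r. restrict (tensor_digit d n r) {..<n}) ` {..<d ^ n} \<subseteq> {..<n} \<rightarrow>\<^sub>E {..<d}"
  proof (intro image_subsetI)
    fix r assume "r \<in> {..<d ^ n}"
    show "restrict (tensor_digit d n r) {..<n} \<in> {..<n} \<rightarrow>\<^sub>E {..<d}"
    proof (cases "n = 0")
      case False
      then have "0 < d" using assms[of 0] by simp
      then show ?thesis by (auto intro: tensor_digit_less)
    qed (simp add: restrict_def)
  qed
  moreover have "card ({..<n} \<rightarrow>\<^sub>E {..<d}) = card {..<d ^ n}" by (simp add: card_PiE)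
  moreover have "finite ({..<n} \<rightarrow>\<^sub>E {..<d})" by (intro finite_PiE) auto
  ultimately have "(\<lambda>r. restrict (tensor_digit d n r) {..<n}) ` {..<d ^ n} = {..<n} \<rightarrow>\<^sub>E {..<d}"
    by (intro card_subset_eq) (simp_all add: card_image)
  moreover have "restrict f {..<n} \<in> {..<n} \<rightarrow>\<^sub>E {..<d}" using assms by auto
  ultimately obtain r where r: "r < d ^ n" "restrict f {..<n} = restrict (tensor_digit d n r) {..<n}" by blast
  then have "\<forall>t<n. tensor_digit d n r t = f t" by (metis lessThan_iff restrict_apply')
  with r show ?thesis by blast
qed

text \<open>The leading factor is indexed by the leading digit. In this form, permuting tensor
  factors means reindexing a product of numbers.\<close>

lemma tprod_index:
  assumes "set Ys \<subseteq> carrier_mat d d" "length Ys = n" "r < d ^ n" "c < d ^ n"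
  shows "tprod Ys $$ (r, c) = (\<Prod>t<n. (Ys ! t) $$ (tensor_digit d n r t, tensor_digit d n c t))"
  using assms
proof (induction Ys arbitrary: n r c)
  case (Cons Y Ys)
  then obtain m where n: "n = Suc m" "length Ys = m" by auto
  have "0 < d" using Cons.prems(3) n by (auto intro: gr0I)
  then have mods: "r mod d ^ m < d ^ m" "c mod d ^ m < d ^ m" by simp_all
  have "tprod (Y # Ys) $$ (r, c) = Y $$ (r div d ^ m, c div d ^ m) * tprod Ys $$ (r mod d ^ m, c mod d ^ m)"
    using Cons.prems n by (simp add: tensor_mat_index[OF _ tprod_carrier, of Y d d Ys d m])
  also have "\<dots> = Y $$ (r div d ^ m, c div d ^ m) *
      (\<Prod>t<m. (Ys ! t) $$ (tensor_digit d m (r mod d ^ m) t, tensor_digit d m (c mod d ^ m) t))"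
    using Cons.IH[OF _ n(2) mods] Cons.prems by simp
  finally show ?case
    using Cons.prems n by (simp add: prod.lessThan_Suc_shift tensor_digit_Suc_0 tensor_digit_Suc_Suc del: prod.lessThan_Suc)
qed simp

section \<open>Permutation symmetry\<close>

lemma perm_op_carrier [simp]: "perm_op d n \<sigma> \<in> carrier_mat (d ^ n) (d ^ n)"
  by (simp add: perm_op_def)

lemma sum_mult_indicator:
  fixes f :: "nat \<Rightarrow> complex"
  assumes "s0 < m" "\<And>s. s < m \<Longrightarrow> P s \<longleftrightarrow> s = s0"
  shows "(\<Sum>s<m. f s * (if P s then 1 else 0)) = f s0"
proof -
  have "(\<Sum>s<m. f s * (if P s then 1 else 0)) = (\<Sum>s<m. f s * (if s = s0 then 1 else 0))"
    using assms by (intro sum.cong refl) auto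
  then show ?thesis using assms(1) by (simp add: sum_mult_delta)
qed

text \<open>Row r of a permutation operator has its single 1 in the column r' whose digits are those
  of r rearranged by \<sigma>; the product therefore selects row r' of M.\<close>

lemma perm_op_mult_left:
  assumes M: "M \<in> carrier_mat (d ^ n) (d ^ n)" and rc: "r < d ^ n" "c < d ^ n" "r' < d ^ n"
    and dig: "\<And>t. t < n \<Longrightarrow> tensor_digit d n r' t = tensor_digit d n r (\<sigma> t)"
  shows "(perm_op d n \<sigma> * M) $$ (r, c) = M $$ (r', c)"
proof -
  have "(\<forall>t<n. tensor_digit d n r (\<sigma> t) = tensor_digit d n s t) \<longleftrightarrow> s = r'" if "s < d ^ n" for s
    using tensor_digit_inject[OF that rc(3)] dig by auto
  then have "(\<Sum>s<d ^ n. M $$ (s, c) * (if \<forall>t<n. tensor_digit d n r (\<sigma> t) = tensor_digit d n s t then 1 else 0))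
      = M $$ (r', c)"
    by (rule sum_mult_indicator[OF rc(3)])
  then show ?thesis
    unfolding mult_mat_index[OF perm_op_carrier M rc(1,2)]
    using rc by (simp add: perm_op_def mult.commute)
qed

lemma perm_op_mult_right:
  assumes M: "M \<in> carrier_mat (d ^ n) (d ^ n)" and rc: "r < d ^ n" "c < d ^ n" "c' < d ^ n"
    and \<sigma>: "\<sigma> permutes {..<n}"
    and dig: "\<And>t. t < n \<Longrightarrow> tensor_digit d n c' (\<sigma> t) = tensor_digit d n c t"
  shows "(M * perm_op d n \<sigma>) $$ (r, c) = M $$ (r, c')"
proof -
  have "(\<forall>t<n. tensor_digit d n s (\<sigma> t) = tensor_digit d n c t) \<longleftrightarrow> s = c'" if s: "s < d ^ n" for s
  proof
    assume eq: "\<forall>t<n. tensor_digit d n s (\<sigma> t) = tensor_digit d n c t"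
    show "s = c'"
    proof (rule tensor_digit_inject[OF s rc(3)])
      fix t assume "t < n"
      then obtain t' where "t' < n" "t = \<sigma> t'"
        using permutes_image[OF \<sigma>] by (metis image_iff lessThan_iff)
      then show "tensor_digit d n s t = tensor_digit d n c' t" using eq dig by simp
    qed
  qed (use dig in auto)
  then have "(\<Sum>s<d ^ n. M $$ (r, s) * (if \<forall>t<n. tensor_digit d n s (\<sigma> t) = tensor_digit d n c t then 1 else 0))
      = M $$ (r, c')"
    by (rule sum_mult_indicator[OF rc(3)])
  then show ?thesis
    unfolding mult_mat_index[OF M perm_op_carrier rc(1,2)] using rc by (simp add: perm_op_def)
qed

lemma perm_op_index_left:
  assumes "r < d ^ n" "\<sigma> permutes {..<n}"
  obtains r' where "r' < d ^ n" "\<And>t. t < n \<Longrightarrow> tensor_digit d n r' t = tensor_digit d n r (\<sigma> t)"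
proof -
  have "tensor_digit d n r (\<sigma> t) < d" if "t < n" for t
  proof -
    have "0 < d" using assms(1) that by (auto intro: gr0I simp: zero_power)
    then show ?thesis by (rule tensor_digit_less)
  qed
  from tensor_digit_surj[of n "\<lambda>t. tensor_digit d n r (\<sigma> t)", OF this] show ?thesis using that by blast
qed

lemma perm_op_index_right:
  assumes "c < d ^ n" "\<sigma> permutes {..<n}"
  obtains c' where "c' < d ^ n" "\<And>t. t < n \<Longrightarrow> tensor_digit d n c' (\<sigma> t) = tensor_digit d n c t"
proof -
  obtain c' where c': "c' < d ^ n" "\<And>t. t < n \<Longrightarrow> tensor_digit d n c' t = tensor_digit d n c (inv_into UNIV \<sigma> t)"
    using perm_op_index_left[OF assms(1) permutes_inv[OF assms(2)]] by blast
  have "tensor_digit d n c' (\<sigma> t) = tensor_digit d n c t" if "t < n" for t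
  proof -
    have "\<sigma> t < n" using permutes_in_image[OF assms(2), of t] that by simp
    then show ?thesis using c'(2) permutes_inverses[OF assms(2)] by simp
  qed
  with c'(1) show ?thesis using that by blast
qed

text \<open>Both entries are products over the factors, and reindexing one by \<sigma> gives the
  other. The relation \<open>Zs ! \<sigma> t = Ys ! t\<close> reflects that \<open>perm_op\<close>
  moves the content of factor t to factor \<sigma> t.\<close>

lemma tprod_perm_op:
  assumes Ys: "set Ys \<subseteq> carrier_mat d d" "length Ys = n" and Zs: "set Zs \<subseteq> carrier_mat d d" "length Zs = n"
    and \<sigma>: "\<sigma> permutes {..<n}" and eq: "\<And>t. t < n \<Longrightarrow> Zs ! \<sigma> t = Ys ! t"
  shows "tprod Zs * perm_op d n \<sigma> = perm_op d n \<sigma> * tprod Ys"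
proof (rule eq_matI)
  note cY = tprod_carrier[OF Ys] and cZ = tprod_carrier[OF Zs]
  fix r c assume "r < dim_row (perm_op d n \<sigma> * tprod Ys)" "c < dim_col (perm_op d n \<sigma> * tprod Ys)"
  then have rc: "r < d ^ n" "c < d ^ n" using cY by (auto simp: perm_op_def)
  obtain r' where r': "r' < d ^ n" "\<And>t. t < n \<Longrightarrow> tensor_digit d n r' t = tensor_digit d n r (\<sigma> t)"
    using perm_op_index_left[OF rc(1) \<sigma>] by blast
  obtain c' where c': "c' < d ^ n" "\<And>t. t < n \<Longrightarrow> tensor_digit d n c' (\<sigma> t) = tensor_digit d n c t"
    using perm_op_index_right[OF rc(2) \<sigma>] by blast
  have "(tprod Zs * perm_op d n \<sigma>) $$ (r, c) = tprod Zs $$ (r, c')"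
    by (rule perm_op_mult_right[OF cZ rc c'(1) \<sigma> c'(2)])
  also have "\<dots> = (\<Prod>t<n. (Zs ! t) $$ (tensor_digit d n r t, tensor_digit d n c' t))"
    by (rule tprod_index[OF Zs rc(1) c'(1)])
  also have "\<dots> = (\<Prod>t<n. (Zs ! \<sigma> t) $$ (tensor_digit d n r (\<sigma> t), tensor_digit d n c' (\<sigma> t)))"
    using prod.permute[OF \<sigma>, of "\<lambda>t. (Zs ! t) $$ (tensor_digit d n r t, tensor_digit d n c' t)"]
    by (simp add: comp_def)
  also have "\<dots> = (\<Prod>t<n. (Ys ! t) $$ (tensor_digit d n r' t, tensor_digit d n c t))"
    using eq r'(2) c'(2) by (intro prod.cong refl) simp
  also have "\<dots> = tprod Ys $$ (r', c)" by (rule tprod_index[OF Ys r'(1) rc(2), symmetric])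
  also have "\<dots> = (perm_op d n \<sigma> * tprod Ys) $$ (r, c)"
    by (rule perm_op_mult_left[OF cY rc r', symmetric])
  finally show "(tprod Zs * perm_op d n \<sigma>) $$ (r, c) = (perm_op d n \<sigma> * tprod Ys) $$ (r, c)" .
qed (use tprod_carrier[OF Ys] tprod_carrier[OF Zs] in \<open>auto simp: perm_op_def\<close>)

lemma perm_op_inverse:
  assumes \<sigma>: "\<sigma> permutes {..<n}"
  shows "perm_op d n \<sigma> * perm_op d n (inv_into UNIV \<sigma>) = 1\<^sub>m (d ^ n)"
proof (rule eq_matI)
  fix r c assume "r < dim_row (1\<^sub>m (d ^ n) :: complex mat)" "c < dim_col (1\<^sub>m (d ^ n) :: complex mat)"
  then have rc: "r < d ^ n" "c < d ^ n" by auto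
  obtain r' where r': "r' < d ^ n" "\<And>t. t < n \<Longrightarrow> tensor_digit d n r' t = tensor_digit d n r (\<sigma> t)"
    using perm_op_index_left[OF rc(1) \<sigma>] by blast
  have "tensor_digit d n r' (inv_into UNIV \<sigma> t) = tensor_digit d n r t" if "t < n" for t
  proof -
    have "inv_into UNIV \<sigma> t < n" using permutes_in_image[OF permutes_inv[OF \<sigma>], of t] that by simp
    then show ?thesis using r'(2) permutes_inverses[OF \<sigma>] by simp
  qed
  then have "(\<forall>t<n. tensor_digit d n r' (inv_into UNIV \<sigma> t) = tensor_digit d n c t) \<longleftrightarrow> r = c"
    using tensor_digit_inject[OF rc] by auto
  moreover have "(perm_op d n \<sigma> * perm_op d n (inv_into UNIV \<sigma>)) $$ (r, c) = perm_op d n (inv_into UNIV \<sigma>) $$ (r', c)"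
    by (rule perm_op_mult_left[OF perm_op_carrier rc r'])
  ultimately show "(perm_op d n \<sigma> * perm_op d n (inv_into UNIV \<sigma>)) $$ (r, c) = (1\<^sub>m (d ^ n) :: complex mat) $$ (r, c)"
    using rc r'(1) by (simp add: perm_op_def)
qed (auto simp: perm_op_def)

section \<open>Expectations of product operators in a symmetric state\<close>

definition tfun :: "complex mat \<Rightarrow> complex mat \<Rightarrow> complex mat list \<Rightarrow> complex" where
  "tfun \<rho> X Ys = tr (\<rho> * (X \<otimes>\<^sub>m tprod Ys))"

text \<open>The form in which the symmetry of \<rho> is used: operators on the B-factors may be
  listed in any order. Conjugation by a permutation operator rearranges them, and it cancels under
  the trace because \<rho> commutes with it.\<close>

lemma tfun_mset_cong:
  assumes \<rho>: "\<rho> \<in> carrier_mat (dA * d ^ n) (dA * d ^ n)" and X: "X \<in> carrier_mat dA dA"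
    and comm: "\<And>\<sigma>. \<sigma> permutes {..<n} \<Longrightarrow>
      \<rho> * (1\<^sub>m dA \<otimes>\<^sub>m perm_op d n \<sigma>) = (1\<^sub>m dA \<otimes>\<^sub>m perm_op d n \<sigma>) * \<rho>"
    and Ys: "set Ys \<subseteq> carrier_mat d d" "length Ys = n" and eq: "mset Ys = mset Zs"
  shows "tfun \<rho> X Ys = tfun \<rho> X Zs"
proof -
  have Zs: "set Zs \<subseteq> carrier_mat d d" "length Zs = n"
    using Ys eq by (metis set_mset_mset, metis size_mset)
  obtain \<sigma> where "\<sigma> permutes {..<length Zs}" "permute_list \<sigma> Zs = Ys"
    using mset_eq_permutation[OF eq] by blast
  then have \<sigma>: "\<sigma> permutes {..<n}" and nth: "\<And>t. t < n \<Longrightarrow> Zs ! \<sigma> t = Ys ! t"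
    using Zs by (auto simp: permute_list_nth)
  define P where "P = 1\<^sub>m dA \<otimes>\<^sub>m perm_op d n \<sigma>"
  define Q where "Q = 1\<^sub>m dA \<otimes>\<^sub>m perm_op d n (inv_into UNIV \<sigma>)"
  define y where "y = X \<otimes>\<^sub>m tprod Ys"
  define z where "z = X \<otimes>\<^sub>m tprod Zs"
  let ?D = "dA * d ^ n"
  note cY = tprod_carrier[OF Ys] and cZ = tprod_carrier[OF Zs]
  have P: "P \<in> carrier_mat ?D ?D" and Q: "Q \<in> carrier_mat ?D ?D"
    and y: "y \<in> carrier_mat ?D ?D" and z: "z \<in> carrier_mat ?D ?D"
    using cY cZ X by (simp_all add: P_def Q_def y_def z_def)
  have one: "1\<^sub>m dA \<in> carrier_mat dA dA" for dA by simp
  have PQ: "P * Q = 1\<^sub>m ?D"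
    unfolding P_def Q_def tensor_mat_mult[OF one perm_op_carrier one perm_op_carrier] perm_op_inverse[OF \<sigma>]
    by (simp add: tensor_mat_one)
  then have QP: "Q * P = 1\<^sub>m ?D" by (rule mat_mult_left_right_inverse[OF P Q])
  have zP: "z * P = P * y"
    unfolding P_def y_def z_def tensor_mat_mult[OF X cZ one perm_op_carrier]
      tensor_mat_mult[OF one perm_op_carrier X cY]
    using tprod_perm_op[OF Ys Zs \<sigma> nth] X by simp
  \<comment> \<open>Shows that \<open>z\<close> is P y Q; then P passes \<rho>, goes around the
    trace and meets its inverse Q.\<close>
  have "z = z * (P * Q)" unfolding PQ using z by simp
  also have "\<dots> = (z * P) * Q" by (rule assoc_mult_mat[OF z P Q, symmetric])
  also have "\<dots> = P * (y * Q)" unfolding zP by (rule assoc_mult_mat[OF P y Q])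
  finally have "tr (\<rho> * z) = tr (\<rho> * (P * (y * Q)))" by simp
  also have "\<rho> * (P * (y * Q)) = (\<rho> * P) * (y * Q)"
    by (rule assoc_mult_mat[OF \<rho> P mult_carrier_mat[OF y Q], symmetric])
  also have "\<dots> = (P * \<rho>) * (y * Q)" using comm[OF \<sigma>] by (simp add: P_def)
  also have "\<dots> = P * (\<rho> * (y * Q))" by (rule assoc_mult_mat[OF P \<rho> mult_carrier_mat[OF y Q]])
  also have "tr \<dots> = tr ((\<rho> * (y * Q)) * P)"
    by (rule tr_mult_commute[OF P mult_carrier_mat[OF \<rho> mult_carrier_mat[OF y Q]]])
  also have "(\<rho> * (y * Q)) * P = \<rho> * (y * (Q * P))"
    unfolding assoc_mult_mat[OF \<rho> mult_carrier_mat[OF y Q] P] assoc_mult_mat[OF y Q P] ..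
  also have "\<dots> = \<rho> * y" unfolding QP using y by simp
  finally show ?thesis by (simp add: tfun_def y_def z_def)
qed

text \<open>Linear combinations are stated entry by entry, here and below, so that only numbers are
  summed over an index set.\<close>

lemma tr_mult_linear:
  assumes \<rho>: "\<rho> \<in> carrier_mat n n" and M: "M \<in> carrier_mat n n"
    and K: "\<And>s. s \<in> S \<Longrightarrow> K s \<in> carrier_mat n n"
    and eq: "\<And>i j. i < n \<Longrightarrow> j < n \<Longrightarrow> M $$ (i, j) = (\<Sum>s\<in>S. c s * K s $$ (i, j))"
  shows "tr (\<rho> * M) = (\<Sum>s\<in>S. c s * tr (\<rho> * K s))"
proof -
  have "tr (\<rho> * M) = (\<Sum>i<n. \<Sum>j<n. \<Sum>s\<in>S. c s * (\<rho> $$ (i, j) * K s $$ (j, i)))"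
    using eq by (simp add: tr_mult[OF \<rho> M] sum_distrib_left mult_ac)
  also have "\<dots> = (\<Sum>s\<in>S. \<Sum>i<n. \<Sum>j<n. c s * (\<rho> $$ (i, j) * K s $$ (j, i)))" by (rule sum_rotate3)
  also have "\<dots> = (\<Sum>s\<in>S. c s * tr (\<rho> * K s))"
    using K by (intro sum.cong refl) (simp add: tr_mult[OF \<rho>] sum_distrib_left)
  finally show ?thesis .
qed

lemma tensor_mat_linear_left:
  assumes "X \<in> carrier_mat a a" "Z \<in> carrier_mat b b" "\<And>s. s \<in> S \<Longrightarrow> K s \<in> carrier_mat a a"
    and eq: "\<And>i j. i < a \<Longrightarrow> j < a \<Longrightarrow> X $$ (i, j) = (\<Sum>s\<in>S. c s * K s $$ (i, j))"
    and rc: "r < a * b" "q < a * b"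
  shows "(X \<otimes>\<^sub>m Z) $$ (r, q) = (\<Sum>s\<in>S. c s * (K s \<otimes>\<^sub>m Z) $$ (r, q))"
proof -
  have "r div b < a" "q div b < a" using rc by (simp_all add: less_mult_imp_div_less)
  then show ?thesis
    using assms by (simp add: tensor_mat_index[where a = a and b = a and c = b and d = b] sum_distrib_right mult.assoc)
qed

lemma tensor_mat_linear_right:
  assumes "X \<in> carrier_mat a a" "Z \<in> carrier_mat b b" "\<And>s. s \<in> S \<Longrightarrow> K s \<in> carrier_mat b b"
    and eq: "\<And>i j. i < b \<Longrightarrow> j < b \<Longrightarrow> Z $$ (i, j) = (\<Sum>s\<in>S. c s * K s $$ (i, j))"
    and rc: "r < a * b" "q < a * b"
  shows "(X \<otimes>\<^sub>m Z) $$ (r, q) = (\<Sum>s\<in>S. c s * (X \<otimes>\<^sub>m K s) $$ (r, q))"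
proof -
  have "0 < b" using rc by (auto intro: gr0I)
  then have "r mod b < b" "q mod b < b" by simp_all
  then show ?thesis
    using assms by (simp add: tensor_mat_index[where a = a and b = a and c = b and d = b] sum_distrib_left mult_ac)
qed

lemma tprod_linear:
  assumes "set As \<subseteq> carrier_mat d d" "set Bs \<subseteq> carrier_mat d d" "Y \<in> carrier_mat d d"
    and K: "\<And>s. s \<in> S \<Longrightarrow> K s \<in> carrier_mat d d"
    and eq: "\<And>i j. i < d \<Longrightarrow> j < d \<Longrightarrow> Y $$ (i, j) = (\<Sum>s\<in>S. c s * K s $$ (i, j))"
    and "length As + 1 + length Bs = n" "r < d ^ n" "q < d ^ n"
  shows "tprod (As @ Y # Bs) $$ (r, q) = (\<Sum>s\<in>S. c s * tprod (As @ K s # Bs) $$ (r, q))"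
  using assms(1,6-)
proof (induction As arbitrary: n r q)
  case Nil
  have "tprod Bs \<in> carrier_mat (d ^ length Bs) (d ^ length Bs)" using assms by (intro tprod_carrier) auto
  from tensor_mat_linear_left[OF assms(3) this K eq, of r q] show ?case using Nil by auto
next
  case (Cons A As)
  then obtain m where n: "n = Suc m" "length As + 1 + length Bs = m" by (cases n) auto
  have c: "A \<in> carrier_mat d d" "tprod (As @ Y # Bs) \<in> carrier_mat (d ^ m) (d ^ m)"
    "\<And>s. s \<in> S \<Longrightarrow> tprod (As @ K s # Bs) \<in> carrier_mat (d ^ m) (d ^ m)"
    using Cons.prems assms n by (auto intro!: tprod_carrier)
  have "(A \<otimes>\<^sub>m tprod (As @ Y # Bs)) $$ (r, q) = (\<Sum>s\<in>S. c s * (A \<otimes>\<^sub>m tprod (As @ K s # Bs)) $$ (r, q))"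
    by (rule tensor_mat_linear_right[OF c(1-3)])
      (use Cons n in auto)
  then show ?case by simp
qed

lemma tfun_linear_left:
  assumes \<rho>: "\<rho> \<in> carrier_mat (dA * d ^ n) (dA * d ^ n)" and X: "X \<in> carrier_mat dA dA"
    and Ys: "set Ys \<subseteq> carrier_mat d d" "length Ys = n"
    and K: "\<And>s. s \<in> S \<Longrightarrow> K s \<in> carrier_mat dA dA"
    and eq: "\<And>i j. i < dA \<Longrightarrow> j < dA \<Longrightarrow> X $$ (i, j) = (\<Sum>s\<in>S. c s * K s $$ (i, j))"
  shows "tfun \<rho> X Ys = (\<Sum>s\<in>S. c s * tfun \<rho> (K s) Ys)"
  unfolding tfun_def
  by (rule tr_mult_linear[OF \<rho>])
    (use X K tprod_carrier[OF Ys] tensor_mat_linear_left[OF X tprod_carrier[OF Ys] K eq] in auto)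

lemma tfun_linear_right:
  assumes \<rho>: "\<rho> \<in> carrier_mat (dA * d ^ n) (dA * d ^ n)" and X: "X \<in> carrier_mat dA dA"
    and AB: "set As \<subseteq> carrier_mat d d" "set Bs \<subseteq> carrier_mat d d" "length As + 1 + length Bs = n"
    and Y: "Y \<in> carrier_mat d d"
    and K: "\<And>s. s \<in> S \<Longrightarrow> K s \<in> carrier_mat d d"
    and eq: "\<And>i j. i < d \<Longrightarrow> j < d \<Longrightarrow> Y $$ (i, j) = (\<Sum>s\<in>S. c s * K s $$ (i, j))"
  shows "tfun \<rho> X (As @ Y # Bs) = (\<Sum>s\<in>S. c s * tfun \<rho> X (As @ K s # Bs))"
proof -
  have cY: "tprod (As @ Y # Bs) \<in> carrier_mat (d ^ n) (d ^ n)"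
    using AB Y by (intro tprod_carrier) auto
  have cK: "tprod (As @ K s # Bs) \<in> carrier_mat (d ^ n) (d ^ n)" if "s \<in> S" for s
    using AB K[OF that] by (intro tprod_carrier) auto
  show ?thesis
    unfolding tfun_def
    by (rule tr_mult_linear[OF \<rho>])
      (use X cY cK tensor_mat_linear_right[OF X cY cK tprod_linear[OF AB(1,2) Y K eq AB(3)]] in auto)
qed

section \<open>Conditional states and linear constraints\<close>

text \<open>The trace is the sum of the values of the quadratic form of \<rho> at the conjugated
  rows of C.\<close>

lemma positive_mat_square:
  assumes \<rho>: "positive_mat n \<rho>" and C: "C \<in> carrier_mat m n"
  shows "0 \<le> tr (\<rho> * (mat_adjoint C * C))"
proof -
  have \<rho>c: "\<rho> \<in> carrier_mat n n" using \<rho> by (simp add: positive_mat_def hermitian_mat_def)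
  have CC: "mat_adjoint C * C \<in> carrier_mat n n" by (rule mult_carrier_mat[OF mat_adjoint_carrier[OF C] C])
  have "tr (\<rho> * (mat_adjoint C * C)) = (\<Sum>i<n. \<Sum>j<n. \<Sum>t<m. \<rho> $$ (i, j) * (cnj (C $$ (t, j)) * C $$ (t, i)))"
    using C by (simp add: tr_mult[OF \<rho>c CC] mult_mat_index[OF mat_adjoint_carrier[OF C] C] sum_distrib_left
        del: index_mult_mat(1))
  also have "\<dots> = (\<Sum>t<m. \<Sum>i<n. \<Sum>j<n. \<rho> $$ (i, j) * (cnj (C $$ (t, j)) * C $$ (t, i)))"
    by (rule sum_rotate3)
  also have "\<dots> = (\<Sum>t<m. (\<rho> *\<^sub>v vec n (\<lambda>i. cnj (C $$ (t, i)))) \<bullet>c vec n (\<lambda>i. cnj (C $$ (t, i))))"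
    using \<rho>c by (intro sum.cong refl)
      (simp add: scalar_prod_def lessThan_atLeast0 sum_distrib_right sum_distrib_left mult_ac)
  also have "0 \<le> \<dots>" using \<rho> by (intro sum_nonneg) (simp add: positive_mat_def)
  finally show ?thesis .
qed

text \<open>Matrices C with a single row yield every rank-one square, hence the whole quadratic
  form; that M is Hermitian follows from this form being real.\<close>

lemma positive_matI:
  assumes M: "M \<in> carrier_mat d d"
    and pos: "\<And>C. C \<in> carrier_mat 1 d \<Longrightarrow> 0 \<le> tr (M * (mat_adjoint C * C))"
  shows "positive_mat d M"
proof -
  have form: "0 \<le> sesq d (\<lambda>i j. M $$ (i, j)) x x" for x
  proof -
    define C where "C = mat 1 d (\<lambda>(_, i). cnj (x i))"
    have C: "C \<in> carrier_mat 1 d" by (simp add: C_def)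
    have CC: "mat_adjoint C * C \<in> carrier_mat d d" by (rule mult_carrier_mat[OF mat_adjoint_carrier[OF C] C])
    have "tr (M * (mat_adjoint C * C)) = sesq d (\<lambda>i j. M $$ (i, j)) x x"
    proof -
      have "(mat_adjoint C * C) $$ (j, i) = x j * cnj (x i)" if "i < d" "j < d" for i j
        unfolding mult_mat_index[OF mat_adjoint_carrier[OF C] C that(2,1)] using that by (simp add: C_def)
      then show ?thesis by (simp add: tr_mult[OF M CC] sesq_def mult_ac del: index_mult_mat(1))
    qed
    then show ?thesis using pos[OF C] by simp
  qed
  have herm: "cnj (M $$ (r, s)) = M $$ (s, r)" if "r < d" "s < d" for r s
    by (rule psd_fun_hermitian[of d "\<lambda>i j. M $$ (i, j)", symmetric, OF _ that])
      (simp add: psd_fun_def form)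
  have "mat_adjoint M = M"
    using carrier_matD[OF M] by (intro eq_matI) (simp_all add: herm)
  moreover have "0 \<le> (M *\<^sub>v v) \<bullet>c v" if "v \<in> carrier_vec d" for v
  proof -
    have "(M *\<^sub>v v) \<bullet>c v = sesq d (\<lambda>i j. M $$ (i, j)) (\<lambda>i. v $ i) (\<lambda>i. v $ i)"
      using M that by (simp add: sesq_def scalar_prod_def lessThan_atLeast0 sum_distrib_left sum_distrib_right mult_ac)
    then show ?thesis using form by simp
  qed
  ultimately show ?thesis using M by (simp add: positive_mat_def hermitian_mat_def)
qed

text \<open>The partial trace over the second factor of \<rho> times 1 \<otimes> Z. For a
  measurement operator Z it is the unnormalised state of the first factor after that outcome on the
  second.\<close>

definition reduce_fst :: "nat \<Rightarrow> nat \<Rightarrow> complex mat \<Rightarrow> complex mat \<Rightarrow> complex mat" where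
  "reduce_fst d1 d2 \<rho> Z = mat d1 d1 (\<lambda>(i, j). \<Sum>k<d2. \<Sum>l<d2. \<rho> $$ (i * d2 + k, j * d2 + l) * Z $$ (l, k))"

definition reduce_snd :: "nat \<Rightarrow> nat \<Rightarrow> complex mat \<Rightarrow> complex mat \<Rightarrow> complex mat" where
  "reduce_snd d1 d2 \<rho> W = mat d2 d2 (\<lambda>(k, l). \<Sum>i<d1. \<Sum>j<d1. \<rho> $$ (i * d2 + k, j * d2 + l) * W $$ (j, i))"

lemma reduce_carrier [simp]:
  "reduce_fst d1 d2 \<rho> Z \<in> carrier_mat d1 d1" "reduce_snd d1 d2 \<rho> W \<in> carrier_mat d2 d2"
  by (simp_all add: reduce_fst_def reduce_snd_def)

lemma tr_mult_tensor:
  assumes \<rho>: "\<rho> \<in> carrier_mat (d1 * d2) (d1 * d2)" and X: "X \<in> carrier_mat d1 d1" and Z: "Z \<in> carrier_mat d2 d2"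
  shows "tr (\<rho> * (X \<otimes>\<^sub>m Z)) = (\<Sum>i<d1. \<Sum>k<d2. \<Sum>j<d1. \<Sum>l<d2.
      \<rho> $$ (i * d2 + k, j * d2 + l) * (X $$ (j, i) * Z $$ (l, k)))"
  unfolding tr_mult[OF \<rho> tensor_mat_carrier[OF X Z]] sum_product_index
  by (intro sum.cong refl) (simp add: tensor_mat_index'[OF X Z])

lemma tr_reduce_fst:
  assumes \<rho>: "\<rho> \<in> carrier_mat (d1 * d2) (d1 * d2)" and X: "X \<in> carrier_mat d1 d1" and Z: "Z \<in> carrier_mat d2 d2"
  shows "tr (reduce_fst d1 d2 \<rho> Z * X) = tr (\<rho> * (X \<otimes>\<^sub>m Z))"
proof -
  have "tr (reduce_fst d1 d2 \<rho> Z * X) = (\<Sum>i<d1. \<Sum>j<d1. \<Sum>k<d2. \<Sum>l<d2.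
      \<rho> $$ (i * d2 + k, j * d2 + l) * (X $$ (j, i) * Z $$ (l, k)))"
    unfolding tr_mult[OF reduce_carrier(1) X]
    by (intro sum.cong refl) (simp add: reduce_fst_def sum_distrib_left sum_distrib_right mult_ac)
  also have "\<dots> = (\<Sum>i<d1. \<Sum>k<d2. \<Sum>j<d1. \<Sum>l<d2.
      \<rho> $$ (i * d2 + k, j * d2 + l) * (X $$ (j, i) * Z $$ (l, k)))"
    by (intro sum.cong refl sum.swap)
  finally show ?thesis unfolding tr_mult_tensor[OF assms] .
qed

lemma tr_reduce_snd:
  assumes \<rho>: "\<rho> \<in> carrier_mat (d1 * d2) (d1 * d2)" and W: "W \<in> carrier_mat d1 d1" and Y: "Y \<in> carrier_mat d2 d2"
  shows "tr (reduce_snd d1 d2 \<rho> W * Y) = tr (\<rho> * (W \<otimes>\<^sub>m Y))"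
proof -
  have "tr (reduce_snd d1 d2 \<rho> W * Y) = (\<Sum>k<d2. \<Sum>l<d2. \<Sum>i<d1. \<Sum>j<d1.
      \<rho> $$ (i * d2 + k, j * d2 + l) * (W $$ (j, i) * Y $$ (l, k)))"
    unfolding tr_mult[OF reduce_carrier(2) Y]
    by (intro sum.cong refl) (simp add: reduce_snd_def sum_distrib_left sum_distrib_right mult_ac)
  also have "\<dots> = (\<Sum>k<d2. \<Sum>i<d1. \<Sum>j<d1. \<Sum>l<d2.
      \<rho> $$ (i * d2 + k, j * d2 + l) * (W $$ (j, i) * Y $$ (l, k)))"
    by (rule sum.cong[OF refl], rule sum_rotate3[symmetric])
  also have "\<dots> = (\<Sum>i<d1. \<Sum>k<d2. \<Sum>j<d1. \<Sum>l<d2.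
      \<rho> $$ (i * d2 + k, j * d2 + l) * (W $$ (j, i) * Y $$ (l, k)))"
    by (rule sum.swap)
  finally show ?thesis unfolding tr_mult_tensor[OF assms] .
qed

lemma tensor_square:
  assumes C: "C \<in> carrier_mat a b" and D: "D \<in> carrier_mat c d"
  shows "(mat_adjoint C * C) \<otimes>\<^sub>m (mat_adjoint D * D) = mat_adjoint (C \<otimes>\<^sub>m D) * (C \<otimes>\<^sub>m D)"
  unfolding mat_adjoint_tensor[OF C D]
  by (rule tensor_mat_mult[OF mat_adjoint_carrier[OF C] mat_adjoint_carrier[OF D] C D, symmetric])

lemma reduce_fst_positive:
  assumes \<rho>: "positive_mat (d1 * d2) \<rho>" and D: "D \<in> carrier_mat m d2"
  shows "positive_mat d1 (reduce_fst d1 d2 \<rho> (mat_adjoint D * D))"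
proof (rule positive_matI)
  fix C :: "complex mat" assume C: "C \<in> carrier_mat 1 d1"
  have "tr (reduce_fst d1 d2 \<rho> (mat_adjoint D * D) * (mat_adjoint C * C))
      = tr (\<rho> * (mat_adjoint (C \<otimes>\<^sub>m D) * (C \<otimes>\<^sub>m D)))"
    using \<rho> C D by (subst tr_reduce_fst) (auto simp: positive_mat_def hermitian_mat_def tensor_square[OF C D])
  then show "0 \<le> tr (reduce_fst d1 d2 \<rho> (mat_adjoint D * D) * (mat_adjoint C * C))"
    using positive_mat_square[OF \<rho> tensor_mat_carrier[OF C D]] by simp
qed simp

lemma reduce_snd_positive:
  assumes \<rho>: "positive_mat (d1 * d2) \<rho>" and D: "D \<in> carrier_mat m d1"
  shows "positive_mat d2 (reduce_snd d1 d2 \<rho> (mat_adjoint D * D))"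
proof (rule positive_matI)
  fix C :: "complex mat" assume C: "C \<in> carrier_mat 1 d2"
  have "tr (reduce_snd d1 d2 \<rho> (mat_adjoint D * D) * (mat_adjoint C * C))
      = tr (\<rho> * (mat_adjoint (D \<otimes>\<^sub>m C) * (D \<otimes>\<^sub>m C)))"
    using \<rho> C D by (subst tr_reduce_snd) (auto simp: positive_mat_def hermitian_mat_def tensor_square[OF D C])
  then show "0 \<le> tr (reduce_snd d1 d2 \<rho> (mat_adjoint D * D) * (mat_adjoint C * C))"
    using positive_mat_square[OF \<rho> tensor_mat_carrier[OF D C]] by simp
qed simp

lemma smult_state:
  assumes M: "positive_mat d M" and tr: "tr M = complex_of_real p" and p: "0 < p"
  shows "complex_of_real (1 / p) \<cdot>\<^sub>m M \<in> states d"
proof -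
  have Mc: "M \<in> carrier_mat d d" using M by (simp add: positive_mat_def hermitian_mat_def)
  have "positive_mat d (complex_of_real (1 / p) \<cdot>\<^sub>m M)"
  proof (rule positive_matI)
    fix C :: "complex mat" assume C: "C \<in> carrier_mat 1 d"
    have CC: "mat_adjoint C * C \<in> carrier_mat d d" by (rule mult_carrier_mat[OF mat_adjoint_carrier[OF C] C])
    have "tr (complex_of_real (1 / p) \<cdot>\<^sub>m M * (mat_adjoint C * C))
        = complex_of_real (1 / p) * tr (M * (mat_adjoint C * C))"
      using Mc by (simp add: tr_mult[OF _ CC] sum_distrib_left mult_ac)
    also have "0 \<le> \<dots>"
      using p positive_mat_square[OF M C] by (intro mult_nonneg_nonneg) (simp_all add: less_eq_complex_def)
    finally show "0 \<le> tr (complex_of_real (1 / p) \<cdot>\<^sub>m M * (mat_adjoint C * C))" .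
  qed (use Mc in simp)
  moreover have "tr (complex_of_real (1 / p) \<cdot>\<^sub>m M) = complex_of_real (1 / p) * tr M"
    using Mc by (simp add: tr_def sum_distrib_left)
  ultimately show ?thesis using p tr by (simp add: states_def)
qed

lemma linear_map_expand:
  assumes \<Psi>: "linear_map_on_mats d \<Psi>" and M: "M \<in> carrier_mat d d" and ab: "a < d" "b < d"
  shows "\<Psi> M $$ (a, b) = (\<Sum>i<d. \<Sum>j<d. M $$ (i, j) * \<Psi> (mat_unit d i j) $$ (a, b))"
proof -
  \<comment> \<open>Additivity is given for two summands, so the entries of M are switched on one at
    a time. The empty set needs homogeneity: the zero matrix is 0 times itself.\<close>
  define P where "P S = mat d d (\<lambda>p. if p \<in> S then M $$ p else 0)" for S
  have P: "P S \<in> carrier_mat d d" for S by (simp add: P_def)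
  have E: "mat_unit d i j \<in> carrier_mat d d" for i j by (simp add: mat_unit_def)
  have \<Psi>c: "X \<in> carrier_mat d d \<Longrightarrow> \<Psi> X \<in> carrier_mat d d" for X
    using \<Psi> by (simp add: linear_map_on_mats_def)
  have \<Psi>a: "X \<in> carrier_mat d d \<Longrightarrow> Y \<in> carrier_mat d d \<Longrightarrow> \<Psi> (X + Y) = \<Psi> X + \<Psi> Y" for X Y
    using \<Psi> by (simp add: linear_map_on_mats_def)
  have \<Psi>s: "X \<in> carrier_mat d d \<Longrightarrow> \<Psi> (c \<cdot>\<^sub>m X) = c \<cdot>\<^sub>m \<Psi> X" for X c
    using \<Psi> by (simp add: linear_map_on_mats_def)
  have "\<Psi> (P S) $$ (a, b) = (\<Sum>p\<in>S. M $$ p * \<Psi> (mat_unit d (fst p) (snd p)) $$ (a, b))"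
    if "finite S" "S \<subseteq> {..<d} \<times> {..<d}" for S
    using that
  proof (induction S)
    case empty
    have "P {} = 0 \<cdot>\<^sub>m P {}" by (intro eq_matI) (auto simp: P_def)
    then have "\<Psi> (P {}) = 0 \<cdot>\<^sub>m \<Psi> (P {})" using \<Psi>s[OF P] by metis
    then have "\<Psi> (P {}) $$ (a, b) = (0 \<cdot>\<^sub>m \<Psi> (P {})) $$ (a, b)" by simp
    then show ?case using \<Psi>c[OF P, of "{}"] ab by simp
  next
    case (insert p S)
    have "P (insert p S) = M $$ p \<cdot>\<^sub>m mat_unit d (fst p) (snd p) + P S"
      using insert.hyps by (intro eq_matI) (auto simp: P_def mat_unit_def)
    then have "\<Psi> (P (insert p S)) = M $$ p \<cdot>\<^sub>m \<Psi> (mat_unit d (fst p) (snd p)) + \<Psi> (P S)"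
      using \<Psi>a[OF smult_carrier_mat[OF E] P] \<Psi>s[OF E] by simp
    then show ?case
      using insert carrier_matD[OF \<Psi>c[OF P, of S]] carrier_matD[OF \<Psi>c[OF E]] ab by simp
  qed
  from this[of "{..<d} \<times> {..<d}"] have "\<Psi> (P ({..<d} \<times> {..<d})) $$ (a, b)
      = (\<Sum>i<d. \<Sum>j<d. M $$ (i, j) * \<Psi> (mat_unit d i j) $$ (a, b))"
    by (simp add: sum.cartesian_product case_prod_unfold)
  moreover have "P ({..<d} \<times> {..<d}) = M" using M by (intro eq_matI) (auto simp: P_def)
  ultimately show ?thesis by simp
qed

lemma sum_mult_delta2:
  fixes f :: "nat \<Rightarrow> nat \<Rightarrow> complex"
  assumes "k < m" "l < n"
  shows "(\<Sum>k'<m. \<Sum>l'<n. f k' l' * (if k = k' \<and> l = l' then 1 else 0)) = f k l"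
proof -
  have "(\<Sum>l'<n. f k' l' * (if k = k' \<and> l = l' then 1 else 0)) = f k' l * (if k' = k then 1 else 0)" for k'
  proof -
    have "(\<Sum>l'<n. f k' l' * (if k = k' \<and> l = l' then 1 else 0))
        = (\<Sum>l'<n. (f k' l' * (if k' = k then 1 else 0)) * (if l' = l then 1 else 0))"
      by (intro sum.cong refl) auto
    also have "\<dots> = f k' l * (if k' = k then 1 else 0)"
      unfolding sum_mult_delta using assms by simp
    finally show ?thesis .
  qed
  then show ?thesis using assms by (simp only: sum_mult_delta if_True)
qed

text \<open>\<open>E i j\<close> is one entry of the map at a matrix unit, x that entry of the
  prescribed value, and k, l index the factor on which the map acts as the identity. Weighting the
  constraints for all k, l with Z gives the constraint for the contracted operator.\<close>

lemma contract_constraint: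
  fixes f :: "nat \<Rightarrow> nat \<Rightarrow> nat \<Rightarrow> nat \<Rightarrow> complex"
  assumes constr: "\<And>k l. k < q \<Longrightarrow> l < q \<Longrightarrow>
      (\<Sum>i<p. \<Sum>j<p. f i j k l * E i j) = x * (\<Sum>i<p. f i i k l)"
  shows "(\<Sum>i<p. \<Sum>j<p. (\<Sum>k<q. \<Sum>l<q. f i j k l * Z l k) * E i j)
    = x * (\<Sum>i<p. \<Sum>k<q. \<Sum>l<q. f i i k l * Z l k)"
proof -
  let ?t = "\<lambda>i j k l. Z l k * (f i j k l * E i j)"
  have "(\<Sum>i<p. \<Sum>j<p. (\<Sum>k<q. \<Sum>l<q. f i j k l * Z l k) * E i j)
      = (\<Sum>i<p. \<Sum>j<p. \<Sum>k<q. \<Sum>l<q. ?t i j k l)"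
    by (simp add: sum_distrib_left sum_distrib_right mult_ac)
  also have "\<dots> = (\<Sum>k<q. \<Sum>i<p. \<Sum>j<p. \<Sum>l<q. ?t i j k l)" by (rule sum_rotate3)
  also have "\<dots> = (\<Sum>k<q. \<Sum>l<q. \<Sum>i<p. \<Sum>j<p. ?t i j k l)" by (rule sum.cong[OF refl], rule sum_rotate3)
  also have "\<dots> = (\<Sum>k<q. \<Sum>l<q. Z l k * (x * (\<Sum>i<p. f i i k l)))"
    by (intro sum.cong refl) (simp only: sum_distrib_left[symmetric] lessThan_iff constr)
  also have "\<dots> = x * (\<Sum>k<q. \<Sum>l<q. \<Sum>i<p. f i i k l * Z l k)"
    by (simp add: sum_distrib_left mult_ac)
  finally show ?thesis by (subst (asm) sum_rotate3)
qed

text \<open>The map touches the first factor alone, so it commutes with contracting the second. For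
  a measurement operator Z, division by the probability then shows that the conditional state
  satisfies the constraint exactly.\<close>

lemma constraint_reduce_fst:
  assumes \<rho>: "\<rho> \<in> carrier_mat (d1 * d2) (d1 * d2)" and \<Psi>: "linear_map_on_mats d1 \<Psi>" and X: "X \<in> carrier_mat d1 d1"
    and constr: "tensor_map d1 \<Psi> d2 id \<rho> = X \<otimes>\<^sub>m ptrace_fst d1 d2 \<rho>" and Z: "Z \<in> carrier_mat d2 d2"
  shows "\<Psi> (reduce_fst d1 d2 \<rho> Z) = tr (\<rho> * (1\<^sub>m d1 \<otimes>\<^sub>m Z)) \<cdot>\<^sub>m X"
proof (rule eq_matI)
  have \<Psi>c: "M \<in> carrier_mat d1 d1 \<Longrightarrow> \<Psi> M \<in> carrier_mat d1 d1" for M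
    using \<Psi> by (simp add: linear_map_on_mats_def)
  fix a b assume "a < dim_row (tr (\<rho> * (1\<^sub>m d1 \<otimes>\<^sub>m Z)) \<cdot>\<^sub>m X)" "b < dim_col (tr (\<rho> * (1\<^sub>m d1 \<otimes>\<^sub>m Z)) \<cdot>\<^sub>m X)"
  then have ab: "a < d1" "b < d1" using X by auto
  have E: "\<Psi> (mat_unit d1 i j) \<in> carrier_mat d1 d1" for i j
    by (rule \<Psi>c) (simp add: mat_unit_def)
  have id: "mat_unit d2 k l \<in> carrier_mat d2 d2" for k l by (simp add: mat_unit_def)
  have P: "ptrace_fst d1 d2 \<rho> \<in> carrier_mat d2 d2" by (simp add: ptrace_fst_def)
  \<comment> \<open>The operator identity read at one pair of indices of the second factor.\<close>
  have entry: "(\<Sum>i<d1. \<Sum>j<d1. \<rho> $$ (i * d2 + k, j * d2 + l) * \<Psi> (mat_unit d1 i j) $$ (a, b))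
      = X $$ (a, b) * (\<Sum>i<d1. \<rho> $$ (i * d2 + k, i * d2 + l))" if kl: "k < d2" "l < d2" for k l
  proof -
    have "(X \<otimes>\<^sub>m ptrace_fst d1 d2 \<rho>) $$ (a * d2 + k, b * d2 + l)
        = X $$ (a, b) * (\<Sum>i<d1. \<rho> $$ (i * d2 + k, i * d2 + l))"
      using ab kl by (simp add: tensor_mat_index'[OF X P]) (simp add: ptrace_fst_def)
    moreover have "tensor_map d1 \<Psi> d2 id \<rho> $$ (a * d2 + k, b * d2 + l) =
      (\<Sum>i<d1. \<Sum>j<d1. \<Sum>k'<d2. \<Sum>l'<d2.
        \<rho> $$ (i * d2 + k', j * d2 + l') * \<Psi> (mat_unit d1 i j) $$ (a, b) * (if k = k' \<and> l = l' then 1 else 0))"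
      unfolding tensor_map_def using ab kl
      by (simp add: product_index_less) (intro sum.cong refl,
          simp add: tensor_mat_index'[OF E id] mult.assoc, simp add: mat_unit_def)
    ultimately show ?thesis unfolding constr sum_mult_delta2[OF kl] by simp
  qed
  have "\<Psi> (reduce_fst d1 d2 \<rho> Z) $$ (a, b) = X $$ (a, b) * tr (reduce_fst d1 d2 \<rho> Z)"
    unfolding linear_map_expand[OF \<Psi> reduce_carrier(1) ab]
    using contract_constraint[where f = "\<lambda>i j k l. \<rho> $$ (i * d2 + k, j * d2 + l)" and Z = "\<lambda>l k. Z $$ (l, k)", OF entry]
    by (simp add: tr_def reduce_fst_def)
  also have "tr (reduce_fst d1 d2 \<rho> Z) = tr (\<rho> * (1\<^sub>m d1 \<otimes>\<^sub>m Z))"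
    using tr_reduce_fst[OF \<rho> one_carrier_mat Z] right_mult_one_mat[OF reduce_carrier(1)] by metis
  finally show "\<Psi> (reduce_fst d1 d2 \<rho> Z) $$ (a, b) = (tr (\<rho> * (1\<^sub>m d1 \<otimes>\<^sub>m Z)) \<cdot>\<^sub>m X) $$ (a, b)"
    using ab X by simp
next
  have "\<Psi> (reduce_fst d1 d2 \<rho> Z) \<in> carrier_mat d1 d1"
    using \<Psi> by (simp add: linear_map_on_mats_def)
  then show "dim_row (\<Psi> (reduce_fst d1 d2 \<rho> Z)) = dim_row (tr (\<rho> * (1\<^sub>m d1 \<otimes>\<^sub>m Z)) \<cdot>\<^sub>m X)"
    "dim_col (\<Psi> (reduce_fst d1 d2 \<rho> Z)) = dim_col (tr (\<rho> * (1\<^sub>m d1 \<otimes>\<^sub>m Z)) \<cdot>\<^sub>m X)"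
    using X by auto
qed

lemma constraint_reduce_snd:
  assumes \<rho>: "\<rho> \<in> carrier_mat (d1 * d2) (d1 * d2)" and \<Psi>: "linear_map_on_mats d2 \<Psi>" and X: "X \<in> carrier_mat d2 d2"
    and constr: "tensor_map d1 id d2 \<Psi> \<rho> = ptrace_snd d1 d2 \<rho> \<otimes>\<^sub>m X" and W: "W \<in> carrier_mat d1 d1"
  shows "\<Psi> (reduce_snd d1 d2 \<rho> W) = tr (\<rho> * (W \<otimes>\<^sub>m 1\<^sub>m d2)) \<cdot>\<^sub>m X"
proof (rule eq_matI)
  have \<Psi>c: "M \<in> carrier_mat d2 d2 \<Longrightarrow> \<Psi> M \<in> carrier_mat d2 d2" for M
    using \<Psi> by (simp add: linear_map_on_mats_def)
  fix a b assume "a < dim_row (tr (\<rho> * (W \<otimes>\<^sub>m 1\<^sub>m d2)) \<cdot>\<^sub>m X)" "b < dim_col (tr (\<rho> * (W \<otimes>\<^sub>m 1\<^sub>m d2)) \<cdot>\<^sub>m X)"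
  then have ab: "a < d2" "b < d2" using X by auto
  have E: "\<Psi> (mat_unit d2 i j) \<in> carrier_mat d2 d2" for i j
    by (rule \<Psi>c) (simp add: mat_unit_def)
  have id: "mat_unit d1 k l \<in> carrier_mat d1 d1" for k l by (simp add: mat_unit_def)
  have P: "ptrace_snd d1 d2 \<rho> \<in> carrier_mat d1 d1" by (simp add: ptrace_snd_def)
  have entry: "(\<Sum>k<d2. \<Sum>l<d2. \<rho> $$ (i * d2 + k, j * d2 + l) * \<Psi> (mat_unit d2 k l) $$ (a, b))
      = X $$ (a, b) * (\<Sum>k<d2. \<rho> $$ (i * d2 + k, j * d2 + k))" if ij: "i < d1" "j < d1" for i j
  proof -
    have "(ptrace_snd d1 d2 \<rho> \<otimes>\<^sub>m X) $$ (i * d2 + a, j * d2 + b)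
        = X $$ (a, b) * (\<Sum>k<d2. \<rho> $$ (i * d2 + k, j * d2 + k))"
      using ab ij by (simp add: tensor_mat_index'[OF P X]) (simp add: ptrace_snd_def)
    moreover have "tensor_map d1 id d2 \<Psi> \<rho> $$ (i * d2 + a, j * d2 + b) =
      (\<Sum>i'<d1. \<Sum>j'<d1. (\<Sum>k<d2. \<Sum>l<d2.
        \<rho> $$ (i' * d2 + k, j' * d2 + l) * \<Psi> (mat_unit d2 k l) $$ (a, b)) * (if i = i' \<and> j = j' then 1 else 0))"
      unfolding tensor_map_def using ab ij
      by (simp add: product_index_less) (intro sum.cong refl,
          simp add: tensor_mat_index'[OF id E], simp add: mat_unit_def sum_distrib_right mult_ac)
    ultimately show ?thesis unfolding constr sum_mult_delta2[OF ij] by simp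
  qed
  have "\<Psi> (reduce_snd d1 d2 \<rho> W) $$ (a, b) = X $$ (a, b) * tr (reduce_snd d1 d2 \<rho> W)"
    unfolding linear_map_expand[OF \<Psi> reduce_carrier(2) ab]
    using contract_constraint[where f = "\<lambda>k l i j. \<rho> $$ (i * d2 + k, j * d2 + l)" and Z = "\<lambda>j i. W $$ (j, i)", OF entry]
    by (simp add: tr_def reduce_snd_def)
  also have "tr (reduce_snd d1 d2 \<rho> W) = tr (\<rho> * (W \<otimes>\<^sub>m 1\<^sub>m d2))"
    using tr_reduce_snd[OF \<rho> W one_carrier_mat] right_mult_one_mat[OF reduce_carrier(2)] by metis
  finally show "\<Psi> (reduce_snd d1 d2 \<rho> W) $$ (a, b) = (tr (\<rho> * (W \<otimes>\<^sub>m 1\<^sub>m d2)) \<cdot>\<^sub>m X) $$ (a, b)"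
    using ab X by simp
next
  have "\<Psi> (reduce_snd d1 d2 \<rho> W) \<in> carrier_mat d2 d2"
    using \<Psi> by (simp add: linear_map_on_mats_def)
  then show "dim_row (\<Psi> (reduce_snd d1 d2 \<rho> W)) = dim_row (tr (\<rho> * (W \<otimes>\<^sub>m 1\<^sub>m d2)) \<cdot>\<^sub>m X)"
    "dim_col (\<Psi> (reduce_snd d1 d2 \<rho> W)) = dim_col (tr (\<rho> * (W \<otimes>\<^sub>m 1\<^sub>m d2)) \<cdot>\<^sub>m X)"
    using X by auto
qed

section \<open>Matrix units of a commutant\<close>

lemma mat_adjoint_mult:
  assumes A: "A \<in> carrier_mat a b" and B: "B \<in> carrier_mat b c"
  shows "mat_adjoint (A * B) = mat_adjoint B * mat_adjoint (A :: complex mat)"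
proof (rule eq_matI)
  fix i j assume "i < dim_row (mat_adjoint B * mat_adjoint A)" "j < dim_col (mat_adjoint B * mat_adjoint A)"
  then have ij: "i < c" "j < a" using A B by auto
  have "mat_adjoint (A * B) $$ (i, j) = cnj ((A * B) $$ (j, i))"
    using A B ij by (intro mat_adjoint_index) auto
  also have "\<dots> = (\<Sum>t<b. mat_adjoint B $$ (i, t) * mat_adjoint A $$ (t, j))"
    unfolding mult_mat_index[OF A B ij(2,1)] using A B ij by (simp add: mult.commute)
  also have "\<dots> = (mat_adjoint B * mat_adjoint A) $$ (i, j)"
    by (rule mult_mat_index[symmetric]) (use A B ij in auto)
  finally show "mat_adjoint (A * B) $$ (i, j) = (mat_adjoint B * mat_adjoint A) $$ (i, j)" .
qed (use A B in auto)

lemma mat_adjoint_adjoint [simp]: "mat_adjoint (mat_adjoint A) = (A :: complex mat)"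
  by (intro eq_matI) auto

lemma mat_unit_carrier [simp]: "mat_unit d a b \<in> carrier_mat d d"
  by (simp add: mat_unit_def)

lemma mat_unit_mult:
  assumes "b < d" "b' < d"
  shows "mat_unit d a b * mat_unit d b' c = (if b = b' then mat_unit d a c else 0\<^sub>m d d)"
proof (rule eq_matI)
  fix r s assume "r < dim_row (if b = b' then mat_unit d a c else 0\<^sub>m d d)"
    "s < dim_col (if b = b' then mat_unit d a c else 0\<^sub>m d d)"
  then have rs: "r < d" "s < d" by (auto simp: mat_unit_def split: if_splits)
  have "(mat_unit d a b * mat_unit d b' c) $$ (r, s)
      = (\<Sum>t<d. (if r = a \<and> b' = t \<and> s = c then 1 else 0) * (if t = b then 1 else 0))"
    unfolding mult_mat_index[OF mat_unit_carrier mat_unit_carrier rs] using rs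
    by (intro sum.cong refl) (auto simp: mat_unit_def)
  also have "\<dots> = (if b = b' then mat_unit d a c else 0\<^sub>m d d) $$ (r, s)"
    unfolding sum_mult_delta using rs assms by (auto simp: mat_unit_def)
  finally show "(mat_unit d a b * mat_unit d b' c) $$ (r, s) = (if b = b' then mat_unit d a c else 0\<^sub>m d d) $$ (r, s)" .
qed (simp_all add: mat_unit_def)

lemma mat_unit_adjoint: "mat_adjoint (mat_unit d a b) = mat_unit d b a"
  by (intro eq_matI) (auto simp: mat_unit_def)

text \<open>The commutation relation is multiplied by the inverse of V on both sides. This is what
  closes the commutant under adjoints.\<close>

lemma unitary_commute_adjoint:
  fixes X V :: "complex mat"
  assumes X: "X \<in> carrier_mat d d" and V: "V \<in> carrier_mat d d"
    and u: "V * mat_adjoint V = 1\<^sub>m d" "mat_adjoint V * V = 1\<^sub>m d" and c: "X * V = V * X"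
  shows "X * mat_adjoint V = mat_adjoint V * X"
proof -
  note V' = mat_adjoint_carrier[OF V]
  have "X * mat_adjoint V = (mat_adjoint V * V) * (X * mat_adjoint V)"
    unfolding u using X V' by simp
  also have "\<dots> = mat_adjoint V * (V * X * mat_adjoint V)"
    unfolding assoc_mult_mat[OF V' V mult_carrier_mat[OF X V']] assoc_mult_mat[OF V X V'] ..
  also have "\<dots> = mat_adjoint V * (X * (V * mat_adjoint V))"
    unfolding c[symmetric] assoc_mult_mat[OF X V V'] ..
  also have "\<dots> = mat_adjoint V * X" unfolding u using X by simp
  finally show ?thesis .
qed

locale unitary_commutant =
  fixes d :: nat and \<V> :: "complex mat set"
  assumes unitary: "\<V> \<subseteq> carrier (unitary_group d)"
begin

abbreviation "\<A> \<equiv> commutant d \<V>"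

lemma V_carrier: "V \<in> \<V> \<Longrightarrow> V \<in> carrier_mat d d"
  using unitary by (auto simp: unitary_group_def)

lemma A_carrier: "X \<in> \<A> \<Longrightarrow> X \<in> carrier_mat d d"
  by (simp add: commutant_def)

lemma A_one: "1\<^sub>m d \<in> \<A>"
  using V_carrier by (auto simp: commutant_def left_mult_one_mat[of _ d d] right_mult_one_mat[of _ d d])

lemma A_add: "X \<in> \<A> \<Longrightarrow> Y \<in> \<A> \<Longrightarrow> X + Y \<in> \<A>"
  unfolding commutant_def
proof clarsimp
  fix V assume c: "X \<in> carrier_mat d d" "Y \<in> carrier_mat d d" and V: "V \<in> \<V>"
    and "\<forall>V\<in>\<V>. X * V = V * X" "\<forall>V\<in>\<V>. Y * V = V * Y"
  then show "(X + Y) * V = V * (X + Y)"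
    by (simp add: add_mult_distrib_mat[OF c V_carrier[OF V]] mult_add_distrib_mat[OF V_carrier[OF V] c])
qed

lemma A_smult: "X \<in> \<A> \<Longrightarrow> c \<cdot>\<^sub>m X \<in> \<A>"
  unfolding commutant_def
proof clarsimp
  fix V assume X: "X \<in> carrier_mat d d" and V: "V \<in> \<V>" and "\<forall>V\<in>\<V>. X * V = V * X"
  then show "c \<cdot>\<^sub>m X * V = V * (c \<cdot>\<^sub>m X)"
    by (simp add: mult_smult_assoc_mat[OF X V_carrier[OF V]] mult_smult_distrib[OF V_carrier[OF V] X])
qed

lemma A_mult:
  assumes "X \<in> \<A>" "Y \<in> \<A>" shows "X * Y \<in> \<A>"
proof -
  have X: "X \<in> carrier_mat d d" and Y: "Y \<in> carrier_mat d d" using assms by (auto simp: A_carrier)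
  have "X * Y * V = V * (X * Y)" if "V \<in> \<V>" for V
  proof -
    note V = V_carrier[OF that]
    have "X * Y * V = X * (Y * V)" by (rule assoc_mult_mat[OF X Y V])
    also have "Y * V = V * Y" using assms that by (simp add: commutant_def)
    also have "X * (V * Y) = X * V * Y" by (rule assoc_mult_mat[OF X V Y, symmetric])
    also have "X * V = V * X" using assms that by (simp add: commutant_def)
    also have "V * X * Y = V * (X * Y)" by (rule assoc_mult_mat[OF V X Y])
    finally show ?thesis .
  qed
  then show ?thesis using X Y by (simp add: commutant_def)
qed

lemma A_adjoint:
  assumes "X \<in> \<A>" shows "mat_adjoint X \<in> \<A>"
proof -
  have X: "X \<in> carrier_mat d d" using assms by (rule A_carrier)
  have "mat_adjoint X * V = V * mat_adjoint X" if V: "V \<in> \<V>" for V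
  proof -
    have Vc: "V \<in> carrier_mat d d" "V * mat_adjoint V = 1\<^sub>m d" "mat_adjoint V * V = 1\<^sub>m d"
      using unitary V by (auto simp: unitary_group_def)
    have "X * mat_adjoint V = mat_adjoint V * X"
      using assms V by (intro unitary_commute_adjoint[OF X Vc]) (simp add: commutant_def)
    then have "mat_adjoint (X * mat_adjoint V) = mat_adjoint (mat_adjoint V * X)" by simp
    then show ?thesis
      using mat_adjoint_mult[OF X mat_adjoint_carrier[OF Vc(1)]] mat_adjoint_mult[OF mat_adjoint_carrier[OF Vc(1)] X]
      by simp
  qed
  then show ?thesis using X by (simp add: commutant_def)
qed

lemma A_zero: "0\<^sub>m d d \<in> \<A>"
proof -
  have "0 \<cdot>\<^sub>m 1\<^sub>m d = (0\<^sub>m d d :: complex mat)" by (intro eq_matI) auto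
  then show ?thesis using A_smult[OF A_one, of 0] by metis
qed

end

text \<open>
  \<open>K r c\<close> for \<open>blk r = blk c\<close> are the matrix units of the block \<open>blk r\<close>, and \<open>f\<close> spans one
  copy of each irreducible representation of the algebra, with multiplicity one.
\<close>

definition matrix_units ::
  "nat \<Rightarrow> complex mat set \<Rightarrow> nat \<Rightarrow> (nat \<Rightarrow> nat) \<Rightarrow> (nat \<Rightarrow> nat \<Rightarrow> complex mat) \<Rightarrow> (nat \<Rightarrow> nat \<Rightarrow> complex) \<Rightarrow> bool"
  where
  "matrix_units d \<A> N blk K f \<longleftrightarrow>
     (\<forall>r<N. \<forall>c<N. K r c \<in> carrier_mat d d) \<and>
     (\<forall>r<N. \<forall>c<N. mat_adjoint (K r c) = K c r) \<and>
     (\<forall>r<N. \<forall>c<N. blk r \<noteq> blk c \<longrightarrow> K r c = 0\<^sub>m d d) \<and>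
     (\<forall>r<N. \<forall>c<N. \<forall>t<N. blk r = blk c \<longrightarrow> blk c = blk t \<longrightarrow> K r c * K c t = K r t) \<and>
     orthonormal_system d N f \<and>
     (\<forall>X\<in>\<A>. \<forall>i<d. \<forall>j<d. X $$ (i, j) =
        (\<Sum>r<N. \<Sum>c<N. sesq d (\<lambda>i j. X $$ (i, j)) (f r) (f c) * K r c $$ (i, j)))"

lemma sesq_one_mat: "sesq d (\<lambda>i j. 1\<^sub>m d $$ (i, j)) x y = ip d x y"
proof -
  have "(\<Sum>s<d. 1\<^sub>m d $$ (t, s) * y s) = y t" if "t < d" for t
  proof -
    have "(\<Sum>s<d. 1\<^sub>m d $$ (t, s) * y s) = (\<Sum>s<d. y s * (if s = t then 1 else 0))"
      using that by (intro sum.cong refl) auto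
    then show ?thesis using that by (simp only: sum_mult_delta if_True)
  qed
  then show ?thesis by (simp add: sesq_eq_ip_right ip_def)
qed

lemma sesq_columns:
  assumes F: "F \<in> carrier_mat d d" and X: "X \<in> carrier_mat d d" and G: "G \<in> carrier_mat d d"
    and s: "s < d" "s' < d"
  shows "sesq d (\<lambda>i j. X $$ (i, j)) (\<lambda>t. F $$ (t, s)) (\<lambda>t. G $$ (t, s')) = (mat_adjoint F * (X * G)) $$ (s, s')"
proof -
  have "(mat_adjoint F * (X * G)) $$ (s, s') = (\<Sum>t<d. cnj (F $$ (t, s)) * (\<Sum>u<d. X $$ (t, u) * G $$ (u, s')))"
    unfolding mult_mat_index[OF mat_adjoint_carrier[OF F] mult_carrier_mat[OF X G] s]
    using carrier_matD[OF F] s by (intro sum.cong refl) (simp add: mult_mat_index[OF X G _ s(2)] del: index_mult_mat(1))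
  then show ?thesis by (simp add: sesq_def sum_distrib_left mult.assoc)
qed

section \<open>Matrix units pulled back along the block isomorphism\<close>

locale block_iso = unitary_commutant +
  fixes k :: nat and m :: "nat \<Rightarrow> nat" and \<phi> :: "complex mat \<Rightarrow> nat \<Rightarrow> complex mat"
  assumes m_pos: "\<And>i. i \<in> {1..k} \<Longrightarrow> 0 < m i"
    and bij: "bij_betw \<phi> \<A> (\<Pi>\<^sub>E i \<in> {1..k}. carrier_mat (m i) (m i))"
    and phi_add: "\<And>i X Y. i \<in> {1..k} \<Longrightarrow> X \<in> \<A> \<Longrightarrow> Y \<in> \<A> \<Longrightarrow> \<phi> (X + Y) i = \<phi> X i + \<phi> Y i"
    and phi_smult: "\<And>i c X. i \<in> {1..k} \<Longrightarrow> X \<in> \<A> \<Longrightarrow> \<phi> (c \<cdot>\<^sub>m X) i = c \<cdot>\<^sub>m \<phi> X i"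
    and phi_mult: "\<And>i X Y. i \<in> {1..k} \<Longrightarrow> X \<in> \<A> \<Longrightarrow> Y \<in> \<A> \<Longrightarrow> \<phi> (X * Y) i = \<phi> X i * \<phi> Y i"
    and phi_adjoint: "\<And>i X. i \<in> {1..k} \<Longrightarrow> X \<in> \<A> \<Longrightarrow> \<phi> (mat_adjoint X) i = mat_adjoint (\<phi> X i)"
begin

lemma phi_carrier: "X \<in> \<A> \<Longrightarrow> i \<in> {1..k} \<Longrightarrow> \<phi> X i \<in> carrier_mat (m i) (m i)"
  using bij_betwE[OF bij] by (auto simp: PiE_iff)

lemma phi_inject:
  assumes "X \<in> \<A>" "Y \<in> \<A>" "\<And>i. i \<in> {1..k} \<Longrightarrow> \<phi> X i = \<phi> Y i"
  shows "X = Y"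
proof -
  have "\<phi> X = \<phi> Y"
    by (rule PiE_ext[OF bij_betwE[OF bij, rule_format, OF assms(1)]
          bij_betwE[OF bij, rule_format, OF assms(2)] assms(3)])
  then show ?thesis using bij assms by (auto simp: bij_betw_def inj_on_def)
qed

lemma phi_surj:
  assumes "\<And>i. i \<in> {1..k} \<Longrightarrow> M i \<in> carrier_mat (m i) (m i)"
  shows "\<exists>X\<in>\<A>. \<forall>i\<in>{1..k}. \<phi> X i = M i"
proof -
  have "restrict M {1..k} \<in> (\<Pi>\<^sub>E i \<in> {1..k}. carrier_mat (m i) (m i))" using assms by auto
  then obtain X where "X \<in> \<A>" "\<phi> X = restrict M {1..k}"
    using bij by (metis (no_types, lifting) bij_betw_imp_surj_on imageE)
  then show ?thesis by (intro bexI[of _ X]) auto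
qed

lemma phi_zero: "i \<in> {1..k} \<Longrightarrow> \<phi> (0\<^sub>m d d) i = 0\<^sub>m (m i) (m i)"
proof -
  assume i: "i \<in> {1..k}"
  have "0\<^sub>m d d = 0 \<cdot>\<^sub>m (0\<^sub>m d d :: complex mat)" by (intro eq_matI) auto
  then have "\<phi> (0\<^sub>m d d) i = 0 \<cdot>\<^sub>m \<phi> (0\<^sub>m d d) i" using phi_smult[OF i A_zero, of 0] by metis
  also have "\<dots> = 0\<^sub>m (m i) (m i)" using phi_carrier[OF A_zero i] by (intro eq_matI) auto
  finally show ?thesis .
qed

text \<open>The preimage of a matrix unit of block i. For i outside \<open>{1..k}\<close> all
  components vanish and the value is the zero matrix, so the relations below carry no side condition
  on i.\<close>

definition unit :: "nat \<Rightarrow> nat \<Rightarrow> nat \<Rightarrow> complex mat" where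
  "unit i a b = (SOME X. X \<in> \<A> \<and> (\<forall>j\<in>{1..k}. \<phi> X j = (if j = i then mat_unit (m i) a b else 0\<^sub>m (m j) (m j))))"

lemma unit_props:
  "unit i a b \<in> \<A> \<and> (\<forall>j\<in>{1..k}. \<phi> (unit i a b) j = (if j = i then mat_unit (m i) a b else 0\<^sub>m (m j) (m j)))"
  unfolding unit_def
proof (rule someI_ex)
  show "\<exists>X. X \<in> \<A> \<and> (\<forall>j\<in>{1..k}. \<phi> X j = (if j = i then mat_unit (m i) a b else 0\<^sub>m (m j) (m j)))"
    unfolding Bex_def[symmetric] by (rule phi_surj) simp
qed

lemma unit_in: "unit i a b \<in> \<A>" and unit_carrier: "unit i a b \<in> carrier_mat d d"
  using unit_props A_carrier by auto

lemma phi_unit: "j \<in> {1..k} \<Longrightarrow> \<phi> (unit i a b) j = (if j = i then mat_unit (m i) a b else 0\<^sub>m (m j) (m j))"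
  using unit_props by auto

lemma unit_mult:
  assumes "b < m i" "b' < m i"
  shows "unit i a b * unit i b' c = (if b = b' then unit i a c else 0\<^sub>m d d)"
  by (rule phi_inject)
    (use assms in \<open>auto simp: A_mult unit_in A_zero phi_mult phi_unit mat_unit_mult phi_zero\<close>)

lemma unit_mult_neq:
  assumes "i \<noteq> i'"
  shows "unit i a b * unit i' b' c = 0\<^sub>m d d"
proof (rule phi_inject)
  fix j assume "j \<in> {1..k}"
  then show "\<phi> (unit i a b * unit i' b' c) j = \<phi> (0\<^sub>m d d) j"
    using assms by (cases "j = i") (auto simp: unit_in phi_mult phi_unit phi_zero
      left_mult_zero_mat[of _ "m j" "m j"] right_mult_zero_mat[of _ "m i" "m i"])
qed (simp_all add: A_mult unit_in A_zero)

lemma unit_adjoint: "mat_adjoint (unit i a b) = unit i b a"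
  by (rule phi_inject) (auto simp: A_adjoint unit_in phi_adjoint phi_unit mat_unit_adjoint intro!: eq_matI)

lemma unit_expand_finite:
  assumes "finite S" "S \<subseteq> (SIGMA i:{1..k}. {..<m i} \<times> {..<m i})"
  shows "\<exists>Y\<in>\<A>. (\<forall>j\<in>{1..k}. \<phi> Y j = mat (m j) (m j) (\<lambda>(a, b). if (j, a, b) \<in> S then x j a b else 0)) \<and>
    (\<forall>r<d. \<forall>s<d. Y $$ (r, s) = (\<Sum>(i, a, b)\<in>S. x i a b * unit i a b $$ (r, s)))"
  using assms
proof (induction S)
  case empty
  show ?case by (intro bexI[of _ "0\<^sub>m d d"]) (auto simp: phi_zero A_zero intro!: eq_matI)
next
  case (insert q S)
  obtain i a b where q: "q = (i, a, b)" by (cases q)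
  obtain Y where Y: "Y \<in> \<A>" "\<forall>j\<in>{1..k}. \<phi> Y j = mat (m j) (m j) (\<lambda>(a, b). if (j, a, b) \<in> S then x j a b else 0)"
    "\<forall>r<d. \<forall>s<d. Y $$ (r, s) = (\<Sum>(i, a, b)\<in>S. x i a b * unit i a b $$ (r, s))"
    using insert by auto
  let ?Z = "x i a b \<cdot>\<^sub>m unit i a b + Y"
  have "?Z \<in> \<A>" by (intro A_add A_smult unit_in Y)
  moreover have "\<phi> ?Z j = mat (m j) (m j) (\<lambda>(a, b). if (j, a, b) \<in> insert q S then x j a b else 0)"
    if j: "j \<in> {1..k}" for j
    using j insert.hyps Y(2) unfolding phi_add[OF j A_smult[OF unit_in] Y(1)] phi_smult[OF j unit_in] phi_unit[OF j]
    by (intro eq_matI) (auto simp: q mat_unit_def)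
  moreover have "?Z $$ (r, s) = (\<Sum>(i, a, b)\<in>insert q S. x i a b * unit i a b $$ (r, s))" if "r < d" "s < d" for r s
    using that insert.hyps Y A_carrier[OF Y(1)] unit_carrier[of i a b] by (simp add: q)
  ultimately show ?case by blast
qed

lemma unit_expand:
  assumes X: "X \<in> \<A>" and rs: "r < d" "s < d"
  shows "X $$ (r, s) = (\<Sum>(i, a, b)\<in>(SIGMA i:{1..k}. {..<m i} \<times> {..<m i}). \<phi> X i $$ (a, b) * unit i a b $$ (r, s))"
proof -
  obtain Y where Y: "Y \<in> \<A>"
    "\<forall>j\<in>{1..k}. \<phi> Y j = mat (m j) (m j) (\<lambda>(a, b). if (j, a, b) \<in> (SIGMA i:{1..k}. {..<m i} \<times> {..<m i}) then \<phi> X j $$ (a, b) else 0)"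
    "\<forall>r<d. \<forall>s<d. Y $$ (r, s) = (\<Sum>(i, a, b)\<in>(SIGMA i:{1..k}. {..<m i} \<times> {..<m i}). \<phi> X i $$ (a, b) * unit i a b $$ (r, s))"
    using unit_expand_finite[of "SIGMA i:{1..k}. {..<m i} \<times> {..<m i}" "\<lambda>i a b. \<phi> X i $$ (a, b)"] by auto
  have "Y = X"
  proof (rule phi_inject[OF Y(1) X])
    fix j assume j: "j \<in> {1..k}"
    show "\<phi> Y j = \<phi> X j" using phi_carrier[OF X j] Y(2) j by (intro eq_matI) auto
  qed
  with Y(3) rs show ?thesis by simp
qed

text \<open>\<open>unit i 0 0\<close> is a nonzero projection, hence its adjoint times itself. The
  diagonal entry at a nonzero column is therefore the squared length of that column.\<close>

lemma unit_diagonal: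
  assumes i: "i \<in> {1..k}"
  shows "\<exists>s<d. \<exists>\<nu>>0. unit i 0 0 $$ (s, s) = complex_of_real \<nu>"
proof -
  have "unit i 0 0 \<noteq> 0\<^sub>m d d"
  proof
    assume "unit i 0 0 = 0\<^sub>m d d"
    then have "mat_unit (m i) 0 0 = 0\<^sub>m (m i) (m i)" using phi_unit[OF i, of i 0 0] phi_zero[OF i] by simp
    then have "mat_unit (m i) 0 0 $$ (0, 0) = 0\<^sub>m (m i) (m i) $$ (0, 0)" by simp
    then show False using m_pos[OF i] by (simp add: mat_unit_def)
  qed
  then obtain t s where ts: "t < d" "s < d" "unit i 0 0 $$ (t, s) \<noteq> 0"
    using unit_carrier[of i 0 0] by (metis eq_matI index_zero_mat carrier_matD)
  have "unit i 0 0 = mat_adjoint (unit i 0 0) * unit i 0 0"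
    using m_pos[OF i] by (simp add: unit_adjoint unit_mult)
  then have "unit i 0 0 $$ (s, s) = (mat_adjoint (unit i 0 0) * unit i 0 0) $$ (s, s)" by simp
  also have "\<dots> = (\<Sum>t<d. cnj (unit i 0 0 $$ (t, s)) * unit i 0 0 $$ (t, s))"
    unfolding mult_mat_index[OF mat_adjoint_carrier[OF unit_carrier] unit_carrier ts(2,2)]
    using unit_carrier[of i 0 0] ts by (intro sum.cong refl) simp
  finally have "unit i 0 0 $$ (s, s) = (\<Sum>t<d. cnj (unit i 0 0 $$ (t, s)) * unit i 0 0 $$ (t, s))" .
  with sum_norm_square_pos[OF ts(1), of "\<lambda>t. unit i 0 0 $$ (t, s)", OF ts(3)] ts(2) show ?thesis
    by (metis zero_less_power)
qed

text \<open>The N indices enumerate the pairs of a block and a position in it. Between the vectors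
  \<open>f\<close>, the form of X returns the entries of its blocks, and 0 across blocks. One vector
  per pair, regardless of how often an irreducible representation occurs in dimension d, is what
  later replaces ln d by ln N.\<close>

theorem matrix_units_exist:
  "\<exists>N blk K f. matrix_units d \<A> N blk K f \<and> N = (\<Sum>i = 1..k. m i) \<and>
     (\<forall>r<N. blk r \<in> {1..k} \<and> card {c. c < N \<and> blk c = blk r} = m (blk r))"
proof -
  define I where "I = (SIGMA i:{1..k}. {..<m i})"
  define N where "N = (\<Sum>i = 1..k. m i)"
  have cardI: "card I = N" by (simp add: I_def N_def)
  have finI: "finite I" by (simp add: I_def)
  obtain e where e: "bij_betw e {..<N} I"
    using ex_bij_betw_nat_finite[OF finI] cardI by (auto simp: lessThan_atLeast0)
  have eI: "e r \<in> I" if "r < N" for r using bij_betwE[OF e] that by auto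
  have inj: "e r = e c \<longleftrightarrow> r = c" if "r < N" "c < N" for r c
    using e that by (auto simp: bij_betw_def inj_on_def)
  define blk where "blk r = fst (e r)" for r
  define K where "K r c = (if blk r = blk c then unit (blk r) (snd (e r)) (snd (e c)) else 0\<^sub>m d d)" for r c
  have snd_lt: "snd (e r) < m (blk r)" and blk: "blk r \<in> {1..k}" if "r < N" for r
    using eI[OF that] by (auto simp: I_def blk_def)
  have "\<forall>i\<in>{1..k}. \<exists>p. fst p < d \<and> 0 < snd p \<and> unit i 0 0 $$ (fst p, fst p) = complex_of_real (snd p)"
    using unit_diagonal by fastforce
  then obtain p where p: "\<forall>i\<in>{1..k}. fst (p i) < d \<and> 0 < snd (p i) \<and>
      unit i 0 0 $$ (fst (p i), fst (p i)) = complex_of_real (snd (p i))"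
    by (rule bchoice[THEN exE])
  define s where "s i = fst (p i)" for i
  define \<nu> where "\<nu> i = snd (p i)" for i
  have s: "s i < d" and \<nu>: "0 < \<nu> i" and diag: "unit i 0 0 $$ (s i, s i) = complex_of_real (\<nu> i)" if "i \<in> {1..k}" for i
    using p that by (auto simp: s_def \<nu>_def)
  \<comment> \<open>Column s of the matrix unit with indices (a, 0), normalised: its squared length
    is the entry (s, s) of \<open>unit i 0 0\<close>, which is \<nu>.\<close>
  define f where "f r t = unit (blk r) (snd (e r)) 0 $$ (t, s (blk r)) / sqrt (\<nu> (blk r))" for r t
  have sqrt: "complex_of_real (sqrt (\<nu> i)) * complex_of_real (sqrt (\<nu> i)) = complex_of_real (\<nu> i)" if "i \<in> {1..k}" for i
    using \<nu>[OF that] by (simp flip: of_real_mult)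
  \<comment> \<open>Between such columns the form is an entry of a product of three matrix units,
    which collapses to \<open>unit i 0 0\<close> or to 0.\<close>
  have sesq_unit: "sesq d (\<lambda>u v. unit i a b $$ (u, v)) (f r) (f c)
      = (if e r = (i, a) \<and> e c = (i, b) then 1 else 0)"
    if r: "r < N" and c: "c < N" and i: "i \<in> {1..k}" and ab: "a < m i" "b < m i" for r c i a b
  proof -
    let ?P = "unit (blk r) 0 (snd (e r)) * (unit i a b * unit (blk c) (snd (e c)) 0)"
    have "sesq d (\<lambda>u v. unit i a b $$ (u, v)) (f r) (f c)
        = sesq d (\<lambda>u v. unit i a b $$ (u, v)) (\<lambda>t. unit (blk r) (snd (e r)) 0 $$ (t, s (blk r)))
            (\<lambda>t. unit (blk c) (snd (e c)) 0 $$ (t, s (blk c)))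
          / (complex_of_real (sqrt (\<nu> (blk r))) * complex_of_real (sqrt (\<nu> (blk c))))"
      by (simp add: sesq_def f_def sum_divide_distrib)
    also have "\<dots> = ?P $$ (s (blk r), s (blk c))
        / (complex_of_real (sqrt (\<nu> (blk r))) * complex_of_real (sqrt (\<nu> (blk c))))"
      unfolding sesq_columns[OF unit_carrier unit_carrier unit_carrier s[OF blk[OF r]] s[OF blk[OF c]]] unit_adjoint ..
    also have "\<dots> = (if e r = (i, a) \<and> e c = (i, b) then 1 else 0)"
    proof (cases "blk r = i \<and> blk c = i")
      case True
      then have lt: "snd (e r) < m i" "snd (e c) < m i" using snd_lt[OF r] snd_lt[OF c] by auto
      have iff: "e r = (i, a) \<and> e c = (i, b) \<longleftrightarrow> snd (e r) = a \<and> snd (e c) = b"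
        using True by (auto simp: blk_def prod_eq_iff)
      have "?P = (if e r = (i, a) \<and> e c = (i, b) then unit i 0 0 else 0\<^sub>m d d)"
        unfolding iff using True lt ab m_pos[OF i] unit_carrier
        by (auto simp: unit_mult right_mult_zero_mat[of _ d d])
      then show ?thesis using True diag[OF i] \<nu>[OF i] s[OF i] sqrt[OF i] by simp
    next
      case False
      have "?P = 0\<^sub>m d d"
      proof (cases "blk c = i")
        case True
        with False have "blk r \<noteq> i" by simp
        then show ?thesis
          using True unit_mult[of b i "snd (e c)" a 0] ab snd_lt[OF c] unit_carrier
          by (auto simp: unit_mult_neq right_mult_zero_mat[of _ d d])
      next
        case False
        then have "unit i a b * unit (blk c) (snd (e c)) 0 = 0\<^sub>m d d" by (intro unit_mult_neq) simp
        then show ?thesis using unit_carrier by (simp add: right_mult_zero_mat[of _ d d])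
      qed
      moreover have "\<not> (e r = (i, a) \<and> e c = (i, b))" using False by (auto simp: blk_def)
      ultimately show ?thesis using s[OF blk[OF r]] s[OF blk[OF c]] by simp
    qed
    finally show ?thesis .
  qed
  have coeff: "sesq d (\<lambda>u v. X $$ (u, v)) (f r) (f c) = (if blk r = blk c then \<phi> X (blk r) $$ (snd (e r), snd (e c)) else 0)"
    if X: "X \<in> \<A>" and r: "r < N" and c: "c < N" for X r c
  proof -
    let ?J = "SIGMA i:{1..k}. {..<m i} \<times> {..<m i}"
    have "sesq d (\<lambda>u v. X $$ (u, v)) (f r) (f c)
        = (\<Sum>u<d. \<Sum>v<d. \<Sum>q\<in>?J. \<phi> X (fst q) $$ snd q * (cnj (f r u) * unit (fst q) (fst (snd q)) (snd (snd q)) $$ (u, v) * f c v))"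
      unfolding sesq_def
      by (intro sum.cong refl) (simp add: unit_expand[OF X] sum_distrib_left sum_distrib_right case_prod_unfold mult_ac)
    also have "\<dots> = (\<Sum>q\<in>?J. \<phi> X (fst q) $$ snd q * sesq d (\<lambda>u v. unit (fst q) (fst (snd q)) (snd (snd q)) $$ (u, v)) (f r) (f c))"
      by (subst sum_rotate3) (simp add: sesq_def sum_distrib_left)
    also have "\<dots> = (\<Sum>q\<in>?J. if q = (blk r, snd (e r), snd (e c)) then (if blk r = blk c then \<phi> X (blk r) $$ (snd (e r), snd (e c)) else 0) else 0)"
    proof (intro sum.cong refl)
      fix q assume "q \<in> ?J"
      then obtain i a b where q: "q = (i, a, b)" and i: "i \<in> {1..k}" and ab: "a < m i" "b < m i" by auto
      show "\<phi> X (fst q) $$ snd q * sesq d (\<lambda>u v. unit (fst q) (fst (snd q)) (snd (snd q)) $$ (u, v)) (f r) (f c)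
        = (if q = (blk r, snd (e r), snd (e c)) then (if blk r = blk c then \<phi> X (blk r) $$ (snd (e r), snd (e c)) else 0) else 0)"
        unfolding q fst_conv snd_conv sesq_unit[OF r c i ab] by (auto simp: blk_def prod_eq_iff)
    qed
    also have "\<dots> = (if blk r = blk c then \<phi> X (blk r) $$ (snd (e r), snd (e c)) else 0)"
      using snd_lt[OF r] snd_lt[OF c] blk[OF r] by (subst sum.delta) auto
    finally show ?thesis .
  qed
  \<comment> \<open>Unitality is not part of the isomorphism as given; multiplying by a preimage of
    the identity, which exists by surjectivity, yields it.\<close>
  have phi_one: "\<phi> (1\<^sub>m d) i = 1\<^sub>m (m i)" if i: "i \<in> {1..k}" for i
  proof -
    obtain X where X: "X \<in> \<A>" "\<forall>i\<in>{1..k}. \<phi> X i = 1\<^sub>m (m i)" using phi_surj[of "\<lambda>i. 1\<^sub>m (m i)"] by auto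
    have "\<phi> (1\<^sub>m d) i = \<phi> (1\<^sub>m d) i * \<phi> X i" using X i phi_carrier[OF A_one i] by simp
    also have "\<dots> = \<phi> X i"
      using phi_mult[OF i A_one X(1)] A_carrier[OF X(1)] by (simp add: left_mult_one_mat[of _ d d])
    finally show ?thesis using X i by simp
  qed
  have on: "orthonormal_system d N f"
    unfolding orthonormal_system_def
  proof (intro allI impI)
    fix r c assume rc: "r < N" "c < N"
    have "(\<Sum>t<d. cnj (f r t) * f c t) = sesq d (\<lambda>u v. 1\<^sub>m d $$ (u, v)) (f r) (f c)"
      by (simp only: sesq_one_mat ip_def)
    also have "\<dots> = (if blk r = blk c then 1\<^sub>m (m (blk r)) $$ (snd (e r), snd (e c)) else 0)"
      by (simp only: coeff[OF A_one rc] phi_one[OF blk[OF rc(1)]])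
    also have "\<dots> = (if r = c then 1 else 0)"
      using snd_lt[OF rc(1)] snd_lt[OF rc(2)] inj[OF rc] by (auto simp: blk_def prod_eq_iff split: if_splits)
    finally show "(\<Sum>t<d. cnj (f r t) * f c t) = (if r = c then 1 else 0)" .
  qed
  have expand: "X $$ (i, j) = (\<Sum>r<N. \<Sum>c<N. sesq d (\<lambda>i j. X $$ (i, j)) (f r) (f c) * K r c $$ (i, j))"
    if X: "X \<in> \<A>" and ij: "i < d" "j < d" for X i j
  proof -
    let ?h = "\<lambda>p q. if fst p = fst q then \<phi> X (fst p) $$ (snd p, snd q) * unit (fst p) (snd p) (snd q) $$ (i, j) else 0"
    have "(\<Sum>r<N. \<Sum>c<N. sesq d (\<lambda>i j. X $$ (i, j)) (f r) (f c) * K r c $$ (i, j))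
        = (\<Sum>r<N. \<Sum>c<N. ?h (e r) (e c))"
      by (intro sum.cong refl) (auto simp: coeff[OF X] K_def blk_def)
    also have "\<dots> = (\<Sum>p\<in>I. \<Sum>q\<in>I. ?h p q)"
      by (simp add: sum.reindex_bij_betw[OF e, where g = "\<lambda>q. ?h p q" for p] sum.reindex_bij_betw[OF e, where g = "\<lambda>p. \<Sum>q\<in>I. ?h p q"])
    also have "\<dots> = (\<Sum>i'\<in>{1..k}. \<Sum>a<m i'. \<Sum>l\<in>{1..k}. \<Sum>b<m l. ?h (i', a) (l, b))"
    proof -
      have sig: "(\<Sum>p\<in>I. g p) = (\<Sum>i\<in>{1..k}. \<Sum>a<m i. g (i, a))" for g :: "nat \<times> nat \<Rightarrow> complex"
        by (simp add: I_def sum.Sigma)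
      show ?thesis by (simp only: sig)
    qed
    also have "\<dots> = (\<Sum>i'\<in>{1..k}. \<Sum>a<m i'. \<Sum>b<m i'. \<phi> X i' $$ (a, b) * unit i' a b $$ (i, j))"
    proof (rule sum.cong[OF refl], rule sum.cong[OF refl])
      fix i' a assume i': "i' \<in> {1..k}"
      have "(\<Sum>l\<in>{1..k}. \<Sum>b<m l. ?h (i', a) (l, b))
          = (\<Sum>l\<in>{1..k}. if l = i' then \<Sum>b<m i'. \<phi> X i' $$ (a, b) * unit i' a b $$ (i, j) else 0)"
        by (intro sum.cong refl) auto
      then show "(\<Sum>l\<in>{1..k}. \<Sum>b<m l. ?h (i', a) (l, b)) = (\<Sum>b<m i'. \<phi> X i' $$ (a, b) * unit i' a b $$ (i, j))"
        using i' by simp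
    qed
    also have "\<dots> = X $$ (i, j)"
      unfolding unit_expand[OF X ij] by (simp add: sum.cartesian_product sum.Sigma case_prod_unfold)
    finally show ?thesis ..
  qed
  have card: "card {c. c < N \<and> blk c = blk r} = m (blk r)" if "r < N" for r
  proof -
    have "bij_betw (\<lambda>c. snd (e c)) {c. c < N \<and> blk c = blk r} {..<m (blk r)}"
    proof (rule bij_betw_imageI)
      show "inj_on (\<lambda>c. snd (e c)) {c. c < N \<and> blk c = blk r}"
      proof (rule inj_onI)
        fix x y assume "x \<in> {c. c < N \<and> blk c = blk r}" "y \<in> {c. c < N \<and> blk c = blk r}" "snd (e x) = snd (e y)"
        then show "x = y" using inj[of x y] by (auto simp: blk_def prod_eq_iff)
      qed
      show "(\<lambda>c. snd (e c)) ` {c. c < N \<and> blk c = blk r} = {..<m (blk r)}"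
      proof (intro equalityI subsetI)
        fix a assume "a \<in> {..<m (blk r)}"
        then have "(blk r, a) \<in> I" using blk[OF that] by (simp add: I_def)
        then obtain c where "c < N" "e c = (blk r, a)" using e by (metis bij_betw_imp_surj_on imageE lessThan_iff)
        then show "a \<in> (\<lambda>c. snd (e c)) ` {c. c < N \<and> blk c = blk r}" by (intro image_eqI[of _ _ c]) (auto simp: blk_def)
      next
        fix a assume "a \<in> (\<lambda>c. snd (e c)) ` {c. c < N \<and> blk c = blk r}"
        then obtain c where "c < N" "blk c = blk r" "a = snd (e c)" by auto
        then show "a \<in> {..<m (blk r)}" using snd_lt[of c] by simp
      qed
    qed
    from bij_betw_same_card[OF this] show ?thesis by simp
  qed
  have "matrix_units d \<A> N blk K f"
    unfolding matrix_units_def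
  proof (intro conjI)
    show "\<forall>X\<in>\<A>. \<forall>i<d. \<forall>j<d. X $$ (i, j) =
        (\<Sum>r<N. \<Sum>c<N. sesq d (\<lambda>i j. X $$ (i, j)) (f r) (f c) * K r c $$ (i, j))"
      using expand by blast
    show "\<forall>r<N. \<forall>c<N. mat_adjoint (K r c) = K c r"
      by (auto simp: K_def unit_adjoint intro!: eq_matI)
    show "\<forall>r<N. \<forall>c<N. \<forall>t<N. blk r = blk c \<longrightarrow> blk c = blk t \<longrightarrow> K r c * K c t = K r t"
    proof (intro allI impI)
      fix r c t assume "r < N" "c < N" "t < N" "blk r = blk c" "blk c = blk t"
      then show "K r c * K c t = K r t" using snd_lt[of c] by (simp add: K_def unit_mult)
    qed
  qed (use on unit_carrier in \<open>auto simp: K_def\<close>)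
  then show ?thesis using blk card N_def by blast
qed

end

section \<open>Operator norm and invariant Hamiltonians\<close>

lemma matrix_units_if_block_dims:
  assumes "\<V> \<subseteq> carrier (unitary_group d)" "has_block_dims (commutant d \<V>) k m"
  shows "\<exists>N blk K f. matrix_units d (commutant d \<V>) N blk K f \<and> N = (\<Sum>i = 1..k. m i) \<and>
     (\<forall>r<N. blk r \<in> {1..k} \<and> card {c. c < N \<and> blk c = blk r} = m (blk r))"
proof -
  obtain \<phi> where "block_iso d \<V> k m \<phi>"
    using assms unfolding has_block_dims_def block_iso_def block_iso_axioms_def unitary_commutant_def by blast
  then show ?thesis by (rule block_iso.matrix_units_exist)
qed

lemma ip_Cauchy_Schwarz: "cmod (ip n x y) \<le> sqrt (Re (ip n x x)) * sqrt (Re (ip n y y))"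
proof -
  have "cmod (ip n x y) \<le> (\<Sum>r<n. \<bar>cmod (x r)\<bar> * \<bar>cmod (y r)\<bar>)"
    unfolding ip_def by (rule order_trans[OF norm_sum]) (simp add: norm_mult)
  then have "(cmod (ip n x y))\<^sup>2 \<le> (\<Sum>r<n. \<bar>cmod (x r)\<bar> * \<bar>cmod (y r)\<bar>)\<^sup>2" by (intro power_mono) auto
  also have "\<dots> \<le> (\<Sum>r<n. (cmod (x r))\<^sup>2) * (\<Sum>r<n. (cmod (y r))\<^sup>2)" by (rule Cauchy_Schwarz_sum)
  finally have "cmod (ip n x y) \<le> sqrt ((\<Sum>r<n. (cmod (x r))\<^sup>2) * (\<Sum>r<n. (cmod (y r))\<^sup>2))"
    by (rule real_le_rsqrt)
  then show ?thesis by (simp add: ip_self real_sqrt_mult)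
qed

lemma vec_norm2_vec: "vec_norm2 (vec n x) = sqrt (Re (ip n x x))"
proof -
  have "vec n x \<bullet>c vec n x = ip n x x"
    by (simp add: scalar_prod_def ip_def lessThan_atLeast0 mult.commute)
  then show ?thesis by (simp add: vec_norm2_def)
qed

lemma mult_mat_vec_fun:
  assumes "M \<in> carrier_mat n n"
  shows "M *\<^sub>v vec n x = vec n (\<lambda>r. \<Sum>s<n. M $$ (r, s) * x s)"
  using assms by (intro eq_vecI) (auto simp: scalar_prod_def lessThan_atLeast0)

text \<open>\<open>op_norm\<close> speaks of unit vectors; other vectors are rescaled, and the zero
  vector is treated apart.\<close>

lemma vec_norm2_mult_le_op_norm:
  assumes M: "M \<in> carrier_mat n n"
  shows "vec_norm2 (M *\<^sub>v vec n x) \<le> op_norm M * vec_norm2 (vec n x)"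
proof -
  define R where "R = {vec_norm2 (M *\<^sub>v v) | v. v \<in> carrier_vec (dim_col M) \<and> vec_norm2 v = 1}"
  \<comment> \<open>A real supremum bounds its set only if the set is bounded. The coordinates of a
    unit vector have modulus at most 1, so the row sums of M bound all values.\<close>
  have bdd: "bdd_above R"
  proof (rule bdd_aboveI)
    fix t assume "t \<in> R"
    then obtain v where v: "v \<in> carrier_vec n" "vec_norm2 v = 1" "t = vec_norm2 (M *\<^sub>v v)"
      using M by (auto simp: R_def)
    define y where "y = (\<lambda>i. v $ i)"
    have vy: "v = vec n y" using v by (auto simp: y_def)
    have "Re (ip n y y) = 1" using v(2) unfolding vy vec_norm2_vec by simp
    then have "(\<Sum>r<n. (cmod (y r))\<^sup>2) = 1" by (simp add: ip_self)
    then have y1: "cmod (y s) \<le> 1" if "s < n" for s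
      using member_le_sum[of s "{..<n}" "\<lambda>r. (cmod (y r))\<^sup>2"] that by (simp add: power_le_one_iff)
    have "(\<Sum>r<n. (cmod (\<Sum>s<n. M $$ (r, s) * y s))\<^sup>2) \<le> (\<Sum>r<n. (\<Sum>s<n. cmod (M $$ (r, s)))\<^sup>2)"
      using y1 by (intro sum_mono power_mono order_trans[OF norm_sum] sum_mono)
        (auto simp: norm_mult intro: mult_left_le)
    then show "t \<le> sqrt (\<Sum>r<n. (\<Sum>s<n. cmod (M $$ (r, s)))\<^sup>2)"
      unfolding v(3) vy mult_mat_vec_fun[OF M] vec_norm2_vec by (simp add: ip_self)
  qed
  define t where "t = vec_norm2 (vec n x)"
  have t: "t = sqrt (Re (ip n x x))" by (simp add: t_def vec_norm2_vec)
  show ?thesis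
  proof (cases "t = 0")
    case True
    then have "(\<Sum>r<n. (cmod (x r))\<^sup>2) = 0" unfolding t by (simp add: ip_self)
    then have "\<forall>r\<in>{..<n}. x r = 0" by (subst (asm) sum_nonneg_eq_0_iff) auto
    then have "ip n (\<lambda>r. \<Sum>s<n. M $$ (r, s) * x s) (\<lambda>r. \<Sum>s<n. M $$ (r, s) * x s) = 0" by (simp add: ip_def)
    then show ?thesis using True unfolding mult_mat_vec_fun[OF M] vec_norm2_vec[of n "\<lambda>r. \<Sum>s<n. M $$ (r, s) * x s"] t_def by simp
  next
    case False
    moreover have "0 \<le> t" unfolding t by (simp add: ip_self sum_nonneg)
    ultimately have tpos: "0 < t" by simp
    define y where "y r = x r / complex_of_real t" for r
    have scale: "ip n (\<lambda>r. z r / complex_of_real t) (\<lambda>r. z r / complex_of_real t) = ip n z z / complex_of_real (t\<^sup>2)"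
      for z :: "nat \<Rightarrow> complex"
      by (simp add: ip_def sum_divide_distrib power2_eq_square)
    have ipx: "ip n x x = complex_of_real (t\<^sup>2)" unfolding t by (simp add: ip_self sum_nonneg)
    then have "ip n y y = 1" unfolding y_def scale using tpos by simp
    then have "vec_norm2 (vec n y) = 1" by (simp add: vec_norm2_vec)
    then have "vec_norm2 (M *\<^sub>v vec n y) \<in> R" unfolding R_def using M by (intro CollectI exI[of _ "vec n y"]) auto
    then have le: "vec_norm2 (M *\<^sub>v vec n y) \<le> op_norm M"
      unfolding op_norm_def R_def[symmetric] by (rule cSup_upper[OF _ bdd])
    have "vec_norm2 (M *\<^sub>v vec n y) = vec_norm2 (M *\<^sub>v vec n x) / t"
    proof -
      have "(\<Sum>s<n. M $$ (r, s) * y s) = (\<Sum>s<n. M $$ (r, s) * x s) / t" for r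
        by (simp add: y_def sum_divide_distrib)
      then show ?thesis unfolding mult_mat_vec_fun[OF M] vec_norm2_vec
        using tpos by (simp add: scale real_sqrt_divide)
    qed
    with le tpos show ?thesis by (simp add: t_def[symmetric] field_simps)
  qed
qed

lemma sesq_bounded_op_norm:
  assumes M: "M \<in> carrier_mat n n"
  shows "sesq_bounded n (\<lambda>i j. M $$ (i, j)) (op_norm M)"
  unfolding sesq_bounded_def
proof (intro allI)
  fix x y
  let ?z = "\<lambda>r. \<Sum>s<n. M $$ (r, s) * y s"
  have "cmod (sesq n (\<lambda>i j. M $$ (i, j)) x y) \<le> sqrt (Re (ip n x x)) * sqrt (Re (ip n ?z ?z))"
    unfolding sesq_eq_ip_right by (rule ip_Cauchy_Schwarz)
  also have "sqrt (Re (ip n ?z ?z)) \<le> op_norm M * sqrt (Re (ip n y y))"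
    using vec_norm2_mult_le_op_norm[OF M, of y] unfolding mult_mat_vec_fun[OF M] vec_norm2_vec .
  also have "sqrt (Re (ip n x x)) * (op_norm M * sqrt (Re (ip n y y)))
      = op_norm M * sqrt (Re (ip n x x)) * sqrt (Re (ip n y y))" by simp
  finally show "cmod (sesq n (\<lambda>i j. M $$ (i, j)) x y) \<le> op_norm M * sqrt (Re (ip n x x)) * sqrt (Re (ip n y y))"
    by (simp add: mult_left_mono ip_self sum_nonneg)
qed

text \<open>A positive dimension provides a unit vector; for n = 0 the supremum would be over the
  empty set.\<close>

lemma op_norm_nonneg:
  assumes M: "M \<in> carrier_mat n n" and n: "0 < n"
  shows "0 \<le> op_norm M"
proof -
  let ?x = "\<lambda>i::nat. if i = 0 then 1 else 0 :: complex"
  have "ip n ?x ?x = 1"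
  proof -
    have "ip n ?x ?x = (\<Sum>i<n. 1 * (if i = 0 then 1 else 0))" unfolding ip_def by (intro sum.cong refl) auto
    then show ?thesis unfolding sum_mult_delta using n by simp
  qed
  then have "vec_norm2 (vec n ?x) = 1" by (simp add: vec_norm2_vec)
  moreover have "0 \<le> vec_norm2 (M *\<^sub>v vec n ?x)"
    unfolding mult_mat_vec_fun[OF M] vec_norm2_vec by (simp add: ip_self sum_nonneg)
  ultimately show ?thesis using vec_norm2_mult_le_op_norm[OF M, of ?x] by simp
qed

section \<open>Expansion of an invariant Hamiltonian in products of matrix units\<close>

definition block_fst :: "nat \<Rightarrow> nat \<Rightarrow> complex mat \<Rightarrow> nat \<Rightarrow> nat \<Rightarrow> complex mat" where
  "block_fst d1 d2 H k l = mat d1 d1 (\<lambda>(i, j). H $$ (i * d2 + k, j * d2 + l))"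

definition block_snd :: "nat \<Rightarrow> nat \<Rightarrow> complex mat \<Rightarrow> nat \<Rightarrow> nat \<Rightarrow> complex mat" where
  "block_snd d1 d2 H i j = mat d2 d2 (\<lambda>(k, l). H $$ (i * d2 + k, j * d2 + l))"

text \<open>V \<otimes> 1 multiplies each block of H by V, so commutation on the product space can
  be compared block by block.\<close>

lemma block_fst_commutant:
  assumes H: "H \<in> carrier_mat (d1 * d2) (d1 * d2)" and V: "\<And>V. V \<in> \<V> \<Longrightarrow> V \<in> carrier_mat d1 d1"
    and comm: "\<And>V. V \<in> \<V> \<Longrightarrow> (V \<otimes>\<^sub>m 1\<^sub>m d2) * H = H * (V \<otimes>\<^sub>m 1\<^sub>m d2)" and kl: "k < d2" "l < d2"
  shows "block_fst d1 d2 H k l \<in> commutant d1 \<V>"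
proof -
  let ?B = "block_fst d1 d2 H k l"
  have B: "?B \<in> carrier_mat d1 d1" by (simp add: block_fst_def)
  have "?B * V = V * ?B" if "V \<in> \<V>" for V
  proof (rule eq_matI)
    note Vc = V[OF that]
    have one: "1\<^sub>m d2 \<in> carrier_mat d2 d2" by simp
    note V1 = tensor_mat_carrier[OF Vc one]
    fix i j assume "i < dim_row (V * ?B)" "j < dim_col (V * ?B)"
    then have ij: "i < d1" "j < d1" using Vc B by auto
    note p = product_index_less[OF ij(1) kl(1)] product_index_less[OF ij(2) kl(2)]
    have "(H * (V \<otimes>\<^sub>m 1\<^sub>m d2)) $$ (i * d2 + k, j * d2 + l) = (?B * V) $$ (i, j)"
    proof -
      have "(H * (V \<otimes>\<^sub>m 1\<^sub>m d2)) $$ (i * d2 + k, j * d2 + l)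
        = (\<Sum>t<d1. \<Sum>u<d2. (H $$ (i * d2 + k, t * d2 + u) * V $$ (t, j)) * (if u = l then 1 else 0))"
        unfolding mult_mat_index[OF H V1 p] sum_product_index using ij kl
        by (intro sum.cong refl) (simp add: tensor_mat_index'[OF Vc one])
      also have "\<dots> = (\<Sum>t<d1. ?B $$ (i, t) * V $$ (t, j))"
        unfolding sum_mult_delta using ij kl by (simp add: block_fst_def)
      finally show ?thesis unfolding mult_mat_index[OF B Vc ij] .
    qed
    moreover have "((V \<otimes>\<^sub>m 1\<^sub>m d2) * H) $$ (i * d2 + k, j * d2 + l) = (V * ?B) $$ (i, j)"
    proof -
      have "((V \<otimes>\<^sub>m 1\<^sub>m d2) * H) $$ (i * d2 + k, j * d2 + l)
        = (\<Sum>t<d1. \<Sum>u<d2. (V $$ (i, t) * H $$ (t * d2 + u, j * d2 + l)) * (if u = k then 1 else 0))"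
        unfolding mult_mat_index[OF V1 H p] sum_product_index using ij kl
        by (intro sum.cong refl) (auto simp: tensor_mat_index'[OF Vc one])
      also have "\<dots> = (\<Sum>t<d1. V $$ (i, t) * ?B $$ (t, j))"
        unfolding sum_mult_delta using ij kl by (simp add: block_fst_def)
      finally show ?thesis unfolding mult_mat_index[OF Vc B ij] .
    qed
    ultimately show "(?B * V) $$ (i, j) = (V * ?B) $$ (i, j)" using comm[OF that] by simp
  qed (use V[OF that] B in auto)
  with B show ?thesis by (simp add: commutant_def)
qed

lemma block_snd_commutant:
  assumes H: "H \<in> carrier_mat (d1 * d2) (d1 * d2)" and V: "\<And>V. V \<in> \<V> \<Longrightarrow> V \<in> carrier_mat d2 d2"
    and comm: "\<And>V. V \<in> \<V> \<Longrightarrow> (1\<^sub>m d1 \<otimes>\<^sub>m V) * H = H * (1\<^sub>m d1 \<otimes>\<^sub>m V)" and ij: "i < d1" "j < d1"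
  shows "block_snd d1 d2 H i j \<in> commutant d2 \<V>"
proof -
  let ?B = "block_snd d1 d2 H i j"
  have B: "?B \<in> carrier_mat d2 d2" by (simp add: block_snd_def)
  have "?B * V = V * ?B" if "V \<in> \<V>" for V
  proof (rule eq_matI)
    note Vc = V[OF that]
    have one: "1\<^sub>m d1 \<in> carrier_mat d1 d1" by simp
    note V1 = tensor_mat_carrier[OF one Vc]
    fix k l assume "k < dim_row (V * ?B)" "l < dim_col (V * ?B)"
    then have kl: "k < d2" "l < d2" using Vc B by auto
    note p = product_index_less[OF ij(1) kl(1)] product_index_less[OF ij(2) kl(2)]
    have "(H * (1\<^sub>m d1 \<otimes>\<^sub>m V)) $$ (i * d2 + k, j * d2 + l) = (?B * V) $$ (k, l)"
    proof -
      have "(H * (1\<^sub>m d1 \<otimes>\<^sub>m V)) $$ (i * d2 + k, j * d2 + l)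
        = (\<Sum>t<d1. (\<Sum>u<d2. H $$ (i * d2 + k, t * d2 + u) * V $$ (u, l)) * (if t = j then 1 else 0))"
        unfolding mult_mat_index[OF H V1 p] sum_product_index using ij kl
        by (intro sum.cong refl) (simp add: tensor_mat_index'[OF one Vc])
      also have "\<dots> = (\<Sum>u<d2. ?B $$ (k, u) * V $$ (u, l))"
        unfolding sum_mult_delta using ij kl by (simp add: block_snd_def)
      finally show ?thesis unfolding mult_mat_index[OF B Vc kl] .
    qed
    moreover have "((1\<^sub>m d1 \<otimes>\<^sub>m V) * H) $$ (i * d2 + k, j * d2 + l) = (V * ?B) $$ (k, l)"
    proof -
      have "((1\<^sub>m d1 \<otimes>\<^sub>m V) * H) $$ (i * d2 + k, j * d2 + l)
        = (\<Sum>t<d1. (\<Sum>u<d2. V $$ (k, u) * H $$ (t * d2 + u, j * d2 + l)) * (if t = i then 1 else 0))"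
        unfolding mult_mat_index[OF V1 H p] sum_product_index using ij kl
        by (intro sum.cong refl) (auto simp: tensor_mat_index'[OF one Vc])
      also have "\<dots> = (\<Sum>u<d2. V $$ (k, u) * ?B $$ (u, l))"
        unfolding sum_mult_delta using ij kl by (simp add: block_snd_def)
      finally show ?thesis unfolding mult_mat_index[OF Vc B kl] .
    qed
    ultimately show "(?B * V) $$ (k, l) = (V * ?B) $$ (k, l)" using comm[OF that] by simp
  qed (use V[OF that] B in auto)
  with B show ?thesis by (simp add: commutant_def)
qed

lemma unitary_conjugation_commute:
  fixes U H :: "complex mat"
  assumes U: "U \<in> carrier_mat n n" and H: "H \<in> carrier_mat n n" and u: "mat_adjoint U * U = 1\<^sub>m n"
    and inv: "U * H * mat_adjoint U = H"
  shows "U * H = H * U"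
proof -
  have "H * U = U * H * mat_adjoint U * U" using inv by simp
  also have "\<dots> = U * H * (mat_adjoint U * U)"
    by (rule assoc_mult_mat[OF mult_carrier_mat[OF U H] mat_adjoint_carrier[OF U] U])
  also have "\<dots> = U * H" unfolding u using U H by (simp add: right_mult_one_mat[OF mult_carrier_mat[OF U H]])
  finally show ?thesis ..
qed

text \<open>The matrix element of H between \<open>f r\<close> \<otimes> \<open>g a\<close> and
  \<open>f c\<close> \<otimes> \<open>g b\<close>. For fixed a, b it is a matrix on the side of A
  alone.\<close>

definition compressed_block ::
  "nat \<Rightarrow> nat \<Rightarrow> complex mat \<Rightarrow> (nat \<Rightarrow> nat \<Rightarrow> complex) \<Rightarrow> (nat \<Rightarrow> nat \<Rightarrow> complex) \<Rightarrow> nat \<Rightarrow> nat \<Rightarrow> nat \<Rightarrow> nat \<Rightarrow> complex"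
  where
  "compressed_block d1 d2 H f g a b r c = (\<Sum>k<d2. \<Sum>l<d2. cnj (g a k) * g b l *
     sesq d1 (\<lambda>i j. H $$ (i * d2 + k, j * d2 + l)) (f r) (f c))"

text \<open>The blocks of H in either factor lie in the respective algebra, so \<open>g\<close>
  extracts its coefficients on the second factor and \<open>f\<close> those on the first. In this
  sense H belongs to the product of the two algebras.\<close>

lemma compressed_block_expand:
  assumes A: "matrix_units d1 \<A> NA blkA KA f" and B: "matrix_units d2 \<B> NB blkB KB g"
    and HA: "\<And>k l. k < d2 \<Longrightarrow> l < d2 \<Longrightarrow> block_fst d1 d2 H k l \<in> \<A>"
    and HB: "\<And>i j. i < d1 \<Longrightarrow> j < d1 \<Longrightarrow> block_snd d1 d2 H i j \<in> \<B>"
    and ix: "i < d1" "j < d1" "k < d2" "l < d2"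
  shows "H $$ (i * d2 + k, j * d2 + l) = (\<Sum>a<NB. \<Sum>b<NB.
      (\<Sum>r<NA. \<Sum>c<NA. compressed_block d1 d2 H f g a b r c * KA r c $$ (i, j)) * KB a b $$ (k, l))"
proof -
  have entA: "H $$ (i * d2 + k', j * d2 + l') = (\<Sum>r<NA. \<Sum>c<NA.
      sesq d1 (\<lambda>i j. H $$ (i * d2 + k', j * d2 + l')) (f r) (f c) * KA r c $$ (i, j))"
    if "k' < d2" "l' < d2" for k' l'
  proof -
    have "block_fst d1 d2 H k' l' $$ (i, j) = (\<Sum>r<NA. \<Sum>c<NA.
        sesq d1 (\<lambda>i j. block_fst d1 d2 H k' l' $$ (i, j)) (f r) (f c) * KA r c $$ (i, j))"
      using A HA[OF that] ix unfolding matrix_units_def by blast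
    moreover have "sesq d1 (\<lambda>i j. block_fst d1 d2 H k' l' $$ (i, j)) x y
        = sesq d1 (\<lambda>i j. H $$ (i * d2 + k', j * d2 + l')) x y" for x y
      unfolding sesq_def by (intro sum.cong refl) (simp add: block_fst_def)
    ultimately show ?thesis using ix by (simp add: block_fst_def)
  qed
  have "block_snd d1 d2 H i j $$ (k, l) = (\<Sum>a<NB. \<Sum>b<NB.
      sesq d2 (\<lambda>k l. block_snd d1 d2 H i j $$ (k, l)) (g a) (g b) * KB a b $$ (k, l))"
    using B HB ix unfolding matrix_units_def by blast
  moreover have "sesq d2 (\<lambda>k l. block_snd d1 d2 H i j $$ (k, l)) (g a) (g b)
      = (\<Sum>r<NA. \<Sum>c<NA. compressed_block d1 d2 H f g a b r c * KA r c $$ (i, j))" for a b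
  proof -
    have "sesq d2 (\<lambda>k l. block_snd d1 d2 H i j $$ (k, l)) (g a) (g b)
        = (\<Sum>k<d2. \<Sum>l<d2. cnj (g a k) * H $$ (i * d2 + k, j * d2 + l) * g b l)"
      unfolding sesq_def by (intro sum.cong refl) (simp add: block_snd_def)
    also have "\<dots> = (\<Sum>k<d2. \<Sum>l<d2. \<Sum>r<NA. \<Sum>c<NA. cnj (g a k) * g b l *
        sesq d1 (\<lambda>i j. H $$ (i * d2 + k, j * d2 + l)) (f r) (f c) * KA r c $$ (i, j))"
      by (intro sum.cong refl, subst entA) (simp_all add: sum_distrib_left sum_distrib_right mult_ac)
    also have "\<dots> = (\<Sum>r<NA. \<Sum>k<d2. \<Sum>l<d2. \<Sum>c<NA. cnj (g a k) * g b l *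
        sesq d1 (\<lambda>i j. H $$ (i * d2 + k, j * d2 + l)) (f r) (f c) * KA r c $$ (i, j))"
      by (rule sum_rotate3)
    also have "\<dots> = (\<Sum>r<NA. \<Sum>c<NA. \<Sum>k<d2. \<Sum>l<d2. cnj (g a k) * g b l *
        sesq d1 (\<lambda>i j. H $$ (i * d2 + k, j * d2 + l)) (f r) (f c) * KA r c $$ (i, j))"
      by (rule sum.cong[OF refl], rule sum_rotate3)
    finally show ?thesis by (simp add: compressed_block_def sum_distrib_right)
  qed
  ultimately show ?thesis using ix by (simp add: block_snd_def)
qed

text \<open>For fixed a and b this matrix is a corner of H: tensoring with a unit vector
  \<open>g a\<close> or \<open>g b\<close> embeds the combinations of the \<open>f\<close>
  isometrically, so the norm cannot exceed that of H.\<close>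

lemma compressed_block_bounded:
  assumes H: "H \<in> carrier_mat (d1 * d2) (d1 * d2)"
    and f: "orthonormal_system d1 NA f" and g: "orthonormal_system d2 NB g" and ab: "a < NB" "b < NB"
  shows "sesq_bounded NA (compressed_block d1 d2 H f g a b) (op_norm H)"
  unfolding sesq_bounded_def
proof (intro allI)
  fix x y
  define X where "X x = (\<lambda>i. \<Sum>r<NA. x r * f r i)" for x
  \<comment> \<open>The tensor product of \<open>X x\<close> and \<open>g a\<close>, with a pair of
    indices encoded in p.\<close>
  define Z where "Z x a p = X x (p div d2) * g a (p mod d2)" for x a p
  have norm: "ip (d1 * d2) (Z x a) (Z x a) = ip NA x x" if "a < NB" for x a
  proof -
    have "ip (d1 * d2) (Z x a) (Z x a) = ip d1 (X x) (X x) * ip d2 (g a) (g a)"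
      unfolding ip_def sum_product_index sum_product by (intro sum.cong refl) (simp add: Z_def mult_ac)
    then show ?thesis
      unfolding X_def ip_combination_self[OF f] using ip_orthonormal[OF g that that] by (simp add: ip_def)
  qed
  have "sesq (d1 * d2) (\<lambda>p q. H $$ (p, q)) (Z x a) (Z y b)
      = (\<Sum>i<d1. \<Sum>k<d2. \<Sum>j<d1. \<Sum>l<d2. cnj (g a k) * g b l * (cnj (X x i) * H $$ (i * d2 + k, j * d2 + l) * X y j))"
    unfolding sesq_def sum_product_index by (intro sum.cong refl) (simp add: Z_def mult_ac)
  also have "\<dots> = (\<Sum>k<d2. \<Sum>i<d1. \<Sum>j<d1. \<Sum>l<d2. cnj (g a k) * g b l * (cnj (X x i) * H $$ (i * d2 + k, j * d2 + l) * X y j))"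
    by (rule sum.swap)
  also have "\<dots> = (\<Sum>k<d2. \<Sum>l<d2. \<Sum>i<d1. \<Sum>j<d1. cnj (g a k) * g b l * (cnj (X x i) * H $$ (i * d2 + k, j * d2 + l) * X y j))"
    by (rule sum.cong[OF refl], rule sum_rotate3)
  also have "\<dots> = (\<Sum>k<d2. \<Sum>l<d2. cnj (g a k) * g b l * sesq d1 (\<lambda>i j. H $$ (i * d2 + k, j * d2 + l)) (X x) (X y))"
    by (simp add: sesq_def sum_distrib_left)
  also have "\<dots> = (\<Sum>k<d2. \<Sum>l<d2. \<Sum>r<NA. \<Sum>c<NA. cnj (x r) * (cnj (g a k) * g b l *
      sesq d1 (\<lambda>i j. H $$ (i * d2 + k, j * d2 + l)) (f r) (f c)) * y c)"
    unfolding X_def sesq_sum_left sesq_sum_right by (simp add: sum_distrib_left mult_ac)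
  also have "\<dots> = (\<Sum>r<NA. \<Sum>k<d2. \<Sum>l<d2. \<Sum>c<NA. cnj (x r) * (cnj (g a k) * g b l *
      sesq d1 (\<lambda>i j. H $$ (i * d2 + k, j * d2 + l)) (f r) (f c)) * y c)"
    by (rule sum_rotate3)
  also have "\<dots> = (\<Sum>r<NA. \<Sum>c<NA. \<Sum>k<d2. \<Sum>l<d2. cnj (x r) * (cnj (g a k) * g b l *
      sesq d1 (\<lambda>i j. H $$ (i * d2 + k, j * d2 + l)) (f r) (f c)) * y c)"
    by (rule sum.cong[OF refl], rule sum_rotate3)
  also have "\<dots> = sesq NA (compressed_block d1 d2 H f g a b) x y"
    unfolding sesq_def[of NA] compressed_block_def sum_distrib_left sum_distrib_right ..
  finally show "cmod (sesq NA (compressed_block d1 d2 H f g a b) x y)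
      \<le> op_norm H * sqrt (Re (ip NA x x)) * sqrt (Re (ip NA y y))"
    using sesq_bounded_op_norm[OF H] norm[OF ab(1), of x] norm[OF ab(2), of y]
    unfolding sesq_bounded_def by metis
qed

section \<open>An informationally complete measurement\<close>

lemma matrix_units_entry_mult:
  assumes A: "matrix_units d \<A> N blk K f" and rct: "r < N" "c < N" "t < N" "blk r = blk c" "blk c = blk t"
    and ij: "i < d" "j < d"
  shows "(\<Sum>u<d. K r c $$ (i, u) * K c t $$ (u, j)) = K r t $$ (i, j)"
proof -
  have c: "K r c \<in> carrier_mat d d" "K c t \<in> carrier_mat d d" using A rct by (simp_all add: matrix_units_def)
  have "K r c * K c t = K r t" using A rct by (simp add: matrix_units_def)
  then have "(K r c * K c t) $$ (i, j) = K r t $$ (i, j)" by simp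
  then show ?thesis unfolding mult_mat_index[OF c ij] .
qed

lemma matrix_units_adjoint_entry:
  assumes A: "matrix_units d \<A> N blk K f" and rc: "r < N" "c < N" and ij: "i < d" "j < d"
  shows "cnj (K r c $$ (i, j)) = K c r $$ (j, i)"
proof -
  have c: "K r c \<in> carrier_mat d d" and eq: "mat_adjoint (K r c) = K c r" using A rc by (simp_all add: matrix_units_def)
  have "mat_adjoint (K r c) $$ (j, i) = cnj (K r c $$ (i, j))" using c ij by (intro mat_adjoint_index) auto
  then show ?thesis using eq by simp
qed

text \<open>By orthonormality of \<open>f\<close>, the coefficients of the identity form an identity
  matrix.\<close>

lemma matrix_units_one:
  assumes A: "matrix_units d \<A> N blk K f" and one: "1\<^sub>m d \<in> \<A>" and ij: "i < d" "j < d"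
  shows "(\<Sum>r<N. K r r $$ (i, j)) = 1\<^sub>m d $$ (i, j)"
proof -
  have "1\<^sub>m d $$ (i, j) = (\<Sum>r<N. \<Sum>c<N. sesq d (\<lambda>i j. 1\<^sub>m d $$ (i, j)) (f r) (f c) * K r c $$ (i, j))"
    using A one ij by (simp only: matrix_units_def)
  also have "\<dots> = (\<Sum>r<N. \<Sum>c<N. K r c $$ (i, j) * (if c = r then 1 else 0))"
    using A unfolding sesq_one_mat
    by (intro sum.cong refl) (auto simp: matrix_units_def ip_orthonormal)
  also have "\<dots> = (\<Sum>r<N. K r r $$ (i, j))" by (simp add: sum_mult_delta)
  finally show ?thesis ..
qed

lemma sum_same_block:
  fixes x :: complex and N :: nat
  assumes "card {c. c < N \<and> blk c = b} = m" "0 < m"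
  shows "(\<Sum>c<N. if blk c = b then x / of_nat m else 0) = x"
proof -
  have "(\<Sum>c<N. if blk c = b then x / of_nat m else 0) = (\<Sum>c\<in>{c. c < N \<and> blk c = b}. x / of_nat m)"
    by (intro sum.mono_neutral_cong_right) auto
  then show ?thesis using assms by simp
qed

text \<open>A positive functional has a positive density matrix of size N. Its form at x is a
  weighted sum of the values of \<tau> at the squares of \<open>G t\<close>, the combinations of the
  matrix units in row t. In a block of size m, every pair of indices is counted by m values of t,
  hence the weights 1 / m.\<close>

lemma psd_fun_functional:
  fixes \<tau> :: "complex mat \<Rightarrow> complex"
  assumes A: "matrix_units d \<A> N blk K f"
    and m: "\<And>r. r < N \<Longrightarrow> card {c. c < N \<and> blk c = blk r} = m (blk r)" "\<And>r. r < N \<Longrightarrow> 0 < m (blk r)"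
    and pos: "\<And>C. C \<in> carrier_mat d d \<Longrightarrow> 0 \<le> \<tau> (mat_adjoint C * C)"
    and lin: "\<And>M (c :: nat \<times> nat \<Rightarrow> complex) F. M \<in> carrier_mat d d \<Longrightarrow>
      (\<And>p. p \<in> {..<N} \<times> {..<N} \<Longrightarrow> F p \<in> carrier_mat d d) \<Longrightarrow>
      (\<And>i j. i < d \<Longrightarrow> j < d \<Longrightarrow> M $$ (i, j) = (\<Sum>p\<in>{..<N} \<times> {..<N}. c p * F p $$ (i, j))) \<Longrightarrow>
      \<tau> M = (\<Sum>p\<in>{..<N} \<times> {..<N}. c p * \<tau> (F p))"
  shows "psd_fun N (\<lambda>r c. \<tau> (K c r))"
  unfolding psd_fun_def
proof
  fix x
  have Kc: "K r c \<in> carrier_mat d d" if "r < N" "c < N" for r c using A that by (simp add: matrix_units_def)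
  define G where "G t = mat d d (\<lambda>(i, j). \<Sum>r<N. cnj (x r) * K t r $$ (i, j))" for t
  have Gc: "G t \<in> carrier_mat d d" for t by (simp add: G_def)
  define \<delta> where "\<delta> t c r = (if blk c = blk t \<and> blk r = blk t then 1 else 0 :: complex)" for t c r
  have GG: "(mat_adjoint (G t) * G t) $$ (i, j) = (\<Sum>c<N. \<Sum>r<N. \<delta> t c r * x c * cnj (x r) * K c r $$ (i, j))"
    if t: "t < N" and ij: "i < d" "j < d" for t i j
  proof -
    have KK: "(\<Sum>u<d. cnj (K t c $$ (u, i)) * K t r $$ (u, j)) = \<delta> t c r * K c r $$ (i, j)" if cr: "c < N" "r < N" for c r
    proof (cases "blk c = blk t \<and> blk r = blk t")
      case True
      have "(\<Sum>u<d. cnj (K t c $$ (u, i)) * K t r $$ (u, j)) = (\<Sum>u<d. K c t $$ (i, u) * K t r $$ (u, j))"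
        by (intro sum.cong refl) (simp only: lessThan_iff matrix_units_adjoint_entry[OF A t cr(1) _ ij(1)])
      also have "\<dots> = K c r $$ (i, j)"
        using True by (intro matrix_units_entry_mult[OF A cr(1) t cr(2) _ _ ij]) auto
      finally show ?thesis using True by (simp add: \<delta>_def)
    next
      case False
      then have "K t c = 0\<^sub>m d d \<or> K t r = 0\<^sub>m d d" using A t cr unfolding matrix_units_def by metis
      then have "(\<Sum>u<d. cnj (K t c $$ (u, i)) * K t r $$ (u, j)) = 0" using ij by auto
      moreover have "\<delta> t c r = 0" using False by (auto simp: \<delta>_def)
      ultimately show ?thesis by simp
    qed
    have "(mat_adjoint (G t) * G t) $$ (i, j) = (\<Sum>u<d. cnj (G t $$ (u, i)) * G t $$ (u, j))"
      unfolding mult_mat_index[OF mat_adjoint_carrier[OF Gc] Gc ij] using carrier_matD[OF Gc[of t]] ij by simp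
    also have "\<dots> = (\<Sum>u<d. \<Sum>c<N. \<Sum>r<N. x c * cnj (x r) * (cnj (K t c $$ (u, i)) * K t r $$ (u, j)))"
      using ij by (simp add: G_def sum_product mult_ac)
    also have "\<dots> = (\<Sum>c<N. \<Sum>r<N. \<Sum>u<d. x c * cnj (x r) * (cnj (K t c $$ (u, i)) * K t r $$ (u, j)))"
      by (rule sum_rotate3[symmetric])
    also have "\<dots> = (\<Sum>c<N. \<Sum>r<N. \<delta> t c r * x c * cnj (x r) * K c r $$ (i, j))"
      by (intro sum.cong refl) (simp add: sum_distrib_left[symmetric] KK)
    finally show ?thesis .
  qed
  have \<tau>G: "\<tau> (mat_adjoint (G t) * G t) = (\<Sum>c<N. \<Sum>r<N. \<delta> t c r * x c * cnj (x r) * \<tau> (K c r))" if t: "t < N" for t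
  proof -
    have "\<tau> (mat_adjoint (G t) * G t) = (\<Sum>p\<in>{..<N} \<times> {..<N}. (\<delta> t (fst p) (snd p) * x (fst p) * cnj (x (snd p))) * \<tau> (K (fst p) (snd p)))"
      by (rule lin[OF mult_carrier_mat[OF mat_adjoint_carrier[OF Gc] Gc]])
        (use Kc GG[OF t] in \<open>auto simp: sum.cartesian_product case_prod_unfold\<close>)
    then show ?thesis by (simp add: sum.cartesian_product case_prod_unfold)
  qed
  have zero: "\<tau> (0\<^sub>m d d) = 0"
    using lin[where M = "0\<^sub>m d d" and c = "\<lambda>_. 0" and F = "\<lambda>_. 0\<^sub>m d d"] by simp
  have "0 \<le> (\<Sum>t<N. (1 / of_nat (m (blk t))) * \<tau> (mat_adjoint (G t) * G t))"
    using pos[OF Gc] by (intro sum_nonneg mult_nonneg_nonneg) (simp_all add: less_eq_complex_def)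
  also have "\<dots> = (\<Sum>t<N. \<Sum>c<N. \<Sum>r<N. (1 / of_nat (m (blk t))) * (\<delta> t c r * x c * cnj (x r) * \<tau> (K c r)))"
    by (simp add: \<tau>G sum_distrib_left)
  also have "\<dots> = (\<Sum>c<N. \<Sum>r<N. \<Sum>t<N. (1 / of_nat (m (blk t))) * (\<delta> t c r * x c * cnj (x r) * \<tau> (K c r)))"
    by (rule sum_rotate3[symmetric])
  also have "\<dots> = (\<Sum>c<N. \<Sum>r<N. x c * cnj (x r) * \<tau> (K c r))"
  proof (rule sum.cong[OF refl], rule sum.cong[OF refl])
    fix c r assume "c \<in> {..<N}" "r \<in> {..<N}"
    then have cr: "c < N" "r < N" by auto
    show "(\<Sum>t<N. (1 / of_nat (m (blk t))) * (\<delta> t c r * x c * cnj (x r) * \<tau> (K c r))) = x c * cnj (x r) * \<tau> (K c r)"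
    proof (cases "blk c = blk r")
      case True
      have "(\<Sum>t<N. (1 / of_nat (m (blk t))) * (\<delta> t c r * x c * cnj (x r) * \<tau> (K c r)))
          = (\<Sum>t<N. if blk t = blk c then (x c * cnj (x r) * \<tau> (K c r)) / of_nat (m (blk c)) else 0)"
        using True by (intro sum.cong refl) (auto simp: \<delta>_def)
      then show ?thesis unfolding sum_same_block[OF m(1)[OF cr(1)] m(2)[OF cr(1)]] .
    next
      case False
      then have "K c r = 0\<^sub>m d d" using A cr by (simp add: matrix_units_def)
      then show ?thesis by (simp add: zero)
    qed
  qed
  also have "\<dots> = sesq N (\<lambda>r c. \<tau> (K c r)) x x"
    unfolding sesq_def by (subst sum.swap) (simp add: mult_ac)
  finally show "0 \<le> sesq N (\<lambda>r c. \<tau> (K c r)) x x" .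
qed

text \<open>
  For every block of size \<open>m\<close> and every ordered pair \<open>(a, b)\<close> of its indices, \<open>a = b\<close> included, the
  measurement has the outcomes \<open>(K\<^sub>a\<^sub>a + K\<^sub>b\<^sub>b + \<i>\<^sup>k K\<^sub>a\<^sub>b + \<i>\<^sup>-\<^sup>k K\<^sub>b\<^sub>a) / (8 m)\<close>, \<open>k < 4\<close>. Fourier inversion over \<open>k\<close>
  recovers \<open>K\<^sub>a\<^sub>b\<close> with coefficients of modulus \<open>2 m\<close>.
\<close>

definition povm_root :: "(nat \<Rightarrow> nat) \<Rightarrow> (nat \<Rightarrow> nat) \<Rightarrow> (nat \<Rightarrow> nat \<Rightarrow> complex mat) \<Rightarrow> nat \<times> nat \<times> nat \<Rightarrow> complex mat" where
  "povm_root m blk K = (\<lambda>(a, b, k). complex_of_real (1 / sqrt (8 * real (m (blk a)))) \<cdot>\<^sub>m (K a a + \<i> ^ k \<cdot>\<^sub>m K a b))"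

definition povm_outcomes :: "nat \<Rightarrow> (nat \<Rightarrow> nat) \<Rightarrow> (nat \<times> nat \<times> nat) set" where
  "povm_outcomes N blk = (SIGMA a:{..<N}. {b. b < N \<and> blk b = blk a} \<times> {..<4})"

lemma finite_povm_outcomes [simp]: "finite (povm_outcomes N blk)"
  by (simp add: povm_outcomes_def)

lemma povm_root_carrier:
  assumes "matrix_units d \<A> N blk K f" "y \<in> povm_outcomes N blk"
  shows "povm_root m blk K y \<in> carrier_mat d d"
  using assms by (auto simp: povm_outcomes_def povm_root_def matrix_units_def)

text \<open>The relations of matrix units multiply out the square; in the last term the phase meets
  its conjugate and disappears.\<close>

lemma povm_entry:
  assumes A: "matrix_units d \<A> N blk K f" and ab: "a < N" "b < N" "blk b = blk a" and m: "0 < m (blk a)"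
    and ij: "i < d" "j < d"
  shows "(mat_adjoint (povm_root m blk K (a, b, k)) * povm_root m blk K (a, b, k)) $$ (i, j)
    = (K a a $$ (i, j) + \<i> ^ k * K a b $$ (i, j) + cnj (\<i> ^ k) * K b a $$ (i, j) + K b b $$ (i, j)) / (8 * of_nat (m (blk a)))"
proof -
  define z where "z = \<i> ^ k"
  have zz: "cnj z * z = 1" unfolding z_def by (simp add: power_mult_distrib[symmetric])
  define q where "q = complex_of_real (1 / sqrt (8 * real (m (blk a))))"
  have qq: "cnj q * q = 1 / (8 * of_nat (m (blk a)))"
  proof -
    have "cnj q * q = complex_of_real (1 / sqrt (8 * real (m (blk a))) * (1 / sqrt (8 * real (m (blk a)))))"
      unfolding q_def by (simp only: complex_cnj_complex_of_real of_real_mult)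
    also have "1 / sqrt (8 * real (m (blk a))) * (1 / sqrt (8 * real (m (blk a)))) = 1 / (8 * real (m (blk a)))"
      by simp
    finally show ?thesis by simp
  qed
  let ?C = "povm_root m blk K (a, b, k)"
  have C: "?C \<in> carrier_mat d d" and Kc: "K a a \<in> carrier_mat d d" "K a b \<in> carrier_mat d d"
    using A ab by (simp_all add: povm_root_def matrix_units_def)
  have ent: "?C $$ (u, j) = q * (K a a $$ (u, j) + z * K a b $$ (u, j))" if "u < d" "j < d" for u j
    using that carrier_matD[OF Kc(1)] carrier_matD[OF Kc(2)] by (simp add: povm_root_def q_def z_def)
  note adj = matrix_units_adjoint_entry[OF A ab(1) _ _ ij(1)]
  note prod = matrix_units_entry_mult[OF A _ _ _ _ _ ij]
  have "(mat_adjoint ?C * ?C) $$ (i, j) = (\<Sum>u<d. cnj (?C $$ (u, i)) * ?C $$ (u, j))"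
    unfolding mult_mat_index[OF mat_adjoint_carrier[OF C] C ij] using carrier_matD[OF C] ij by simp
  also have "\<dots> = (\<Sum>u<d. (cnj q * q) * (K a a $$ (i, u) * K a a $$ (u, j) + z * (K a a $$ (i, u) * K a b $$ (u, j))
      + cnj z * (K b a $$ (i, u) * K a a $$ (u, j)) + (cnj z * z) * (K b a $$ (i, u) * K a b $$ (u, j))))"
    using ij adj[OF ab(1)] adj[OF ab(2)]
    by (intro sum.cong refl) (simp add: ent algebra_simps)
  also have "\<dots> = (cnj q * q) * (K a a $$ (i, j) + z * K a b $$ (i, j) + cnj z * K b a $$ (i, j) + (cnj z * z) * K b b $$ (i, j))"
    unfolding sum_distrib_left[symmetric] sum.distrib
    by (simp only: sum_distrib_left[symmetric] prod[OF ab(1,1,1)] prod[OF ab(1,1,2)] prod[OF ab(2,1,1)] prod[OF ab(2,1,2)] ab(3) refl)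
  finally show ?thesis unfolding qq zz by (simp add: z_def)
qed

text \<open>Multiplying by the conjugate phase and summing over k keeps the term with
  \<open>K a b\<close> four times. The other terms carry a sum of all fourth roots of unity or of
  their squares, both 0. The factor 4 against the normalisation 8 m leaves the coefficient 2
  m.\<close>

lemma povm_reconstruct:
  assumes A: "matrix_units d \<A> N blk K f" and ab: "a < N" "b < N" "blk b = blk a" and m: "0 < m (blk a)"
    and ij: "i < d" "j < d"
  shows "K a b $$ (i, j) = (\<Sum>k<4. (2 * of_nat (m (blk a)) * cnj (\<i> ^ k)) *
    (mat_adjoint (povm_root m blk K (a, b, k)) * povm_root m blk K (a, b, k)) $$ (i, j))"
  unfolding povm_entry[where m = m, OF assms] using m
  by (simp add: eval_nat_numeral field_simps)

text \<open>The sum over k removes the phases and leaves (K a a + K b b) / (2 m). Each diagonal unit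
  has m partners in each of the two positions of a pair; the normalisation 8 m is chosen to make
  this exactly 1.\<close>

lemma povm_total:
  assumes A: "matrix_units d \<A> N blk K f" and one: "1\<^sub>m d \<in> \<A>"
    and m: "\<And>r. r < N \<Longrightarrow> card {c. c < N \<and> blk c = blk r} = m (blk r)" "\<And>r. r < N \<Longrightarrow> 0 < m (blk r)"
    and ij: "i < d" "j < d"
  shows "(\<Sum>y\<in>povm_outcomes N blk. (mat_adjoint (povm_root m blk K y) * povm_root m blk K y) $$ (i, j)) = 1\<^sub>m d $$ (i, j)"
proof -
  let ?M = "\<lambda>y. (mat_adjoint (povm_root m blk K y) * povm_root m blk K y) $$ (i, j)"
  have k4: "(\<Sum>k<4. ?M (a, b, k)) = K a a $$ (i, j) / 2 / of_nat (m (blk a)) + K b b $$ (i, j) / 2 / of_nat (m (blk b))"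
    if ab: "a < N" "b < N" "blk b = blk a" for a b
    using m(2)[OF ab(1)] ab(3) unfolding povm_entry[where m = m, OF A ab m(2)[OF ab(1)] ij]
    by (simp add: eval_nat_numeral field_simps)
  have "(\<Sum>y\<in>povm_outcomes N blk. ?M y) = (\<Sum>a<N. \<Sum>b\<in>{b. b < N \<and> blk b = blk a}. \<Sum>k<4. ?M (a, b, k))"
    unfolding povm_outcomes_def by (simp add: sum.Sigma sum.cartesian_product case_prod_unfold)
  also have "\<dots> = (\<Sum>a<N. \<Sum>b<N. (if blk b = blk a then K a a $$ (i, j) / 2 / of_nat (m (blk a)) else 0)
      + (if blk a = blk b then K b b $$ (i, j) / 2 / of_nat (m (blk b)) else 0))"
  proof (rule sum.cong[OF refl])
    fix a assume "a \<in> {..<N}"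
    then show "(\<Sum>b\<in>{b. b < N \<and> blk b = blk a}. \<Sum>k<4. ?M (a, b, k))
      = (\<Sum>b<N. (if blk b = blk a then K a a $$ (i, j) / 2 / of_nat (m (blk a)) else 0)
        + (if blk a = blk b then K b b $$ (i, j) / 2 / of_nat (m (blk b)) else 0))"
      by (intro sum.mono_neutral_cong_left) (auto simp: k4)
  qed
  also have "\<dots> = (\<Sum>a<N. \<Sum>b<N. if blk b = blk a then K a a $$ (i, j) / 2 / of_nat (m (blk a)) else 0)
      + (\<Sum>b<N. \<Sum>a<N. if blk a = blk b then K b b $$ (i, j) / 2 / of_nat (m (blk b)) else 0)"
    unfolding sum.distrib by (rule arg_cong2[where f = "(+)", OF refl sum.swap])
  also have "\<dots> = (\<Sum>a<N. K a a $$ (i, j) / 2) + (\<Sum>b<N. K b b $$ (i, j) / 2)"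
    using m by (simp add: sum_same_block)
  also have "\<dots> = 1\<^sub>m d $$ (i, j)"
    unfolding matrix_units_one[OF A one ij, symmetric] by (simp add: sum.distrib[symmetric])
  finally show ?thesis .
qed

section \<open>Measuring a symmetric extension\<close>

lemma tr_smult_mult:
  assumes "A \<in> carrier_mat m m" "B \<in> carrier_mat m m"
  shows "tr (c \<cdot>\<^sub>m A * B) = c * tr (A * B)"
  using assms by (simp add: tr_mult[of _ m m] sum_distrib_left mult.assoc del: mult_smult_assoc_mat)

lemma smult_one_div: "p \<noteq> 0 \<Longrightarrow> complex_of_real (1 / p) \<cdot>\<^sub>m (complex_of_real p \<cdot>\<^sub>m X) = X"
  by (intro eq_matI) auto

locale symmetric_extension =
  fixes dA d n :: nat and \<rho> :: "complex mat"
  assumes n: "1 \<le> n" and state: "\<rho> \<in> states (dA * d ^ n)"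
    and perm: "\<And>\<sigma>. \<sigma> permutes {..<n} \<Longrightarrow>
      \<rho> * (1\<^sub>m dA \<otimes>\<^sub>m perm_op d n \<sigma>) = (1\<^sub>m dA \<otimes>\<^sub>m perm_op d n \<sigma>) * \<rho>"
begin

lemma pos: "positive_mat (dA * d ^ n) \<rho>" and tr_one: "tr \<rho> = 1"
  using state by (simp_all add: states_def)

lemma carrier: "\<rho> \<in> carrier_mat (dA * d ^ n) (dA * d ^ n)"
  using pos by (simp add: positive_mat_def hermitian_mat_def)

text \<open>Groupings of the same space: the last B-factor is split off for its constraint and its
  conditional state, A with the first B-factor for the objective.\<close>

lemma split_last: "d ^ n = d ^ (n - 1) * d" "dA * d ^ n = dA * d ^ (n - 1) * d" "dA * d ^ n = dA * d * d ^ (n - 1)"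
  using n by (cases n; simp add: mult_ac)+

abbreviation "T \<equiv> tfun \<rho>"

lemma T_square:
  assumes C: "C \<in> carrier_mat dA dA" and Ds: "set Ds \<subseteq> carrier_mat d d" "length Ds = n"
  shows "0 \<le> T (mat_adjoint C * C) (map (\<lambda>D. mat_adjoint D * D) Ds)"
  unfolding tfun_def tprod_square[OF Ds(1)] tensor_square[OF C tprod_carrier[OF Ds]]
  by (rule positive_mat_square[OF pos tensor_mat_carrier[OF C tprod_carrier[OF Ds]]])

lemma T_one: "T (1\<^sub>m dA) (replicate n (1\<^sub>m d)) = 1"
  using carrier by (simp add: tfun_def tprod_one tensor_mat_one tr_one)

lemmas T_mset_cong = tfun_mset_cong[OF carrier _ perm]

end

text \<open>The measurement is given by roots of its operators, so that products of outcomes on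
  several factors are again squares and have nonnegative expectation.\<close>

locale measured_extension = symmetric_extension +
  fixes Y :: "'y set" and root :: "'y \<Rightarrow> complex mat"
  assumes finite_Y: "finite Y" and root: "\<And>y. y \<in> Y \<Longrightarrow> root y \<in> carrier_mat d d"
    and total: "\<And>i j. i < d \<Longrightarrow> j < d \<Longrightarrow> 1\<^sub>m d $$ (i, j) = (\<Sum>y\<in>Y. (mat_adjoint (root y) * root y) $$ (i, j))"
begin

definition M :: "'y \<Rightarrow> complex mat" where
  "M y = mat_adjoint (root y) * root y"

text \<open>The record occupies the first factors; identities stand on the factors not yet
  measured.\<close>

definition obs :: "'y list \<Rightarrow> complex mat list" where
  "obs zs = map M zs @ replicate (n - length zs) (1\<^sub>m d)"

definition obs_root :: "'y list \<Rightarrow> complex mat list" where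
  "obs_root zs = map root zs @ replicate (n - length zs) (1\<^sub>m d)"

definition prob :: "'y list \<Rightarrow> real" where
  "prob zs = Re (T (1\<^sub>m dA) (obs zs))"

lemma M_carrier: "y \<in> Y \<Longrightarrow> M y \<in> carrier_mat d d"
  unfolding M_def using mult_carrier_mat[OF mat_adjoint_carrier[OF root] root] by blast

lemma words_carrier:
  assumes "zs \<in> words Y k"
  shows "set (map M zs) \<subseteq> carrier_mat d d" "set (map root zs) \<subseteq> carrier_mat d d" "length zs = k"
  using assms M_carrier root by (auto simp: words_def)

lemma obs_carrier:
  assumes "zs \<in> words Y k" "k \<le> n"
  shows "set (obs zs) \<subseteq> carrier_mat d d" "length (obs zs) = n"
  using words_carrier[OF assms(1)] assms(2) by (auto simp: obs_def)

lemma obs_root_carrier: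
  assumes "zs \<in> words Y k" "k \<le> n"
  shows "set (obs_root zs) \<subseteq> carrier_mat d d" "length (obs_root zs) = n"
  using words_carrier[OF assms(1)] assms(2) by (auto simp: obs_root_def)

lemma obs_eq_squares: "obs zs = map (\<lambda>D. mat_adjoint D * D) (obs_root zs)"
  by (simp add: obs_def obs_root_def M_def mat_adjoint_one)

lemma T_obs_nonneg:
  assumes "zs \<in> words Y k" "k \<le> n" "C \<in> carrier_mat dA dA"
  shows "0 \<le> T (mat_adjoint C * C) (obs zs)"
  unfolding obs_eq_squares by (rule T_square[OF assms(3) obs_root_carrier[OF assms(1,2)]])

lemma T_one_obs:
  assumes "zs \<in> words Y k" "k \<le> n"
  shows "T (1\<^sub>m dA) (obs zs) = complex_of_real (prob zs)" "0 \<le> prob zs"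
proof -
  have "mat_adjoint (1\<^sub>m dA) * 1\<^sub>m dA = (1\<^sub>m dA :: complex mat)" by simp
  then have "0 \<le> T (1\<^sub>m dA) (obs zs)" using T_obs_nonneg[OF assms one_carrier_mat] by simp
  then show "T (1\<^sub>m dA) (obs zs) = complex_of_real (prob zs)" "0 \<le> prob zs"
    by (simp_all add: prob_def less_eq_complex_def complex_eq_iff)
qed

lemma T_total:
  assumes X: "X \<in> carrier_mat dA dA"
    and AB: "set As \<subseteq> carrier_mat d d" "set Bs \<subseteq> carrier_mat d d" "length As + 1 + length Bs = n"
  shows "T X (As @ 1\<^sub>m d # Bs) = (\<Sum>y\<in>Y. T X (As @ M y # Bs))"
proof -
  have "T X (As @ 1\<^sub>m d # Bs) = (\<Sum>y\<in>Y. 1 * T X (As @ M y # Bs))"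
    by (rule tfun_linear_right[OF carrier X AB one_carrier_mat M_carrier]) (use total in \<open>auto simp: M_def\<close>)
  then show ?thesis by simp
qed

lemma obs_snoc:
  assumes "length zs < n"
  shows "obs zs = map M zs @ 1\<^sub>m d # replicate (n - 1 - length zs) (1\<^sub>m d)"
    "obs (zs @ [y]) = map M zs @ M y # replicate (n - 1 - length zs) (1\<^sub>m d)"
proof -
  obtain l where "n - length zs = Suc l" using assms by (metis Suc_diff_Suc)
  then show "obs zs = map M zs @ 1\<^sub>m d # replicate (n - 1 - length zs) (1\<^sub>m d)"
    "obs (zs @ [y]) = map M zs @ M y # replicate (n - 1 - length zs) (1\<^sub>m d)"
    by (simp_all add: obs_def diff_right_commute)
qed

lemma T_obs_split:
  assumes X: "X \<in> carrier_mat dA dA" and zs: "zs \<in> words Y k" "k < n"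
  shows "T X (obs zs) = (\<Sum>y\<in>Y. T X (obs (zs @ [y])))"
proof -
  have len: "length zs < n" using zs by (simp add: words_def)
  show ?thesis unfolding obs_snoc[OF len] using len
    by (intro T_total[OF X words_carrier(1)[OF zs(1)]]) auto
qed

text \<open>The objective concerns the first B-factor, while the chain bound speaks of the outcome
  after a record of length k. By symmetry \<open>M y\<close> moves to factor k + 1, and the
  identities that take its place in front are resolved into outcomes.\<close>

lemma T_first_eq_sum:
  assumes X: "X \<in> carrier_mat dA dA" and y: "y \<in> Y" and k: "k < n"
  shows "T X (M y # replicate (n - 1) (1\<^sub>m d)) = (\<Sum>zs\<in>words Y k. T X (obs (zs @ [y])))"
  using k
proof (induction k)
  case 0
  then show ?case using obs_snoc(2)[of "[]" y] by simp
next
  case (Suc k)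
  have "T X (obs (zs @ [y])) = (\<Sum>y'\<in>Y. T X (obs ((zs @ [y']) @ [y])))" if zs: "zs \<in> words Y k" for zs
  proof -
    note len = words_carrier(3)[OF zs] and Mzs = words_carrier(1)[OF zs]
    obtain l where l: "n - 1 - k = Suc l" "n - 1 - Suc k = l" using Suc.prems by (metis Suc_diff_Suc Suc_lessE diff_Suc_1 diff_diff_left plus_1_eq_Suc)
    have Bs: "set (M y # replicate l (1\<^sub>m d)) \<subseteq> carrier_mat d d" using M_carrier[OF y] by auto
    \<comment> \<open>Exchanges \<open>M y\<close> with the identity behind it, which makes room for
      one more outcome of the record.\<close>
    have "T X (obs (zs @ [y])) = T X (map M zs @ 1\<^sub>m d # M y # replicate l (1\<^sub>m d))"
      unfolding obs_snoc(2)[of zs, unfolded len, OF Suc_lessD[OF Suc.prems]] l(1)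
    proof (rule T_mset_cong[OF X])
      show "set (map M zs @ M y # replicate (Suc l) (1\<^sub>m d)) \<subseteq> carrier_mat d d" using Mzs M_carrier[OF y] by auto
      show "length (map M zs @ M y # replicate (Suc l) (1\<^sub>m d)) = n" using len l Suc.prems by simp
    qed simp_all
    also have "\<dots> = (\<Sum>y'\<in>Y. T X (map M zs @ M y' # M y # replicate l (1\<^sub>m d)))"
      by (rule T_total[OF X Mzs Bs]) (use len l Suc.prems in auto)
    also have "\<dots> = (\<Sum>y'\<in>Y. T X (obs ((zs @ [y']) @ [y])))"
    proof (rule sum.cong[OF refl])
      fix y'
      have "length (zs @ [y']) < n" using len Suc.prems by simp
      from obs_snoc(2)[OF this, of y] show "T X (map M zs @ M y' # M y # replicate l (1\<^sub>m d)) = T X (obs ((zs @ [y']) @ [y]))"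
        using len l by simp
    qed
    finally show ?thesis .
  qed
  then show ?case using Suc by (simp add: sum_words_Suc[OF finite_Y])
qed

lemma tprod_obs_carrier:
  assumes "zs \<in> words Y k" "k \<le> n"
  shows "tprod (obs zs) \<in> carrier_mat (d ^ n) (d ^ n)"
  by (rule tprod_carrier[OF obs_carrier[OF assms]])

section \<open>Conditional states of A and of the last B-factor\<close>

definition cond_A :: "'y list \<Rightarrow> complex mat" where
  "cond_A zs = complex_of_real (1 / prob zs) \<cdot>\<^sub>m reduce_fst dA (d ^ n) \<rho> (tprod (obs zs))"

text \<open>As \<open>obs\<close>, but one factor shorter: the last B-factor is left free for the
  conditional state.\<close>

definition obs' :: "'y list \<Rightarrow> complex mat list" where
  "obs' zs = map M zs @ replicate (n - 1 - length zs) (1\<^sub>m d)"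

definition cond_B :: "'y list \<Rightarrow> complex mat" where
  "cond_B zs = complex_of_real (1 / prob zs) \<cdot>\<^sub>m
     reduce_snd (dA * d ^ (n - 1)) d \<rho> (1\<^sub>m dA \<otimes>\<^sub>m tprod (obs' zs))"

lemma tr_cond_A:
  assumes "zs \<in> words Y k" "k \<le> n" "X \<in> carrier_mat dA dA"
  shows "tr (cond_A zs * X) = complex_of_real (1 / prob zs) * T X (obs zs)"
  unfolding cond_A_def tr_smult_mult[OF reduce_carrier(1) assms(3)]
    tr_reduce_fst[OF carrier assms(3) tprod_obs_carrier[OF assms(1,2)]] tfun_def ..

lemma cond_A_state:
  assumes zs: "zs \<in> words Y k" "k \<le> n" and p: "0 < prob zs"
  shows "cond_A zs \<in> states dA"
  unfolding cond_A_def
proof (rule smult_state[OF _ _ p])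
  show "positive_mat dA (reduce_fst dA (d ^ n) \<rho> (tprod (obs zs)))"
    unfolding obs_eq_squares tprod_square[OF obs_root_carrier(1)[OF zs]]
    by (rule reduce_fst_positive[OF pos tprod_carrier[OF obs_root_carrier[OF zs]]])
  have "tr (reduce_fst dA (d ^ n) \<rho> (tprod (obs zs))) = tr (reduce_fst dA (d ^ n) \<rho> (tprod (obs zs)) * 1\<^sub>m dA)"
    by (simp add: right_mult_one_mat[OF reduce_carrier(1)])
  also have "\<dots> = T (1\<^sub>m dA) (obs zs)"
    unfolding tr_reduce_fst[OF carrier one_carrier_mat tprod_obs_carrier[OF zs]] tfun_def ..
  finally show "tr (reduce_fst dA (d ^ n) \<rho> (tprod (obs zs))) = complex_of_real (prob zs)"
    using T_one_obs(1)[OF zs] by simp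
qed

lemma cond_A_constraint:
  assumes zs: "zs \<in> words Y k" "k \<le> n" and p: "0 < prob zs"
    and \<Psi>: "linear_map_on_mats dA \<Psi>" and X: "X \<in> carrier_mat dA dA"
    and constr: "tensor_map dA \<Psi> (d ^ n) id \<rho> = X \<otimes>\<^sub>m ptrace_fst dA (d ^ n) \<rho>"
  shows "\<Psi> (cond_A zs) = X"
proof -
  have "\<Psi> (cond_A zs) = complex_of_real (1 / prob zs) \<cdot>\<^sub>m \<Psi> (reduce_fst dA (d ^ n) \<rho> (tprod (obs zs)))"
    unfolding cond_A_def using \<Psi> by (simp add: linear_map_on_mats_def)
  also have "\<Psi> (reduce_fst dA (d ^ n) \<rho> (tprod (obs zs))) = complex_of_real (prob zs) \<cdot>\<^sub>m X"
    unfolding constraint_reduce_fst[OF carrier \<Psi> X constr tprod_obs_carrier[OF zs]]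
    using T_one_obs(1)[OF zs] by (simp add: tfun_def)
  finally show ?thesis using p smult_one_div by simp
qed

lemma obs'_carrier:
  assumes "zs \<in> words Y k" "k < n"
  shows "set (obs' zs) \<subseteq> carrier_mat d d" "length (obs' zs) = n - 1"
  using words_carrier[OF assms(1)] assms(2) by (auto simp: obs'_def)

lemma T_obs'_last:
  assumes zs: "zs \<in> words Y k" "k < n" and Z: "Z \<in> carrier_mat d d"
  shows "tr (\<rho> * ((1\<^sub>m dA \<otimes>\<^sub>m tprod (obs' zs)) \<otimes>\<^sub>m Z)) = T (1\<^sub>m dA) (obs' zs @ [Z])"
proof -
  have "tprod [Z] = Z" using tensor_mat_one_right[OF Z] by simp
  then have "tprod (obs' zs @ [Z]) = tprod (obs' zs) \<otimes>\<^sub>m Z"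
    using tprod_append[OF obs'_carrier(1)[OF zs], of "[Z]"] Z by simp
  then show ?thesis
    unfolding tfun_def using tensor_mat_assoc[OF one_carrier_mat[of dA] tprod_carrier[OF obs'_carrier[OF zs]] Z] by simp
qed

lemma obs'_one:
  assumes "zs \<in> words Y k" "k < n"
  shows "obs' zs @ [1\<^sub>m d] = obs zs"
proof -
  have "replicate (n - 1 - k) (1\<^sub>m d) @ [1\<^sub>m d] = (replicate (n - k) (1\<^sub>m d) :: complex mat list)"
    using assms(2) replicate_append_same[of "n - 1 - k" "1\<^sub>m d :: complex mat"]
    by (metis Suc_diff_Suc diff_Suc_eq_diff_pred replicate_Suc)
  then show ?thesis using words_carrier(3)[OF assms(1)] by (simp add: obs'_def obs_def)
qed

text \<open>The last factor and factor k + 1 are both unmeasured, so by symmetry y is equally likely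
  on either. Thus the conditional state of the last factor predicts the next outcome.\<close>

lemma obs'_M:
  assumes zs: "zs \<in> words Y k" "k < n" and y: "y \<in> Y"
  shows "T (1\<^sub>m dA) (obs' zs @ [M y]) = T (1\<^sub>m dA) (obs (zs @ [y]))"
proof (rule T_mset_cong[OF one_carrier_mat])
  show "set (obs' zs @ [M y]) \<subseteq> carrier_mat d d" "length (obs' zs @ [M y]) = n"
    using obs'_carrier[OF zs] M_carrier[OF y] zs by auto
  have "length zs < n" using zs words_carrier(3)[OF zs(1)] by simp
  then show "mset (obs' zs @ [M y]) = mset (obs (zs @ [y]))"
    unfolding obs_snoc(2)[OF \<open>length zs < n\<close>] by (simp add: obs'_def)
qed

lemma W_carrier:
  assumes "zs \<in> words Y k" "k < n"
  shows "1\<^sub>m dA \<otimes>\<^sub>m tprod (obs' zs) \<in> carrier_mat (dA * d ^ (n - 1)) (dA * d ^ (n - 1))"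
  by (intro tensor_mat_carrier one_carrier_mat tprod_carrier[OF obs'_carrier[OF assms]])

lemma tr_cond_B:
  assumes zs: "zs \<in> words Y k" "k < n" and Z: "Z \<in> carrier_mat d d"
  shows "tr (cond_B zs * Z) = complex_of_real (1 / prob zs) * T (1\<^sub>m dA) (obs' zs @ [Z])"
  unfolding cond_B_def tr_smult_mult[OF reduce_carrier(2) Z]
    tr_reduce_snd[OF carrier[unfolded split_last(2)] W_carrier[OF zs] Z] T_obs'_last[OF zs Z] ..

lemma W_square:
  assumes zs: "zs \<in> words Y k" "k < n"
  shows "\<exists>D\<in>carrier_mat (dA * d ^ (n - 1)) (dA * d ^ (n - 1)). 1\<^sub>m dA \<otimes>\<^sub>m tprod (obs' zs) = mat_adjoint D * D"
proof -
  define Ds where "Ds = map root zs @ replicate (n - 1 - length zs) (1\<^sub>m d)"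
  have Ds: "set Ds \<subseteq> carrier_mat d d" "length Ds = n - 1"
    using words_carrier[OF zs(1)] zs(2) by (auto simp: Ds_def)
  have eq: "obs' zs = map (\<lambda>D. mat_adjoint D * D) Ds"
    by (simp add: obs'_def Ds_def M_def mat_adjoint_one)
  have one: "1\<^sub>m dA = mat_adjoint (1\<^sub>m dA) * (1\<^sub>m dA :: complex mat)" by simp
  have "1\<^sub>m dA \<otimes>\<^sub>m tprod (obs' zs) = (mat_adjoint (1\<^sub>m dA) * 1\<^sub>m dA) \<otimes>\<^sub>m (mat_adjoint (tprod Ds) * tprod Ds)"
    unfolding eq tprod_square[OF Ds(1)] one[symmetric] ..
  also have "\<dots> = mat_adjoint (1\<^sub>m dA \<otimes>\<^sub>m tprod Ds) * (1\<^sub>m dA \<otimes>\<^sub>m tprod Ds)"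
    by (rule tensor_square[OF one_carrier_mat tprod_carrier[OF Ds]])
  finally show ?thesis
    using tensor_mat_carrier[OF one_carrier_mat tprod_carrier[OF Ds]] by blast
qed

lemma cond_B_state:
  assumes zs: "zs \<in> words Y k" "k < n" and p: "0 < prob zs"
  shows "cond_B zs \<in> states d"
  unfolding cond_B_def
proof (rule smult_state[OF _ _ p])
  let ?W = "1\<^sub>m dA \<otimes>\<^sub>m tprod (obs' zs)"
  obtain D where D: "D \<in> carrier_mat (dA * d ^ (n - 1)) (dA * d ^ (n - 1))" "?W = mat_adjoint D * D"
    using W_square[OF zs] by blast
  show "positive_mat d (reduce_snd (dA * d ^ (n - 1)) d \<rho> ?W)"
    unfolding D(2) by (rule reduce_snd_positive[OF pos[unfolded split_last(2)] D(1)])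
  have "tr (reduce_snd (dA * d ^ (n - 1)) d \<rho> ?W) = tr (reduce_snd (dA * d ^ (n - 1)) d \<rho> ?W * 1\<^sub>m d)"
    by (simp add: right_mult_one_mat[OF reduce_carrier(2)])
  also have "\<dots> = complex_of_real (prob zs)"
    unfolding tr_reduce_snd[OF carrier[unfolded split_last(2)] W_carrier[OF zs] one_carrier_mat]
      T_obs'_last[OF zs one_carrier_mat] obs'_one[OF zs]
    by (rule T_one_obs(1)[OF zs(1)]) (use zs in simp)
  finally show "tr (reduce_snd (dA * d ^ (n - 1)) d \<rho> ?W) = complex_of_real (prob zs)" .
qed

text \<open>The map acts on the last factor alone, and a record of length k < n has not measured
  that factor.\<close>

lemma cond_B_constraint:
  assumes zs: "zs \<in> words Y k" "k < n" and p: "0 < prob zs"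
    and \<Psi>: "linear_map_on_mats d \<Psi>" and X: "X \<in> carrier_mat d d"
    and constr: "tensor_map (dA * d ^ (n - 1)) id d \<Psi> \<rho> = ptrace_snd (dA * d ^ (n - 1)) d \<rho> \<otimes>\<^sub>m X"
  shows "\<Psi> (cond_B zs) = X"
proof -
  let ?R = "reduce_snd (dA * d ^ (n - 1)) d \<rho> (1\<^sub>m dA \<otimes>\<^sub>m tprod (obs' zs))"
  have "\<Psi> (cond_B zs) = complex_of_real (1 / prob zs) \<cdot>\<^sub>m \<Psi> ?R"
    unfolding cond_B_def using \<Psi> by (simp add: linear_map_on_mats_def)
  also have "\<Psi> ?R = complex_of_real (prob zs) \<cdot>\<^sub>m X"
    unfolding constraint_reduce_snd[OF carrier[unfolded split_last(2)] \<Psi> X constr W_carrier[OF zs]]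
      T_obs'_last[OF zs one_carrier_mat] obs'_one[OF zs]
    using T_one_obs(1)[OF zs(1)] zs by simp
  finally show ?thesis using p smult_one_div by simp
qed

end

lemma tr_tensor:
  assumes A: "A \<in> carrier_mat a a" and B: "B \<in> carrier_mat b b"
  shows "tr (A \<otimes>\<^sub>m B) = tr A * tr B"
proof -
  have "tr (A \<otimes>\<^sub>m B) = (\<Sum>i<a. \<Sum>k<b. (A \<otimes>\<^sub>m B) $$ (i * b + k, i * b + k))"
    using A B by (simp add: tr_def sum_product_index)
  also have "\<dots> = (\<Sum>i<a. \<Sum>k<b. A $$ (i, i) * B $$ (k, k))"
    by (intro sum.cong refl) (simp add: tensor_mat_index'[OF A B])
  finally have "tr (A \<otimes>\<^sub>m B) = (\<Sum>i<a. \<Sum>k<b. A $$ (i, i) * B $$ (k, k))" .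
  then show ?thesis using A B by (simp add: tr_def sum_product)
qed

lemma ptrace_snd_eq_reduce: "ptrace_snd d1 d2 \<rho> = reduce_fst d1 d2 \<rho> (1\<^sub>m d2)"
proof -
  have "(\<Sum>k<d2. \<rho> $$ (i * d2 + k, j * d2 + k))
      = (\<Sum>k<d2. \<Sum>l<d2. \<rho> $$ (i * d2 + k, j * d2 + l) * 1\<^sub>m d2 $$ (l, k))" for i j
  proof (rule sum.cong[OF refl])
    fix k assume "k \<in> {..<d2}"
    then have k: "k < d2" by simp
    have "(\<Sum>l<d2. \<rho> $$ (i * d2 + k, j * d2 + l) * 1\<^sub>m d2 $$ (l, k))
        = (\<Sum>l<d2. \<rho> $$ (i * d2 + k, j * d2 + l) * (if l = k then 1 else 0))"
      using k by (intro sum.cong refl) simp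
    then show "\<rho> $$ (i * d2 + k, j * d2 + k) = (\<Sum>l<d2. \<rho> $$ (i * d2 + k, j * d2 + l) * 1\<^sub>m d2 $$ (l, k))"
      unfolding sum_mult_delta using k by simp
  qed
  then show ?thesis unfolding ptrace_snd_def reduce_fst_def by simp
qed

section \<open>The objective before and after conditioning\<close>

context measured_extension
begin

lemma value_product:
  assumes H: "H \<in> carrier_mat (dA * d) (dA * d)" and Hy: "\<And>y. y \<in> Y \<Longrightarrow> Hy y \<in> carrier_mat dA dA"
    and H_eq: "\<And>p q. p < dA * d \<Longrightarrow> q < dA * d \<Longrightarrow> H $$ (p, q) = (\<Sum>y\<in>Y. 1 * (Hy y \<otimes>\<^sub>m M y) $$ (p, q))"
    and \<rho>A: "\<rho>A \<in> carrier_mat dA dA" and \<rho>B: "\<rho>B \<in> carrier_mat d d"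
  shows "tr (H * (\<rho>A \<otimes>\<^sub>m \<rho>B)) = (\<Sum>y\<in>Y. tr (\<rho>A * Hy y) * tr (\<rho>B * M y))"
proof -
  note AB = tensor_mat_carrier[OF \<rho>A \<rho>B]
  have "tr (H * (\<rho>A \<otimes>\<^sub>m \<rho>B)) = tr ((\<rho>A \<otimes>\<^sub>m \<rho>B) * H)" by (rule tr_mult_commute[OF H AB])
  also have "\<dots> = (\<Sum>y\<in>Y. 1 * tr ((\<rho>A \<otimes>\<^sub>m \<rho>B) * (Hy y \<otimes>\<^sub>m M y)))"
    by (rule tr_mult_linear[OF AB H _ H_eq]) (use Hy M_carrier in auto)
  also have "\<dots> = (\<Sum>y\<in>Y. tr (\<rho>A * Hy y) * tr (\<rho>B * M y))"
  proof (rule sum.cong[OF refl])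
    fix y assume y: "y \<in> Y"
    show "1 * tr ((\<rho>A \<otimes>\<^sub>m \<rho>B) * (Hy y \<otimes>\<^sub>m M y)) = tr (\<rho>A * Hy y) * tr (\<rho>B * M y)"
      unfolding tensor_mat_mult[OF \<rho>A \<rho>B Hy[OF y] M_carrier[OF y]]
        tr_tensor[OF mult_carrier_mat[OF \<rho>A Hy[OF y]] mult_carrier_mat[OF \<rho>B M_carrier[OF y]]] by simp
  qed
  finally show ?thesis .
qed

lemma value_marginal:
  assumes H: "H \<in> carrier_mat (dA * d) (dA * d)" and Hy: "\<And>y. y \<in> Y \<Longrightarrow> Hy y \<in> carrier_mat dA dA"
    and H_eq: "\<And>p q. p < dA * d \<Longrightarrow> q < dA * d \<Longrightarrow> H $$ (p, q) = (\<Sum>y\<in>Y. 1 * (Hy y \<otimes>\<^sub>m M y) $$ (p, q))"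
  shows "tr (H * ptrace_snd (dA * d) (d ^ (n - 1)) \<rho>) = (\<Sum>y\<in>Y. T (Hy y) (M y # replicate (n - 1) (1\<^sub>m d)))"
proof -
  have one: "1\<^sub>m (d ^ (n - 1)) \<in> carrier_mat (d ^ (n - 1)) (d ^ (n - 1))" by simp
  have c: "\<rho> \<in> carrier_mat (dA * d * d ^ (n - 1)) (dA * d * d ^ (n - 1))" using carrier split_last(3) by metis
  have HM: "Hy y \<otimes>\<^sub>m M y \<in> carrier_mat (dA * d) (dA * d)" if "y \<in> Y" for y using Hy M_carrier that by simp
  have "tr (H * ptrace_snd (dA * d) (d ^ (n - 1)) \<rho>) = tr (\<rho> * (H \<otimes>\<^sub>m 1\<^sub>m (d ^ (n - 1))))"
    unfolding ptrace_snd_eq_reduce tr_mult_commute[OF H reduce_carrier(1)] tr_reduce_fst[OF c H one] ..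
  also have "\<dots> = (\<Sum>y\<in>Y. 1 * tr (\<rho> * ((Hy y \<otimes>\<^sub>m M y) \<otimes>\<^sub>m 1\<^sub>m (d ^ (n - 1)))))"
    by (rule tr_mult_linear[OF c _ _ tensor_mat_linear_left[OF H one HM H_eq]])
      (use H HM in \<open>auto intro!: tensor_mat_carrier\<close>)
  also have "\<dots> = (\<Sum>y\<in>Y. T (Hy y) (M y # replicate (n - 1) (1\<^sub>m d)))"
    unfolding tfun_def
    using tensor_mat_assoc[OF Hy M_carrier one] by (simp add: tprod_one)
  finally show ?thesis .
qed

text \<open>Both values decompose along the records of length k. That of \<rho> pairs
  \<open>Hy\<close> with the joint statistics of A and the next outcome, the averaged product value
  with the product of their conditional marginals. The chain bound controls the difference, so some
  record of positive probability does as well as the average.\<close>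

lemma exists_good_conditional:
  assumes A: "matrix_units dA \<A> N blk K f" and one: "1\<^sub>m dA \<in> \<A>"
    and m: "\<And>r. r < N \<Longrightarrow> card {c. c < N \<and> blk c = blk r} = m (blk r)" "\<And>r. r < N \<Longrightarrow> 0 < m (blk r)"
    and Q: "\<And>y. y \<in> Y \<Longrightarrow> sesq_bounded N (Q y) C" and C: "0 \<le> C"
    and H: "H \<in> carrier_mat (dA * d) (dA * d)" and Hy: "\<And>y. y \<in> Y \<Longrightarrow> Hy y \<in> carrier_mat dA dA"
    and Hy_eq: "\<And>y i j. y \<in> Y \<Longrightarrow> i < dA \<Longrightarrow> j < dA \<Longrightarrow>
      Hy y $$ (i, j) = (\<Sum>r<N. \<Sum>c<N. Q y r c * K r c $$ (i, j))"
    and H_eq: "\<And>p q. p < dA * d \<Longrightarrow> q < dA * d \<Longrightarrow> H $$ (p, q) = (\<Sum>y\<in>Y. 1 * (Hy y \<otimes>\<^sub>m M y) $$ (p, q))"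
  shows "\<exists>k<n. \<exists>zs\<in>words Y k. 0 < prob zs \<and>
    Re (tr (H * ptrace_snd (dA * d) (d ^ (n - 1)) \<rho>))
      \<le> Re (tr (H * (cond_A zs \<otimes>\<^sub>m cond_B zs))) + C * sqrt (2 * ln N / n)"
proof -
  \<comment> \<open>With the indices transposed, \<open>trprod\<close> of the coefficients of an
    operator and \<open>s zs\<close> is the expectation of that operator.\<close>
  define s where "s zs r c = T (K c r) (obs zs)" for zs r c
  have Kc: "K r c \<in> carrier_mat dA dA" if "r < N" "c < N" for r c
    using A that by (simp add: matrix_units_def)
  have psd: "psd_fun N (s zs)" if k: "k \<le> n" and zs: "zs \<in> words Y k" for k zs
    unfolding s_def
  proof (rule psd_fun_functional[OF A m, where \<tau> = "\<lambda>X. T X (obs zs)"])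
    fix M F and c :: "nat \<times> nat \<Rightarrow> complex"
    assume "M \<in> carrier_mat dA dA" "\<And>p. p \<in> {..<N} \<times> {..<N} \<Longrightarrow> F p \<in> carrier_mat dA dA"
      "\<And>i j. i < dA \<Longrightarrow> j < dA \<Longrightarrow> M $$ (i, j) = (\<Sum>p\<in>{..<N} \<times> {..<N}. c p * F p $$ (i, j))"
    then show "T M (obs zs) = (\<Sum>p\<in>{..<N} \<times> {..<N}. c p * T (F p) (obs zs))"
      by (rule tfun_linear_left[OF carrier _ obs_carrier[OF zs k]])
  qed (use T_obs_nonneg[OF zs k] in auto)
  have split: "s zs i j = (\<Sum>y\<in>Y. s (zs @ [y]) i j)" if "k < n" "zs \<in> words Y k" "i < N" "j < N" for k zs i j
    unfolding s_def by (rule T_obs_split[OF Kc[OF that(4,3)] that(2,1)])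
  have tr_s: "(\<Sum>r<N. s zs r r) = complex_of_real (prob zs)" if k: "k \<le> n" and zs: "zs \<in> words Y k" for k zs
  proof -
    have "T (1\<^sub>m dA) (obs zs) = (\<Sum>r<N. 1 * T (K r r) (obs zs))"
      by (rule tfun_linear_left[OF carrier one_carrier_mat obs_carrier[OF zs k]])
        (use Kc matrix_units_one[OF A one] in auto)
    then show ?thesis using T_one_obs(1)[OF zs k] by (simp add: s_def)
  qed
  have T_Hy: "trprod N (Q y) (s zs) = T (Hy y) (obs zs)" if k: "k \<le> n" and zs: "zs \<in> words Y k" and y: "y \<in> Y" for k zs y
  proof -
    have "T (Hy y) (obs zs) = (\<Sum>p\<in>{..<N} \<times> {..<N}. Q y (fst p) (snd p) * T (K (fst p) (snd p)) (obs zs))"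
      by (rule tfun_linear_left[OF carrier Hy[OF y] obs_carrier[OF zs k]])
        (use Kc Hy_eq[OF y] in \<open>auto simp: sum.cartesian_product case_prod_unfold\<close>)
    then show ?thesis by (simp add: trprod_def s_def sum.cartesian_product case_prod_unfold)
  qed
  have nil: "[] \<in> words Y 0" by simp
  have s1: "(\<Sum>i<N. s [] i i) = 1"
    using tr_s[OF le0 nil] T_one_obs(1)[OF nil le0] T_one by (simp add: obs_def)
  have app: "zs @ [y] \<in> words Y (Suc k)" if "zs \<in> words Y k" "y \<in> Y" for zs y k
    using that by (auto simp: words_def)
  have n0: "0 < n" using n by simp
  have "\<exists>k<n. (\<Sum>zs\<in>words Y k. trace_re N (s zs)) = 1 \<and>
    (\<Sum>zs\<in>words Y k. \<Sum>y\<in>Y. cmod (trprod N (Q y) (s (zs @ [y]))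
      - trace_re N (s (zs @ [y])) / trace_re N (s zs) * trprod N (Q y) (s zs))) \<le> C * sqrt (2 * ln N / n)"
    by (rule information_chain_bound[where s = s, OF finite_Y n0 C _ _ s1]) (fact psd split Q)+
  then obtain k where k: "k < n" and sum1: "(\<Sum>zs\<in>words Y k. trace_re N (s zs)) = 1"
    and bound: "(\<Sum>zs\<in>words Y k. \<Sum>y\<in>Y. cmod (trprod N (Q y) (s (zs @ [y]))
      - trace_re N (s (zs @ [y])) / trace_re N (s zs) * trprod N (Q y) (s zs))) \<le> C * sqrt (2 * ln N / n)"
    by blast
  define E where "E = C * sqrt (2 * ln N / n)"
  define v where "v = Re (tr (H * ptrace_snd (dA * d) (d ^ (n - 1)) \<rho>))"
  define w where "w zs = Re (tr (H * (cond_A zs \<otimes>\<^sub>m cond_B zs)))" for zs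
  have prob: "trace_re N (s zs) = prob zs" if "zs \<in> words Y k" for zs
    using tr_s[OF _ that] k by simp
  have prob': "trace_re N (s (zs @ [y])) = prob (zs @ [y])" if "zs \<in> words Y k" "y \<in> Y" for zs y
    using tr_s[OF _ app[OF that]] k by simp
  \<comment> \<open>Symmetry replaces the outcome on the first B-factor by the one that follows a
    record of length k.\<close>
  have v_eq: "v = (\<Sum>zs\<in>words Y k. Re (\<Sum>y\<in>Y. trprod N (Q y) (s (zs @ [y]))))"
  proof -
    have "tr (H * ptrace_snd (dA * d) (d ^ (n - 1)) \<rho>) = (\<Sum>y\<in>Y. T (Hy y) (M y # replicate (n - 1) (1\<^sub>m d)))"
      by (rule value_marginal[OF H Hy H_eq])
    also have "\<dots> = (\<Sum>y\<in>Y. \<Sum>zs\<in>words Y k. T (Hy y) (obs (zs @ [y])))"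
      using T_first_eq_sum[OF Hy _ k] by (intro sum.cong refl) blast
    also have "\<dots> = (\<Sum>zs\<in>words Y k. \<Sum>y\<in>Y. T (Hy y) (obs (zs @ [y])))" by (rule sum.swap)
    also have "\<dots> = (\<Sum>zs\<in>words Y k. \<Sum>y\<in>Y. trprod N (Q y) (s (zs @ [y])))"
      by (intro sum.cong refl) (simp add: T_Hy[OF Suc_leI[OF k] app])
    finally show ?thesis unfolding v_def by (simp only: Re_sum)
  qed
  \<comment> \<open>The conditional state of the last factor gives y the probability
    \<open>prob (zs @ [y]) / prob zs\<close>, just as for the next outcome.\<close>
  have w_eq: "Re (\<Sum>y\<in>Y. prob (zs @ [y]) / prob zs * trprod N (Q y) (s zs)) = prob zs * w zs"
    if zs: "zs \<in> words Y k" and p: "0 < prob zs" for zs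
  proof -
    have cA: "cond_A zs \<in> carrier_mat dA dA" and cB: "cond_B zs \<in> carrier_mat d d"
      by (simp_all add: cond_A_def cond_B_def)
    have "tr (H * (cond_A zs \<otimes>\<^sub>m cond_B zs)) = (\<Sum>y\<in>Y. tr (cond_A zs * Hy y) * tr (cond_B zs * M y))"
      by (rule value_product[OF H Hy H_eq cA cB])
    also have "\<dots> = (\<Sum>y\<in>Y. complex_of_real (1 / prob zs) * T (Hy y) (obs zs) *
        (complex_of_real (1 / prob zs) * complex_of_real (prob (zs @ [y]))))"
    proof (rule sum.cong[OF refl])
      fix y assume y: "y \<in> Y"
      show "tr (cond_A zs * Hy y) * tr (cond_B zs * M y) = complex_of_real (1 / prob zs) * T (Hy y) (obs zs) *
        (complex_of_real (1 / prob zs) * complex_of_real (prob (zs @ [y])))"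
        unfolding tr_cond_A[OF zs less_imp_le[OF k] Hy[OF y]] tr_cond_B[OF zs k M_carrier[OF y]] obs'_M[OF zs k y]
          T_one_obs(1)[OF app[OF zs y] Suc_leI[OF k]] ..
    qed
    also have "\<dots> = complex_of_real (1 / prob zs) *
        (\<Sum>y\<in>Y. complex_of_real (prob (zs @ [y]) / prob zs) * trprod N (Q y) (s zs))"
      using T_Hy[OF less_imp_le[OF k] zs] by (simp add: sum_distrib_left mult_ac)
    finally have "complex_of_real (prob zs) * tr (H * (cond_A zs \<otimes>\<^sub>m cond_B zs))
        = (\<Sum>y\<in>Y. complex_of_real (prob (zs @ [y]) / prob zs) * trprod N (Q y) (s zs))"
      using p by simp
    then have "Re (\<Sum>y\<in>Y. complex_of_real (prob (zs @ [y]) / prob zs) * trprod N (Q y) (s zs))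
        = Re (complex_of_real (prob zs) * tr (H * (cond_A zs \<otimes>\<^sub>m cond_B zs)))" by simp
    then show ?thesis by (simp add: w_def)
  qed
  \<comment> \<open>Averaging: if every record of positive probability failed, weighting with the
    probabilities, which sum to 1, would contradict the chain bound.\<close>
  have "\<exists>zs\<in>words Y k. 0 < prob zs \<and> v \<le> w zs + E"
  proof (rule ccontr)
    assume neg: "\<not> ?thesis"
    have p0: "0 \<le> prob zs" if "zs \<in> words Y k" for zs using T_one_obs(2)[OF that] k by simp
    have sump: "(\<Sum>zs\<in>words Y k. prob zs) = 1" using sum1 prob by (simp cong: sum.cong)
    have "\<exists>zs\<in>words Y k. 0 < prob zs"
    proof (rule ccontr)
      assume "\<not> ?thesis"
      then have "(\<Sum>zs\<in>words Y k. prob zs) \<le> 0" by (intro sum_nonpos) (meson not_le)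
      then show False using sump by simp
    qed
    then obtain z0 where z0: "z0 \<in> words Y k" "0 < prob z0" by blast
    have diff: "Re (\<Sum>y\<in>Y. trprod N (Q y) (s (zs @ [y]))) - prob zs * w zs
        \<le> (\<Sum>y\<in>Y. cmod (trprod N (Q y) (s (zs @ [y])) - trace_re N (s (zs @ [y])) / trace_re N (s zs) * trprod N (Q y) (s zs)))"
      if zs: "zs \<in> words Y k" for zs
    proof -
      \<comment> \<open>At probability 0 both sides vanish, since division by 0 gives 0.\<close>
      have "prob zs * w zs = Re (\<Sum>y\<in>Y. prob (zs @ [y]) / prob zs * trprod N (Q y) (s zs))"
        using w_eq[OF zs] p0[OF zs] by (cases "prob zs = 0") simp_all
      then have "Re (\<Sum>y\<in>Y. trprod N (Q y) (s (zs @ [y]))) - prob zs * w zs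
          = Re (\<Sum>y\<in>Y. trprod N (Q y) (s (zs @ [y])) - complex_of_real (prob (zs @ [y]) / prob zs) * trprod N (Q y) (s zs))"
        by (simp only: sum_subtractf minus_complex.simps)
      also have "\<dots> \<le> cmod (\<Sum>y\<in>Y. trprod N (Q y) (s (zs @ [y])) - complex_of_real (prob (zs @ [y]) / prob zs) * trprod N (Q y) (s zs))"
        by (rule complex_Re_le_cmod)
      also have "\<dots> \<le> (\<Sum>y\<in>Y. cmod (trprod N (Q y) (s (zs @ [y])) - complex_of_real (prob (zs @ [y]) / prob zs) * trprod N (Q y) (s zs)))"
        by (rule norm_sum)
      also have "\<dots> = (\<Sum>y\<in>Y. cmod (trprod N (Q y) (s (zs @ [y])) - trace_re N (s (zs @ [y])) / trace_re N (s zs) * trprod N (Q y) (s zs)))"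
        by (intro sum.cong refl) (simp only: prob[OF zs] prob'[OF zs])
      finally show ?thesis .
    qed
    have "v - (\<Sum>zs\<in>words Y k. prob zs * w zs) \<le> E"
      unfolding v_eq sum_subtractf[symmetric] E_def
      by (rule order_trans[OF sum_mono[OF diff] bound])
    moreover have "(\<Sum>zs\<in>words Y k. prob zs * w zs) < (\<Sum>zs\<in>words Y k. prob zs * (v - E))"
    proof (rule sum_strict_mono_ex1)
      show "finite (words Y k)" by (rule finite_words[OF finite_Y])
      show "\<forall>zs\<in>words Y k. prob zs * w zs \<le> prob zs * (v - E)"
      proof
        fix zs assume zs: "zs \<in> words Y k"
        show "prob zs * w zs \<le> prob zs * (v - E)"
        proof (cases "prob zs = 0")
          case False
          then have "0 < prob zs" using p0[OF zs] by simp
          then have "w zs \<le> v - E" using neg zs by force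
          then show ?thesis using p0[OF zs] by (rule mult_left_mono)
        qed simp
      qed
      have "w z0 < v - E" using neg z0 by force
      then show "\<exists>zs\<in>words Y k. prob zs * w zs < prob zs * (v - E)" using z0 by (intro bexI[of _ z0]) simp_all
    qed
    moreover have "(\<Sum>zs\<in>words Y k. prob zs * (v - E)) = v - E"
      unfolding sum_distrib_right[symmetric] sump by simp
    ultimately show False by simp
  qed
  then show ?thesis using k unfolding v_def w_def E_def by blast
qed

end

lemma sesq_bounded_scale:
  assumes "sesq_bounded n Q C" "cmod z * C \<le> C'"
  shows "sesq_bounded n (\<lambda>r c. z * Q r c) C'"
  unfolding sesq_bounded_def
proof (intro allI)
  fix x y
  let ?p = "sqrt (Re (ip n x x)) * sqrt (Re (ip n y y))"
  have "sesq n (\<lambda>r c. z * Q r c) x y = z * sesq n Q x y"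
    by (simp add: sesq_def sum_distrib_left mult_ac)
  then have "cmod (sesq n (\<lambda>r c. z * Q r c) x y) = cmod z * cmod (sesq n Q x y)" by (simp add: norm_mult)
  also have "\<dots> \<le> cmod z * (C * ?p)"
    using assms(1) by (intro mult_left_mono) (simp_all add: sesq_bounded_def mult.assoc)
  also have "\<dots> = (cmod z * C) * ?p" by (rule mult.assoc[symmetric])
  also have "\<dots> \<le> C' * ?p"
    by (rule mult_right_mono[OF assms(2)]) (simp add: ip_self sum_nonneg)
  finally show "cmod (sesq n (\<lambda>r c. z * Q r c) x y) \<le> C' * sqrt (Re (ip n x x)) * sqrt (Re (ip n y y))"
    by (simp add: mult.assoc)
qed

section \<open>The bound\<close>

text \<open>Membership of the identity allows the joint invariance of \<open>H\<close> to be used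
  with one of the two unitaries trivial.\<close>

lemma subgroup_unitary:
  assumes "closed_unitary_subgroup d \<V>"
  shows "\<V> \<subseteq> carrier (unitary_group d)" "1\<^sub>m d \<in> \<V>"
  using assms subgroup.subset subgroup.one_closed
  by (force simp: closed_unitary_subgroup_def unitary_group_def)+

lemma unitary_groupD:
  assumes "U \<in> carrier (unitary_group d)"
  shows "U \<in> carrier_mat d d" "mat_adjoint U * U = 1\<^sub>m d"
  using assms by (auto simp: unitary_group_def)

lemma tensor_commute_fst:
  assumes H: "H \<in> carrier_mat (dA * d) (dA * d)" and V: "V \<in> carrier (unitary_group dA)"
    and inv: "(V \<otimes>\<^sub>m 1\<^sub>m d) * H * mat_adjoint (V \<otimes>\<^sub>m 1\<^sub>m d) = H"
  shows "(V \<otimes>\<^sub>m 1\<^sub>m d) * H = H * (V \<otimes>\<^sub>m 1\<^sub>m d)"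
proof (rule unitary_conjugation_commute[OF _ H _ inv])
  note Vc = unitary_groupD[OF V]
  show "V \<otimes>\<^sub>m 1\<^sub>m d \<in> carrier_mat (dA * d) (dA * d)" using Vc by simp
  show "mat_adjoint (V \<otimes>\<^sub>m 1\<^sub>m d) * (V \<otimes>\<^sub>m 1\<^sub>m d) = 1\<^sub>m (dA * d)"
    unfolding mat_adjoint_tensor[OF Vc(1) one_carrier_mat] mat_adjoint_one
      tensor_mat_mult[OF mat_adjoint_carrier[OF Vc(1)] one_carrier_mat Vc(1) one_carrier_mat] Vc(2)
    by (simp add: tensor_mat_one)
qed

lemma tensor_commute_snd:
  assumes H: "H \<in> carrier_mat (dA * d) (dA * d)" and V: "V \<in> carrier (unitary_group d)"
    and inv: "(1\<^sub>m dA \<otimes>\<^sub>m V) * H * mat_adjoint (1\<^sub>m dA \<otimes>\<^sub>m V) = H"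
  shows "(1\<^sub>m dA \<otimes>\<^sub>m V) * H = H * (1\<^sub>m dA \<otimes>\<^sub>m V)"
proof (rule unitary_conjugation_commute[OF _ H _ inv])
  note Vc = unitary_groupD[OF V]
  show "1\<^sub>m dA \<otimes>\<^sub>m V \<in> carrier_mat (dA * d) (dA * d)" using Vc by simp
  show "mat_adjoint (1\<^sub>m dA \<otimes>\<^sub>m V) * (1\<^sub>m dA \<otimes>\<^sub>m V) = 1\<^sub>m (dA * d)"
    unfolding mat_adjoint_tensor[OF one_carrier_mat Vc(1)] mat_adjoint_one
      tensor_mat_mult[OF one_carrier_mat mat_adjoint_carrier[OF Vc(1)] one_carrier_mat Vc(1)] Vc(2)
    by (simp add: tensor_mat_one)
qed

lemma states_dim_pos: "\<rho> \<in> states d \<Longrightarrow> 0 < d"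
  by (rule ccontr) (auto simp: states_def positive_mat_def hermitian_mat_def tr_def)

text \<open>The bound for a single \<rho> with an explicit pair of states; in particular the
  bilinear problem is feasible whenever the relaxation is.\<close>

lemma feasible_bound:
  assumes VA: "closed_unitary_subgroup dA \<V>\<^sub>A" and VB: "closed_unitary_subgroup d \<V>\<^sub>B"
    and \<Psi>A: "linear_map_on_mats dA \<Psi>\<^sub>A" and \<Psi>B: "linear_map_on_mats d \<Psi>\<^sub>B"
    and XA: "X\<^sub>A \<in> carrier_mat dA dA" and XB: "X\<^sub>B \<in> carrier_mat d d"
    and H: "H \<in> carrier_mat (dA * d) (dA * d)"
    and inv: "\<And>V\<^sub>A V\<^sub>B. V\<^sub>A \<in> \<V>\<^sub>A \<Longrightarrow> V\<^sub>B \<in> \<V>\<^sub>B \<Longrightarrow>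
           (V\<^sub>A \<otimes>\<^sub>m V\<^sub>B) * H * mat_adjoint (V\<^sub>A \<otimes>\<^sub>m V\<^sub>B) = H"
    and bA: "has_block_dims (commutant dA \<V>\<^sub>A) kA mA" and bB: "has_block_dims (commutant d \<V>\<^sub>B) kB mB"
    and n: "1 \<le> n" and \<rho>: "\<rho> \<in> feasible_ext dA d \<V>\<^sub>A \<V>\<^sub>B \<Psi>\<^sub>A \<Psi>\<^sub>B X\<^sub>A X\<^sub>B n"
  shows "\<exists>\<rho>\<^sub>A\<in>states dA. \<exists>\<rho>\<^sub>B\<in>states d. \<Psi>\<^sub>A \<rho>\<^sub>A = X\<^sub>A \<and> \<Psi>\<^sub>B \<rho>\<^sub>B = X\<^sub>B \<and>
    Re (tr (H * ptrace_snd (dA * d) (d ^ (n - 1)) \<rho>)) \<le> Re (tr (H * (\<rho>\<^sub>A \<otimes>\<^sub>m \<rho>\<^sub>B)))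
      + op_norm H * 2 * real (MAX i\<in>{1..kB}. mB i)
          * sqrt (2 * ln 2 * log 2 (\<Sum>i = 1..kA. (real (mA i))\<^sup>2) / real n)"
proof -
  have st: "\<rho> \<in> states (dA * d ^ n)"
    and cA: "tensor_map dA \<Psi>\<^sub>A (d ^ n) id \<rho> = X\<^sub>A \<otimes>\<^sub>m ptrace_fst dA (d ^ n) \<rho>"
    and cB: "tensor_map (dA * d ^ (n - 1)) id d \<Psi>\<^sub>B \<rho> = ptrace_snd (dA * d ^ (n - 1)) d \<rho> \<otimes>\<^sub>m X\<^sub>B"
    and sym: "\<rho> \<in> sym_commutant dA d \<V>\<^sub>A \<V>\<^sub>B n"
    using \<rho> by (simp_all add: feasible_ext_def)
  have dims: "0 < dA" "0 < d" using states_dim_pos[OF st] n by (auto simp: zero_power)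
  note uA = subgroup_unitary[OF VA] and uB = subgroup_unitary[OF VB]
  interpret A: unitary_commutant dA \<V>\<^sub>A by unfold_locales (rule uA(1))
  interpret B: unitary_commutant d \<V>\<^sub>B by unfold_locales (rule uB(1))
  obtain NA blkA KA f where KA: "matrix_units dA (commutant dA \<V>\<^sub>A) NA blkA KA f" and NA: "NA = (\<Sum>i = 1..kA. mA i)"
    and blkA: "\<forall>r<NA. blkA r \<in> {1..kA} \<and> card {c. c < NA \<and> blkA c = blkA r} = mA (blkA r)"
    using matrix_units_if_block_dims[OF uA(1) bA] by blast
  obtain NB blkB KB g where KB: "matrix_units d (commutant d \<V>\<^sub>B) NB blkB KB g" and NB: "NB = (\<Sum>i = 1..kB. mB i)"
    and blkB: "\<forall>r<NB. blkB r \<in> {1..kB} \<and> card {c. c < NB \<and> blkB c = blkB r} = mB (blkB r)"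
    using matrix_units_if_block_dims[OF uB(1) bB] by blast
  have mA: "\<And>i. i \<in> {1..kA} \<Longrightarrow> 0 < mA i" and mB: "\<And>i. i \<in> {1..kB} \<Longrightarrow> 0 < mB i"
    using bA bB by (simp_all add: has_block_dims_def)
  have cardA: "card {c. c < NA \<and> blkA c = blkA r} = mA (blkA r)" "0 < mA (blkA r)" if "r < NA" for r
    using blkA mA that by auto
  have cardB: "card {c. c < NB \<and> blkB c = blkB r} = mB (blkB r)" "0 < mB (blkB r)" if "r < NB" for r
    using blkB mB that by auto
  define Y where "Y = povm_outcomes NB blkB"
  define root where "root = povm_root mB blkB KB"
  interpret measured_extension dA d n \<rho> Y root
  proof
    show "1 \<le> n" "\<rho> \<in> states (dA * d ^ n)" by fact+
    show "finite Y" by (simp add: Y_def)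
    show "root y \<in> carrier_mat d d" if "y \<in> Y" for y
      using povm_root_carrier[OF KB] that by (simp add: Y_def root_def)
    show "1\<^sub>m d $$ (i, j) = (\<Sum>y\<in>Y. (mat_adjoint (root y) * root y) $$ (i, j))" if "i < d" "j < d" for i j
      unfolding Y_def root_def by (rule povm_total[OF KB B.A_one cardB that, symmetric])
    show "\<rho> * (1\<^sub>m dA \<otimes>\<^sub>m perm_op d n \<sigma>) = (1\<^sub>m dA \<otimes>\<^sub>m perm_op d n \<sigma>) * \<rho>" if "\<sigma> permutes {..<n}" for \<sigma>
    proof -
      have "1\<^sub>m dA \<otimes>\<^sub>m perm_op d n \<sigma> \<in> star_algebra (sym_generators dA d \<V>\<^sub>A \<V>\<^sub>B n)"
        by (rule star_algebra.gen) (use that in \<open>auto simp: sym_generators_def\<close>)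
      then show ?thesis using sym by (simp add: sym_commutant_def commutant_def)
    qed
  qed
  have HA: "block_fst dA d H k l \<in> commutant dA \<V>\<^sub>A" if "k < d" "l < d" for k l
  proof (rule block_fst_commutant[OF H _ _ that])
    fix V assume V: "V \<in> \<V>\<^sub>A"
    then show "V \<in> carrier_mat dA dA" by (rule A.V_carrier)
    show "(V \<otimes>\<^sub>m 1\<^sub>m d) * H = H * (V \<otimes>\<^sub>m 1\<^sub>m d)"
      by (rule tensor_commute_fst[OF H _ inv[OF V uB(2)]]) (use V uA(1) in blast)
  qed
  have HB: "block_snd dA d H i j \<in> commutant d \<V>\<^sub>B" if "i < dA" "j < dA" for i j
  proof (rule block_snd_commutant[OF H _ _ that])
    fix V assume V: "V \<in> \<V>\<^sub>B"
    then show "V \<in> carrier_mat d d" by (rule B.V_carrier)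
    show "(1\<^sub>m dA \<otimes>\<^sub>m V) * H = H * (1\<^sub>m dA \<otimes>\<^sub>m V)"
      by (rule tensor_commute_snd[OF H _ inv[OF uA(2) V]]) (use V uB(1) in blast)
  qed
  \<comment> \<open>The Fourier coefficient with which an outcome (a, b, k) contributes to
    \<open>KB a b\<close>, of modulus twice the block size.\<close>
  define q where "q y = 2 * complex_of_nat (mB (blkB (fst y))) * cnj (\<i> ^ snd (snd y))" for y :: "nat \<times> nat \<times> nat"
  define h where "h = compressed_block dA d H f g"
  define Q where "Q y r c = q y * h (fst y) (fst (snd y)) r c" for y :: "nat \<times> nat \<times> nat" and r c
  define Hy where "Hy y = mat dA dA (\<lambda>(i, j). \<Sum>r<NA. \<Sum>c<NA. Q y r c * KA r c $$ (i, j))" for y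
  have Hyc: "Hy y \<in> carrier_mat dA dA" for y by (simp add: Hy_def)
  define mmax where "mmax = (MAX i\<in>{1..kB}. mB i)"
  have mmax: "mB i \<le> mmax" if "i \<in> {1..kB}" for i unfolding mmax_def using that by (intro Max_ge) auto
  \<comment> \<open>A corner of \<open>H\<close> has norm at most \<open>op_norm H\<close>; the
    other factors bound the modulus of \<open>q\<close>.\<close>
  define C where "C = op_norm H * 2 * real mmax"
  have opH: "0 \<le> op_norm H" using op_norm_nonneg[OF H] dims by simp
  have C0: "0 \<le> C" using opH by (simp add: C_def)
  have onf: "orthonormal_system dA NA f" and ong: "orthonormal_system d NB g"
    using KA KB by (simp_all add: matrix_units_def)
  have Qb: "sesq_bounded NA (Q y) C" if "y \<in> Y" for y
  proof -
    obtain a b k where y: "y = (a, b, k)" by (cases y)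
    have ab: "a < NB" "b < NB" using that by (auto simp: Y_def povm_outcomes_def y)
    have "cmod (q y) = 2 * real (mB (blkB a))" unfolding q_def y by (simp add: norm_mult norm_power)
    then have "cmod (q y) * op_norm H \<le> C"
      using mmax[of "blkB a"] blkB ab(1) opH by (simp add: C_def mult.commute mult_left_mono)
    then show ?thesis
      unfolding Q_def h_def y fst_conv snd_conv
      using sesq_bounded_scale[OF compressed_block_bounded[OF H onf ong ab]] by (simp add: y)
  qed
  \<comment> \<open>\<open>H\<close> is expanded in products of matrix units of A and B. Units of B
    between different blocks vanish, and the others are written through the measurement
    operators.\<close>
  have H_eq: "H $$ (p, p') = (\<Sum>y\<in>Y. 1 * (Hy y \<otimes>\<^sub>m M y) $$ (p, p'))" if pp: "p < dA * d" "p' < dA * d" for p p'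
  proof -
    define i k j l where "i = p div d" and "k = p mod d" and "j = p' div d" and "l = p' mod d"
    have ix: "i < dA" "j < dA" "k < d" "l < d"
      using pp dims by (simp_all add: i_def j_def k_def l_def less_mult_imp_div_less)
    have p: "p = i * d + k" "p' = j * d + l" by (simp_all add: i_def j_def k_def l_def)
    let ?h = "\<lambda>a b. \<Sum>r<NA. \<Sum>c<NA. h a b r c * KA r c $$ (i, j)"
    have KBM: "KB a b $$ (k, l) = (\<Sum>t<4. q (a, b, t) * M (a, b, t) $$ (k, l))"
      if "a < NB" "b < NB" "blkB b = blkB a" for a b
      unfolding M_def unfolding root_def q_def fst_conv snd_conv
      by (rule povm_reconstruct[where m = mB, OF KB that cardB(2)[OF that(1)] ix(3,4)])
    have "H $$ (p, p') = (\<Sum>a<NB. \<Sum>b<NB. ?h a b * KB a b $$ (k, l))"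
      unfolding p h_def by (rule compressed_block_expand[OF KA KB HA HB ix])
    also have "\<dots> = (\<Sum>a<NB. \<Sum>b\<in>{b. b < NB \<and> blkB b = blkB a}. \<Sum>t<4. (q (a, b, t) * ?h a b) * M (a, b, t) $$ (k, l))"
    proof (rule sum.cong[OF refl])
      fix a assume "a \<in> {..<NB}"
      then have a: "a < NB" by simp
      show "(\<Sum>b<NB. ?h a b * KB a b $$ (k, l))
        = (\<Sum>b\<in>{b. b < NB \<and> blkB b = blkB a}. \<Sum>t<4. (q (a, b, t) * ?h a b) * M (a, b, t) $$ (k, l))"
      proof (rule sum.mono_neutral_cong_right)
        show "\<forall>b\<in>{..<NB} - {b. b < NB \<and> blkB b = blkB a}. ?h a b * KB a b $$ (k, l) = 0"
        proof
          fix b assume "b \<in> {..<NB} - {b. b < NB \<and> blkB b = blkB a}"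
          then have "KB a b = 0\<^sub>m d d" using KB a unfolding matrix_units_def by auto
          then show "?h a b * KB a b $$ (k, l) = 0" using ix by simp
        qed
        fix b assume "b \<in> {b. b < NB \<and> blkB b = blkB a}"
        then show "?h a b * KB a b $$ (k, l) = (\<Sum>t<4. (q (a, b, t) * ?h a b) * M (a, b, t) $$ (k, l))"
          using KBM[OF a, of b] by (simp add: sum_distrib_left mult_ac)
      qed auto
    qed
    also have "\<dots> = (\<Sum>y\<in>Y. (q y * ?h (fst y) (fst (snd y))) * M y $$ (k, l))"
      unfolding Y_def povm_outcomes_def by (simp add: sum.Sigma sum.cartesian_product case_prod_unfold)
    also have "\<dots> = (\<Sum>y\<in>Y. 1 * (Hy y \<otimes>\<^sub>m M y) $$ (p, p'))"
    proof (rule sum.cong[OF refl])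
      fix y assume y: "y \<in> Y"
      have "Hy y $$ (i, j) = q y * ?h (fst y) (fst (snd y))"
        using ix by (simp add: Hy_def Q_def sum_distrib_left mult.assoc)
      then show "(q y * ?h (fst y) (fst (snd y))) * M y $$ (k, l) = 1 * (Hy y \<otimes>\<^sub>m M y) $$ (p, p')"
        unfolding p using ix by (simp add: tensor_mat_index'[OF Hyc M_carrier[OF y]])
    qed
    finally show ?thesis .
  qed
  have Hy_eq: "Hy y $$ (i, j) = (\<Sum>r<NA. \<Sum>c<NA. Q y r c * KA r c $$ (i, j))" if "i < dA" "j < dA" for y i j
    using that by (simp add: Hy_def)
  obtain k zs where k: "k < n" and zs: "zs \<in> words Y k" and p: "0 < prob zs"
    and le: "Re (tr (H * ptrace_snd (dA * d) (d ^ (n - 1)) \<rho>))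
      \<le> Re (tr (H * (cond_A zs \<otimes>\<^sub>m cond_B zs))) + C * sqrt (2 * ln NA / n)"
    using exists_good_conditional[OF KA A.A_one cardA Qb C0 H Hyc Hy_eq H_eq] by blast
  \<comment> \<open>Otherwise the identity on A, in positive dimension, would be an empty sum.
    Positivity is what the monotonicity of the logarithm requires.\<close>
  have "NA > 0"
  proof (rule ccontr)
    assume "\<not> NA > 0"
    then have "1\<^sub>m dA $$ (0, 0) = (0 :: complex)"
      using matrix_units_one[OF KA A.A_one dims(1) dims(1)] by simp
    then show False using dims by simp
  qed
  \<comment> \<open>Block sizes are at least 1, so the sum of their squares dominates N.\<close>
  moreover have "real NA \<le> (\<Sum>i = 1..kA. (real (mA i))\<^sup>2)"
    unfolding NA of_nat_sum
  proof (rule sum_mono)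
    fix i assume "i \<in> {1..kA}"
    from mA[OF this] have "real (mA i) * 1 \<le> real (mA i) * real (mA i)" by (intro mult_left_mono) auto
    then show "real (mA i) \<le> (real (mA i))\<^sup>2" by (simp add: power2_eq_square)
  qed
  ultimately have "ln NA \<le> ln (\<Sum>i = 1..kA. (real (mA i))\<^sup>2)" by simp
  also have "\<dots> = ln 2 * log 2 (\<Sum>i = 1..kA. (real (mA i))\<^sup>2)" by (simp add: log_def)
  finally have "C * sqrt (2 * ln NA / n) \<le> C * sqrt (2 * ln 2 * log 2 (\<Sum>i = 1..kA. (real (mA i))\<^sup>2) / n)"
    using C0 by (intro mult_left_mono real_sqrt_le_mono divide_right_mono) auto
  with le have "Re (tr (H * ptrace_snd (dA * d) (d ^ (n - 1)) \<rho>)) \<le> Re (tr (H * (cond_A zs \<otimes>\<^sub>m cond_B zs)))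
      + C * sqrt (2 * ln 2 * log 2 (\<Sum>i = 1..kA. (real (mA i))\<^sup>2) / n)" by linarith
  moreover have "cond_A zs \<in> states dA" "\<Psi>\<^sub>A (cond_A zs) = X\<^sub>A"
    using cond_A_state[OF zs less_imp_le[OF k] p] cond_A_constraint[OF zs less_imp_le[OF k] p \<Psi>A XA cA] by auto
  moreover have "cond_B zs \<in> states d" "\<Psi>\<^sub>B (cond_B zs) = X\<^sub>B"
    using cond_B_state[OF zs k p] cond_B_constraint[OF zs k p \<Psi>B XB cB] by auto
  ultimately show ?thesis unfolding C_def mmax_def by blast
qed

text \<open>Only the passage to suprema remains. Without a feasible \<rho> the left side is
  -\<infinity>; otherwise the pair of states from \<open>feasible_bound\<close> has a value of at
  most \<open>c_opt\<close>.\<close>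

theorem proposition7p1:
  fixes dA dB n kA kB :: nat
    and \<V>\<^sub>A \<V>\<^sub>B :: "complex mat set"
    and \<Psi>\<^sub>A \<Psi>\<^sub>B :: "complex mat \<Rightarrow> complex mat"
    and X\<^sub>A X\<^sub>B H :: "complex mat"
    and mA mB :: "nat \<Rightarrow> nat"
  assumes "closed_unitary_subgroup dA \<V>\<^sub>A"
    and "closed_unitary_subgroup dB \<V>\<^sub>B"
    and "linear_map_on_mats dA \<Psi>\<^sub>A" and "covariant dA \<V>\<^sub>A \<Psi>\<^sub>A"
    and "linear_map_on_mats dB \<Psi>\<^sub>B" and "covariant dB \<V>\<^sub>B \<Psi>\<^sub>B"
    and "X\<^sub>A \<in> carrier_mat dA dA" and "X\<^sub>B \<in> carrier_mat dB dB"
    and "hermitian_mat (dA * dB) H"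
    and "\<And>V\<^sub>A V\<^sub>B. V\<^sub>A \<in> \<V>\<^sub>A \<Longrightarrow> V\<^sub>B \<in> \<V>\<^sub>B \<Longrightarrow>
           (V\<^sub>A \<otimes>\<^sub>m V\<^sub>B) * H * mat_adjoint (V\<^sub>A \<otimes>\<^sub>m V\<^sub>B) = H"
    and "has_block_dims (commutant dA \<V>\<^sub>A) kA mA"
    and "has_block_dims (commutant dB \<V>\<^sub>B) kB mB"
    and "n \<ge> 1"
  shows "c_ext dA dB \<V>\<^sub>A \<V>\<^sub>B \<Psi>\<^sub>A \<Psi>\<^sub>B X\<^sub>A X\<^sub>B H n
    \<le> c_opt dA dB \<Psi>\<^sub>A \<Psi>\<^sub>B X\<^sub>A X\<^sub>B H
      + ereal (op_norm H * 2 * real (MAX i\<in>{1..kB}. mB i)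
          * sqrt (2 * ln 2 * log 2 (\<Sum>i = 1..kA. (real (mA i))\<^sup>2) / real n))"
  unfolding c_ext_def
proof (rule Sup_least, clarify)
  fix \<rho> assume \<rho>: "\<rho> \<in> feasible_ext dA dB \<V>\<^sub>A \<V>\<^sub>B \<Psi>\<^sub>A \<Psi>\<^sub>B X\<^sub>A X\<^sub>B n"
  let ?e = "op_norm H * 2 * real (MAX i\<in>{1..kB}. mB i)
          * sqrt (2 * ln 2 * log 2 (\<Sum>i = 1..kA. (real (mA i))\<^sup>2) / real n)"
  have H: "H \<in> carrier_mat (dA * dB) (dA * dB)" using assms(9) by (simp add: hermitian_mat_def)
  obtain \<rho>\<^sub>A \<rho>\<^sub>B where r: "\<rho>\<^sub>A \<in> states dA" "\<rho>\<^sub>B \<in> states dB" "\<Psi>\<^sub>A \<rho>\<^sub>A = X\<^sub>A" "\<Psi>\<^sub>B \<rho>\<^sub>B = X\<^sub>B"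
    and le: "Re (tr (H * ptrace_snd (dA * dB) (dB ^ (n - 1)) \<rho>)) \<le> Re (tr (H * (\<rho>\<^sub>A \<otimes>\<^sub>m \<rho>\<^sub>B))) + ?e"
    using feasible_bound[OF assms(1,2,3,5,7,8) H assms(10-13) \<rho>] by blast
  have "ereal (Re (tr (H * (\<rho>\<^sub>A \<otimes>\<^sub>m \<rho>\<^sub>B)))) \<le> c_opt dA dB \<Psi>\<^sub>A \<Psi>\<^sub>B X\<^sub>A X\<^sub>B H"
    unfolding c_opt_def using r by (intro Sup_upper) blast
  then have "ereal (Re (tr (H * (\<rho>\<^sub>A \<otimes>\<^sub>m \<rho>\<^sub>B)))) + ereal ?e \<le> c_opt dA dB \<Psi>\<^sub>A \<Psi>\<^sub>B X\<^sub>A X\<^sub>B H + ereal ?e"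
    by (rule add_right_mono)
  moreover have "ereal (Re (tr (H * ptrace_snd (dA * dB) (dB ^ (n - 1)) \<rho>)))
      \<le> ereal (Re (tr (H * (\<rho>\<^sub>A \<otimes>\<^sub>m \<rho>\<^sub>B)))) + ereal ?e" using le by simp
  ultimately show "ereal (Re (tr (H * ptrace_snd (dA * dB) (dB ^ (n - 1)) \<rho>)))
      \<le> c_opt dA dB \<Psi>\<^sub>A \<Psi>\<^sub>B X\<^sub>A X\<^sub>B H + ereal ?e" by (rule order_trans[rotated])
qed

end
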